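(* Let $c\ge 1$ and let $I=\langle\mathrm{Inc}(\mathbb{N})\cdot x^{\underline{a}}\rangle\subset K[X]=K[x_{i,j}\mid 1\le i\le c,\ j\ge 1]$, where $x^{\underline{a}}=\prod_{i=1}^{c}\prod_{j=1}^{\mu_r}x_{i,j}^{a_{i,j}}$ and $\underline{a}=(a_{i,j})\in\mathbb{N}_0^{c\times\mu_r}$ is a non-zero matrix whose non-zero columns are exactly those with indices $\mu_1<\mu_2<\dots<\mu_r$. Put $I_n=I\cap K[X_n]$, $A_n=K[X_n]/I_n$, and $b_j=\sum_{i=1}^{c}a_{i,\mu_j}$ for $j=1,\dots,r$. (a) If $n\ge\mu_r$, then $A_n$ is a Cohen-Macaulay ring of dimension $n(c-1)+\mu_r-1$. (b) Suppose $r\ge 2$ and put $\delta_r=\mu_r-\mu_{r-1}$, $J=\langle\mathrm{Inc}(\mathbb{N})\cdot\prod_{i=1}^{c}\prod_{j=1}^{\mu_{r-1}}x_{i,j}^{a_{i,j}}\rangle$, $J_n=J\cap K[X_n]$ and $B_n=K[X_n]/J_n$. If $n\ge\delta_r$, then \[ H_{A_n}(t)=\frac{1-t^{b_r}}{(1-t)^c}\,H_{A_{n-1}}(t)+\frac{t^{b_r}}{(1-t)^{c\delta_r}}\,H_{B_{n-\delta_r}}(t). \]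
   Context: $K$ is a field, $\mathbb{N}$ is the set of positive integers, $\mathbb{N}_0$ the set of non-negative integers, and $K[X]=K[x_{i,j}\mid 1\le i\le c,\ j\ge 1]$ is a standard graded polynomial ring. $\mathrm{Inc}(\mathbb{N})=\{\pi:\mathbb{N}\to\mathbb{N}\mid\pi(i)<\pi(i+1)\text{ for all }i\ge 1\}$ is the monoid of strictly increasing functions; it acts on $K[X]$ by $K$-algebra endomorphisms with $\pi\cdot x_{i,j}=x_{i,\pi(j)}$. For a monomial $m$, $\langle\mathrm{Inc}(\mathbb{N})\cdot m\rangle$ is the ideal of $K[X]$ generated by the orbit $\{\pi\cdot m\mid\pi\in\mathrm{Inc}(\mathbb{N})\}$. For $n\in\mathbb{N}_0$ put $K[X_n]=K[x_{i,j}\mid 1\le i\le c,\ 1\le j\le n]$ (so $K[X_0]=K$). For a homogeneous ideal $\mathfrak{a}$ of $K[X_n]$, the Hilbert series is $H_{K[X_n]/\mathfrak{a}}(t)=\sum_{j\ge 0}\dim_K[K[X_n]/\mathfrak{a}]_j\,t^j$. *)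

theory Defs
  imports
    "HOL-Algebra.Algebra"
    "HOL-Algebra.Algebraic_Closure_Type"
    "HOL-Library.Poly_Mapping"
    "HOL-Library.Extended_Nat"
    "HOL-Computational_Algebra.Formal_Power_Series"
begin

section \<open>Polynomial rings in variables $x_{i,j}$\<close>

text \<open>
  The variable $x_{i,j}$ has index \<open>(i, j)\<close>; a monomial is its exponent function and a
  polynomial maps monomials to coefficients. The type contains polynomials in all
  \<open>x\<^sub>i\<^sub>,\<^sub>j\<close> with \<open>i, j \<ge> 0\<close>; the actual rings $K[X]$ and $K[X_n]$ are cut out by the carrier.
\<close>

type_synonym mono = "(nat \<times> nat) \<Rightarrow>\<^sub>0 nat"
type_synonym 'k mpol = "mono \<Rightarrow>\<^sub>0 'k"

definition const_poly :: "'k::field \<Rightarrow> 'k mpol" where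
  "const_poly a = Poly_Mapping.single 0 a"

definition xvar :: "nat \<Rightarrow> nat \<Rightarrow> 'k::field mpol" where
  "xvar i j = Poly_Mapping.single (Poly_Mapping.single (i, j) 1) 1"

definition poly_ring :: "(nat \<times> nat) set \<Rightarrow> 'k::field mpol ring" where
  "poly_ring V = ring_of_type_algebra
     \<lparr>carrier := {p. \<forall>m \<in> Poly_Mapping.keys p. Poly_Mapping.keys m \<subseteq> V}\<rparr>"

definition KX :: "nat \<Rightarrow> 'k::field mpol ring" where
  "KX c = poly_ring ({1..c} \<times> {1..})"

definition KXn :: "nat \<Rightarrow> nat \<Rightarrow> 'k::field mpol ring" where
  "KXn c n = poly_ring ({1..c} \<times> {1..n})"

section \<open>The monoid of increasing maps and its orbit ideals\<close>

text \<open>The positive integers are \<open>{1..}\<close> inside \<^typ>\<open>nat\<close>; the value at 0 is irrelevant.\<close>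

definition Inc :: "(nat \<Rightarrow> nat) set" where
  "Inc = {\<pi>. \<forall>i\<ge>1. \<pi> i \<ge> 1 \<and> \<pi> i < \<pi> (i + 1)}"

text \<open>The \<open>K\<close>-algebra endomorphism substituting $x_{i,\pi(j)}$ for $x_{i,j}$.\<close>

definition inc_act :: "(nat \<Rightarrow> nat) \<Rightarrow> 'k::field mpol \<Rightarrow> 'k mpol" where
  "inc_act \<pi> p = (\<Sum>m \<in> Poly_Mapping.keys p. const_poly (Poly_Mapping.lookup p m) *
     (\<Prod>(i, j) \<in> Poly_Mapping.keys m. xvar i (\<pi> j) ^ Poly_Mapping.lookup m (i, j)))"

definition orbit_ideal :: "nat \<Rightarrow> 'k::field mpol \<Rightarrow> 'k mpol set" where
  "orbit_ideal c f = genideal (KX c) ((\<lambda>\<pi>. inc_act \<pi> f) ` Inc)"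

section \<open>Hilbert series\<close>

definition mono_degree :: "mono \<Rightarrow> nat" where
  "mono_degree m = (\<Sum>v \<in> Poly_Mapping.keys m. Poly_Mapping.lookup m v)"

definition forms :: "nat \<Rightarrow> nat \<Rightarrow> nat \<Rightarrow> 'k::field mpol set" where
  "forms c n j = {p \<in> carrier (KXn c n). \<forall>m \<in> Poly_Mapping.keys p. mono_degree m = j}"

text \<open>
  The component \<open>[K[X\<^sub>n]/\<aa>]\<^sub>j\<close> is the image of the forms of degree \<open>j\<close> in the quotient ring, and
  \<open>K\<close> acts on it through the image of the constant polynomials. For homogeneous \<open>\<aa>\<close> the
  components are finite-dimensional, so the description operator is well-defined.
\<close>

definition graded_dim :: "nat \<Rightarrow> nat \<Rightarrow> 'k::field mpol set \<Rightarrow> nat \<Rightarrow> nat" where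
  "graded_dim c n \<aa> j = ring.dim (KXn c n Quot \<aa>)
     ((\<lambda>a. \<aa> +>\<^bsub>KXn c n\<^esub> const_poly a) ` UNIV)
     ((\<lambda>p. \<aa> +>\<^bsub>KXn c n\<^esub> p) ` forms c n j)"

definition hilbert_series :: "nat \<Rightarrow> nat \<Rightarrow> 'k::field mpol set \<Rightarrow> rat fps" where
  "hilbert_series c n \<aa> = Abs_fps (\<lambda>j. of_nat (graded_dim c n \<aa> j))"

section \<open>Krull dimension, localization, depth, Cohen-Macaulay rings\<close>

text \<open>Since \<open>Sup {} = 0\<close> in \<^typ>\<open>enat\<close>, the zero ring gets dimension 0 instead of $-\infty$.\<close>

definition krull_dim :: "('a, 'b) ring_scheme \<Rightarrow> enat" where
  "krull_dim R = Sup {enat d | d. \<exists>P :: nat \<Rightarrow> 'a set.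
     (\<forall>i\<le>d. primeideal (P i) R) \<and> (\<forall>i<d. P i \<subset> P (Suc i))}"

definition regular_sequence :: "('a, 'b) ring_scheme \<Rightarrow> 'a list \<Rightarrow> bool" where
  "regular_sequence R xs \<longleftrightarrow> set xs \<subseteq> carrier R \<and> genideal R (set xs) \<noteq> carrier R \<and>
     (\<forall>i<length xs. \<forall>y\<in>carrier R.
        xs ! i \<otimes>\<^bsub>R\<^esub> y \<in> genideal R (set (take i xs)) \<longrightarrow> y \<in> genideal R (set (take i xs)))"

definition depth :: "('a, 'b) ring_scheme \<Rightarrow> 'a set \<Rightarrow> enat" where
  "depth R I = Sup {enat (length xs) | xs. set xs \<subseteq> I \<and> regular_sequence R xs}"

text \<open>A fraction \<open>a/s\<close> is the class of \<open>(a, s)\<close>.\<close>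

definition frac_rel :: "('a, 'b) ring_scheme \<Rightarrow> 'a set \<Rightarrow> (('a \<times> 'a) \<times> ('a \<times> 'a)) set" where
  "frac_rel R S = {((a, s), (b, t)). a \<in> carrier R \<and> s \<in> S \<and> b \<in> carrier R \<and> t \<in> S \<and>
     (\<exists>u\<in>S. u \<otimes>\<^bsub>R\<^esub> (t \<otimes>\<^bsub>R\<^esub> a \<ominus>\<^bsub>R\<^esub> s \<otimes>\<^bsub>R\<^esub> b) = \<zero>\<^bsub>R\<^esub>)}"

definition fraction :: "('a, 'b) ring_scheme \<Rightarrow> 'a set \<Rightarrow> 'a \<Rightarrow> 'a \<Rightarrow> ('a \<times> 'a) set" where
  "fraction R S a s = frac_rel R S `` {(a, s)}"

definition localization :: "('a, 'b) ring_scheme \<Rightarrow> 'a set \<Rightarrow> ('a \<times> 'a) set ring" where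
  "localization R S =
     \<lparr>carrier = (carrier R \<times> S) // frac_rel R S,
      monoid.mult = (\<lambda>A B. \<Union>(a, s)\<in>A. \<Union>(b, t)\<in>B. fraction R S (a \<otimes>\<^bsub>R\<^esub> b) (s \<otimes>\<^bsub>R\<^esub> t)),
      monoid.one = fraction R S \<one>\<^bsub>R\<^esub> \<one>\<^bsub>R\<^esub>,
      ring.zero = fraction R S \<zero>\<^bsub>R\<^esub> \<one>\<^bsub>R\<^esub>,
      ring.add = (\<lambda>A B. \<Union>(a, s)\<in>A. \<Union>(b, t)\<in>B.
        fraction R S (t \<otimes>\<^bsub>R\<^esub> a \<oplus>\<^bsub>R\<^esub> s \<otimes>\<^bsub>R\<^esub> b) (s \<otimes>\<^bsub>R\<^esub> t))\<rparr>"

definition cohen_macaulay_local :: "('a, 'b) ring_scheme \<Rightarrow> bool" where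
  "cohen_macaulay_local R \<longleftrightarrow> cring R \<and> noetherian_ring R \<and>
     (\<exists>!M. maximalideal M R) \<and> depth R (THE M. maximalideal M R) = krull_dim R"

definition cohen_macaulay :: "('a, 'b) ring_scheme \<Rightarrow> bool" where
  "cohen_macaulay R \<longleftrightarrow> cring R \<and> noetherian_ring R \<and>
     (\<forall>M. maximalideal M R \<longrightarrow> cohen_macaulay_local (localization R (carrier R - M)))"

end

theory Submission
  imports
    Defs
    "HOL-Library.Product_Lexorder"
    "HOL-Computational_Algebra.Polynomial"
begin

text \<open>
  A monomial lies in \<open>I\<^sub>n\<close> iff an increasing map moves the columns of the exponent matrix into
  \<open>1, \<dots>, n\<close> such that the result divides it. Sorting the monomials outside \<open>I\<^sub>n\<close> by whether
  their \<open>n\<close>-th column is divisible by the last column of \<open>a\<close> gives a recursion for their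
  generating function, hence (b).

  For (a), let \<open>L = \<mu>\<^sub>r\<close> and \<open>d = c n - (n + 1 - L)\<close>. A prime containing \<open>I\<^sub>n\<close> contains a variable
  from at least \<open>n + 1 - L\<close> columns, and strict chains of primes over an ideal containing all but
  \<open>d\<close> variables have length at most \<open>d\<close>, as any \<open>d + 1\<close> elements are algebraically dependent
  modulo it. Conversely, by Zariski's lemma every maximal ideal \<open>M\<close> contains a nonzero
  univariate polynomial \<open>g\<^sub>v\<close> in each variable \<open>v\<close>, where \<open>g\<^sub>v = v\<close> if \<open>v\<close> is in \<open>M\<close>. The
  elementary symmetric functions \<open>e\<^sub>d, \<dots>, e\<^sub>1\<close> of all the \<open>g\<^sub>v\<close> form, locally at \<open>M\<close>, a regular
  sequence modulo every ideal generated by \<open>c n - d\<close> variables. The exact sequences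
  \<open>0 \<rightarrow> R / (I : u) \<rightarrow> R / I \<rightarrow> R / (I, u) \<rightarrow> 0\<close> with \<open>u\<close> the last column of \<open>a\<close> placed in column
  \<open>n\<close> transfer this to \<open>I\<^sub>n\<close>, so the depth at \<open>M\<close> is at least \<open>d\<close>.
\<close>

section \<open>Localization and the Cohen-Macaulay property\<close>

text \<open>The Cohen-Macaulay condition concerns every maximal ideal \<open>M\<close>, and
  \<open>K\<close> is arbitrary: \<open>M\<close> need not belong to a point with coordinates in
  \<open>K\<close>, so it cannot be translated to the origin, and a finite \<open>K\<close> has too
  few linear forms for a generic choice. The symmetric functions of the \<open>g_v\<close> avoid
  both obstacles. They depend on \<open>M\<close> only, which is essential: an exact sequence
  transfers regularity only if one and the same sequence serves both outer terms. The choice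
  \<open>g_v = v\<close> inside \<open>M\<close> turns an ideal generated by variables of
  \<open>M\<close> into one generated by some of the \<open>g_v\<close>; an ideal containing a
  variable outside \<open>M\<close> becomes the unit ideal locally, so regularity is understood
  without properness. The number \<open>n + 1 - L\<close> is the size of the sets of variables that
  remain when the exact sequences are unwound, and it also bounds from below the number of variables
  in a prime over \<open>I_n\<close>. Hence the lower bound for the depth and the upper bound for
  chains of primes agree, and the general inequality between depth and dimension turns both into
  equalities.\<close>

lemma krull_dim_leI:
  assumes "\<And>k P. (\<forall>i\<le>k. primeideal (P i) R) \<Longrightarrow> (\<forall>i<k. P i \<subset> P (Suc i)) \<Longrightarrow> k \<le> d"
  shows "krull_dim R \<le> enat d"
  unfolding krull_dim_def by (rule Sup_least) (use assms in auto)

lemma krull_dim_geI: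
  assumes "\<forall>i\<le>d. primeideal (P i) R" "\<forall>i<d. P i \<subset> P (Suc i)"
  shows "enat d \<le> krull_dim R"
  unfolding krull_dim_def by (rule Sup_upper) (use assms in auto)

text \<open>The classical argument: an ideal maximal among those that contain \<open>B\<close> and
  avoid \<open>T\<close> is prime. Zorn's lemma applies since unions of chains stay in this
  family.\<close>

lemma (in cring) prime_avoiding_mult_set:
  assumes B: "ideal B R" and T: "T \<subseteq> carrier R" "\<one> \<in> T" "\<And>x y. x \<in> T \<Longrightarrow> y \<in> T \<Longrightarrow> x \<otimes> y \<in> T"
    and disj: "B \<inter> T = {}"
  obtains P where "primeideal P R" "B \<subseteq> P" "P \<inter> T = {}"
proof -
  define A where "A = {I. ideal I R \<and> B \<subseteq> I \<and> I \<inter> T = {}}"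
  have "\<exists>M\<in>A. \<forall>Y\<in>A. M \<subseteq> Y \<longrightarrow> Y = M"
  proof (rule subset_Zorn_nonempty)
    show "A \<noteq> {}" using B disj unfolding A_def by auto
  next
    fix C assume C: "C \<noteq> {}" "subset.chain A C"
    then have sub: "C \<subseteq> A" unfolding pred_on.chain_def by auto
    have "subset.chain {I. ideal I R} C"
      using C unfolding pred_on.chain_def A_def by auto
    from chain_Union_is_ideal[OF this] have "ideal (\<Union>C) R" using C(1) by simp
    then show "\<Union>C \<in> A" using sub C(1) unfolding A_def by blast
  qed
  then obtain M where M: "M \<in> A" and Mmax: "\<And>Y. Y \<in> A \<Longrightarrow> M \<subseteq> Y \<Longrightarrow> Y = M" by auto
  have MI: "ideal M R" and BM: "B \<subseteq> M" and MT: "M \<inter> T = {}" using M unfolding A_def by auto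
  interpret M: ideal M R by (rule MI)
  have meet: "\<exists>t\<in>T. \<exists>m\<in>M. \<exists>r\<in>carrier R. t = m \<oplus> r \<otimes> x"
    if x: "x \<in> carrier R" "x \<notin> M" for x
  proof -
    let ?Y = "M <+>\<^bsub>R\<^esub> (PIdl x)"
    have Y: "ideal ?Y R" by (rule add_ideals[OF MI cgenideal_ideal[OF x(1)]])
    have mY: "?Y = {m \<oplus> r \<otimes> x | m r. m \<in> M \<and> r \<in> carrier R}"
      unfolding set_add_def' cgenideal_def by blast
    have "M \<subseteq> ?Y"
    proof
      fix m assume "m \<in> M"
      moreover from this have "m = m \<oplus> \<zero> \<otimes> x" using x(1) M.Icarr by simp
      ultimately show "m \<in> ?Y" unfolding mY by blast
    qed
    moreover have "x \<in> ?Y"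
    proof -
      have "x = \<zero> \<oplus> \<one> \<otimes> x" using x by simp
      then show ?thesis unfolding mY using M.additive_subgroup_axioms additive_subgroup.zero_closed by blast
    qed
    ultimately have "?Y \<notin> A" using Mmax x(2) by blast
    then have "?Y \<inter> T \<noteq> {}" using Y \<open>M \<subseteq> ?Y\<close> BM unfolding A_def by auto
    then show ?thesis unfolding mY by blast
  qed
  have "primeideal M R"
  proof (rule primeidealI[OF MI is_cring])
    show "carrier R \<noteq> M" using MT T by auto
  next
    fix a b assume ab: "a \<in> carrier R" "b \<in> carrier R" "a \<otimes> b \<in> M"
    show "a \<in> M \<or> b \<in> M"
    proof (rule ccontr)
      assume "\<not> (a \<in> M \<or> b \<in> M)"
      then obtain t m r t' m' r' where *: "t \<in> T" "m \<in> M" "r \<in> carrier R" "t = m \<oplus> r \<otimes> a"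
         "t' \<in> T" "m' \<in> M" "r' \<in> carrier R" "t' = m' \<oplus> r' \<otimes> b"
        using meet ab by meson
      have mc: "m \<in> carrier R" "m' \<in> carrier R" using * M.Icarr by auto
      have tc: "t' \<in> carrier R" using T * by blast
      \<comment> \<open>Every summand has a factor in \<open>M\<close>, the last one because of
        \<open>a \<otimes> b \<in> M\<close>; so \<open>T\<close> would meet
        \<open>M\<close>.\<close>
      have "t \<otimes> t' = m \<otimes> t' \<oplus> (r \<otimes> a) \<otimes> m' \<oplus> (r \<otimes> r') \<otimes> (a \<otimes> b)"
        unfolding *(4) *(8) using mc ab * by algebra
      also have "\<dots> \<in> M"
        by (rule M.a_closed[OF M.a_closed])
          (use * ab mc tc in \<open>blast intro: M.I_l_closed M.I_r_closed m_closed\<close>)+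
      finally show False using T(3)[OF *(1) *(5)] MT by blast
    qed
  qed
  with BM MT show ?thesis using that by blast
qed

text \<open>A prime that avoids all products of powers of \<open>x\<close> with elements outside
  \<open>Q\<close> lies inside \<open>Q\<close> (exponent 0) and misses \<open>x\<close> (exponent
  1). Cancelling \<open>x\<close> modulo \<open>B\<close> one factor at a time shows that
  \<open>B\<close> avoids these products.\<close>

lemma (in cring) prime_below_nonzerodivisor:
  assumes Q: "primeideal Q R" and B: "ideal B R" "B \<subseteq> Q" and x: "x \<in> Q"
    and nonzerodivisor: "\<And>y. y \<in> carrier R \<Longrightarrow> x \<otimes> y \<in> B \<Longrightarrow> y \<in> B"
  obtains P where "primeideal P R" "B \<subseteq> P" "P \<subset> Q"
proof -
  interpret Q: primeideal Q R by (rule Q)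
  have xc: "x \<in> carrier R" using x Q.Icarr by blast
  define T where "T = {x [^] k \<otimes> s | (k::nat) s. s \<in> carrier R - Q}"
  have one: "\<one> \<in> carrier R - Q" using Q.I_notcarr Q.one_imp_carrier by auto
  obtain P where P: "primeideal P R" "B \<subseteq> P" "P \<inter> T = {}"
  proof (rule prime_avoiding_mult_set[OF B(1)])
    show "T \<subseteq> carrier R" unfolding T_def using xc by auto
    show "\<one> \<in> T" unfolding T_def using one by (intro CollectI exI[of _ 0] exI[of _ \<one>]) auto
    show "u \<otimes> v \<in> T" if "u \<in> T" "v \<in> T" for u v
    proof -
      from that obtain k s l t where uv: "u = x [^] (k::nat) \<otimes> s" "s \<in> carrier R - Q"
        "v = x [^] (l::nat) \<otimes> t" "t \<in> carrier R - Q" unfolding T_def by blast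
      have "u \<otimes> v = x [^] (k + l) \<otimes> (s \<otimes> t)"
        using uv xc by (simp add: nat_pow_mult[symmetric] m_ac)
      moreover have "s \<otimes> t \<in> carrier R - Q" using uv Q.I_prime by auto
      ultimately show ?thesis unfolding T_def by blast
    qed
    have "x [^] (k::nat) \<otimes> s \<in> B \<Longrightarrow> s \<in> carrier R \<Longrightarrow> s \<in> B" for k s
    proof (induction k)
      case (Suc k)
      have "x [^] Suc k \<otimes> s = x \<otimes> (x [^] k \<otimes> s)" using xc Suc.prems by (simp add: m_ac)
      then show ?case using nonzerodivisor[of "x [^] k \<otimes> s"] Suc xc by auto
    qed auto
    then show "B \<inter> T = {}" unfolding T_def using B(2) by blast
  qed (use that in auto)
  have sub: "P \<subseteq> Q"
  proof
    fix p assume p: "p \<in> P"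
    then have pc: "p \<in> carrier R" using P(1) by (meson ideal.Icarr primeideal.axioms(1))
    show "p \<in> Q"
    proof (rule ccontr)
      assume "p \<notin> Q"
      then have "x [^] (0::nat) \<otimes> p \<in> T" unfolding T_def using pc by blast
      then show False using P(3) p pc by auto
    qed
  qed
  have "x [^] (1::nat) \<otimes> \<one> \<in> T" unfolding T_def using one by blast
  then have "x \<notin> P" using P(3) xc by auto
  then show ?thesis using that[OF P(1,2)] sub x by blast
qed

text \<open>The chain is built downwards: it starts at a prime over the ideal of the whole sequence,
  and giving up the last remaining element allows one step to a smaller prime by
  \<open>prime_below_nonzerodivisor\<close>.\<close>

lemma (in cring) prime_chain_of_regular_sequence:
  assumes "regular_sequence R xs"
  obtains P where "\<forall>i\<le>length xs. primeideal (P i) R" "\<forall>i<length xs. P i \<subset> P (Suc i)"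
proof -
  have xs: "set xs \<subseteq> carrier R" "Idl (set xs) \<noteq> carrier R"
    and reg: "\<And>i y. i < length xs \<Longrightarrow> y \<in> carrier R \<Longrightarrow> xs ! i \<otimes> y \<in> Idl (set (take i xs)) \<Longrightarrow>
       y \<in> Idl (set (take i xs))"
    using assms unfolding regular_sequence_def by auto
  have subc: "set (take i xs) \<subseteq> carrier R" for i using xs(1) set_take_subset by fast
  have "\<exists>P. (\<forall>i\<le>j. primeideal (P i) R) \<and> (\<forall>i<j. P i \<subset> P (Suc i)) \<and>
      Idl (set (take (length xs - j) xs)) \<subseteq> P (0::nat)" if "j \<le> length xs" for j
    using that
  proof (induction j)
    case 0
    let ?B = "Idl (set xs)"
    have B: "ideal ?B R" by (rule genideal_ideal[OF xs(1)])
    have "\<one> \<notin> ?B" using ideal.one_imp_carrier[OF B] xs(2) by auto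
    then obtain P where "primeideal P R" "?B \<subseteq> P"
      using prime_avoiding_mult_set[OF B, of "{\<one>}"] by auto
    then show ?case by (intro exI[of _ "\<lambda>_. P"]) auto
  next
    case (Suc j)
    then obtain P where P: "\<forall>i\<le>j. primeideal (P i) R" "\<forall>i<j. P i \<subset> P (Suc i)"
      "Idl (set (take (length xs - j) xs)) \<subseteq> P 0" by auto
    let ?k = "length xs - Suc j"
    have k: "?k < length xs" "length xs - j = Suc ?k" using Suc.prems by auto
    have in_P: "set (take (Suc ?k) xs) \<subseteq> P 0"
      using genideal_self[OF subc] P(3) k(2) by auto
    obtain Q where Q: "primeideal Q R" "Idl (set (take ?k xs)) \<subseteq> Q" "Q \<subset> P 0"
    proof (rule prime_below_nonzerodivisor)
      show "primeideal (P 0) R" using P by simp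
      show "ideal (Idl (set (take ?k xs))) R" by (rule genideal_ideal[OF subc])
      have "set (take ?k xs) \<subseteq> P 0" using in_P k by (simp add: take_Suc_conv_app_nth)
      then show "Idl (set (take ?k xs)) \<subseteq> P 0"
        using \<open>primeideal (P 0) R\<close> genideal_minimal primeideal.axioms(1) by blast
      show "xs ! ?k \<in> P 0" using in_P k by (simp add: take_Suc_conv_app_nth)
    qed (use reg[OF k(1)] that in auto)
    let ?P = "\<lambda>i. case i of 0 \<Rightarrow> Q | Suc i \<Rightarrow> P i"
    have "\<forall>i\<le>Suc j. primeideal (?P i) R" using P Q by (auto split: nat.splits)
    moreover have "\<forall>i<Suc j. ?P i \<subset> ?P (Suc i)" using P Q by (auto split: nat.splits)
    ultimately show ?case using Q(2) by (intro exI[of _ ?P]) auto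
  qed
  from this[of "length xs"] show ?thesis using that by auto
qed

corollary (in cring) depth_le_krull_dim: "depth R I \<le> krull_dim R"
  unfolding depth_def
proof (rule Sup_least)
  fix e assume "e \<in> {enat (length xs) |xs. set xs \<subseteq> I \<and> regular_sequence R xs}"
  then obtain xs where "e = enat (length xs)" "regular_sequence R xs" by auto
  then show "e \<le> krull_dim R" using prime_chain_of_regular_sequence krull_dim_geI by metis
qed

section \<open>Localization at a multiplicative set\<close>

locale mult_subset = cring +
  fixes S
  assumes S_carrier: "S \<subseteq> carrier R" and one_S: "\<one> \<in> S"
    and mult_S: "\<And>x y. x \<in> S \<Longrightarrow> y \<in> S \<Longrightarrow> x \<otimes> y \<in> S"
begin

abbreviation "L \<equiv> localization R S"
abbreviation "fr \<equiv> fraction R S"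

lemma S_closed [simp]: "x \<in> S \<Longrightarrow> x \<in> carrier R" using S_carrier by auto

text \<open>Subtraction is eliminated here once, so that equality of fractions becomes a plain
  equation between multiples.\<close>

lemma frac_rel_iff: "((a, s), (b, t)) \<in> frac_rel R S \<longleftrightarrow> a \<in> carrier R \<and> s \<in> S \<and> b \<in> carrier R \<and> t \<in> S \<and>
     (\<exists>u\<in>S. u \<otimes> (t \<otimes> a) = u \<otimes> (s \<otimes> b))"
proof -
  have "u \<otimes> (t \<otimes> a \<ominus> s \<otimes> b) = \<zero> \<longleftrightarrow> u \<otimes> (t \<otimes> a) = u \<otimes> (s \<otimes> b)"
    if "a \<in> carrier R" "s \<in> S" "b \<in> carrier R" "t \<in> S" "u \<in> S" for u
  proof -
    have "u \<otimes> (t \<otimes> a \<ominus> s \<otimes> b) = u \<otimes> (t \<otimes> a) \<ominus> u \<otimes> (s \<otimes> b)"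
      using that by (simp add: r_distr a_minus_def r_minus)
    then show ?thesis using that by (simp add: r_right_minus_eq)
  qed
  then show ?thesis unfolding frac_rel_def by auto
qed

lemma equiv_frac_rel: "equiv (carrier R \<times> S) (frac_rel R S)"
proof (rule equivI)
  show "frac_rel R S \<subseteq> (carrier R \<times> S) \<times> (carrier R \<times> S)" unfolding frac_rel_def by auto
  show "refl_on (carrier R \<times> S) (frac_rel R S)"
    unfolding refl_on_def using one_S by (auto simp: frac_rel_iff)
  show "sym (frac_rel R S)" unfolding sym_def
  proof clarify
    fix a s b t assume "((a, s), (b, t)) \<in> frac_rel R S"
    then obtain u where "a \<in> carrier R" "s \<in> S" "b \<in> carrier R" "t \<in> S" "u \<in> S"
      "u \<otimes> (t \<otimes> a) = u \<otimes> (s \<otimes> b)" unfolding frac_rel_iff by auto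
    then show "((b, t), (a, s)) \<in> frac_rel R S" unfolding frac_rel_iff by metis
  qed
  show "trans (frac_rel R S)" unfolding trans_def
  proof clarify
    fix a s b t c r assume "((a, s), (b, t)) \<in> frac_rel R S" "((b, t), (c, r)) \<in> frac_rel R S"
    then obtain u v where *: "a \<in> carrier R" "s \<in> S" "b \<in> carrier R" "t \<in> S" "c \<in> carrier R" "r \<in> S"
      "u \<in> S" "v \<in> S" "u \<otimes> (t \<otimes> a) = u \<otimes> (s \<otimes> b)" "v \<otimes> (r \<otimes> b) = v \<otimes> (t \<otimes> c)"
      unfolding frac_rel_iff by auto
    \<comment> \<open>The multiplier contains the middle denominator \<open>t\<close> besides
      \<open>u\<close> and \<open>v\<close>, because \<open>t\<close> cannot be cancelled from the
      combined equation.\<close>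
    have "(u \<otimes> v \<otimes> t) \<otimes> (r \<otimes> a) = (v \<otimes> r) \<otimes> (u \<otimes> (t \<otimes> a))" using *(1-8) by (simp add: m_ac)
    also have "\<dots> = (u \<otimes> s) \<otimes> (v \<otimes> (r \<otimes> b))" unfolding *(9) using *(1-8) by (simp add: m_ac)
    also have "\<dots> = (u \<otimes> v \<otimes> t) \<otimes> (s \<otimes> c)" unfolding *(10) using *(1-8) by (simp add: m_ac)
    finally show "((a, s), (c, r)) \<in> frac_rel R S" unfolding frac_rel_iff using * mult_S by blast
  qed
qed

lemma frac_eq_iff:
  assumes "a \<in> carrier R" "s \<in> S" "b \<in> carrier R" "t \<in> S"
  shows "fr a s = fr b t \<longleftrightarrow> (\<exists>u\<in>S. u \<otimes> (t \<otimes> a) = u \<otimes> (s \<otimes> b))"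
  unfolding fraction_def using eq_equiv_class_iff[OF equiv_frac_rel, of "(a,s)" "(b,t)"] assms
  by (auto simp: frac_rel_iff)

lemma frac_eqI:
  assumes "a \<in> carrier R" "s \<in> S" "b \<in> carrier R" "t \<in> S" "t \<otimes> a = s \<otimes> b"
  shows "fr a s = fr b t"
  using frac_eq_iff[OF assms(1-4)] one_S assms(5) by auto

lemma frac_closed [simp]: "a \<in> carrier R \<Longrightarrow> s \<in> S \<Longrightarrow> fr a s \<in> carrier L"
  unfolding localization_def fraction_def by (simp add: quotientI)

lemma carrier_L_cases:
  assumes "x \<in> carrier L" obtains a s where "a \<in> carrier R" "s \<in> S" "x = fr a s"
  using assms unfolding localization_def fraction_def quotient_def by auto

lemma frac_mem: "a \<in> carrier R \<Longrightarrow> s \<in> S \<Longrightarrow> (b, t) \<in> fr a s \<longleftrightarrow> b \<in> carrier R \<and> t \<in> S \<and> fr b t = fr a s"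
  unfolding fraction_def
  using equiv_class_eq_iff[OF equiv_frac_rel, of "(a,s)" "(b,t)"] by auto

text \<open>The product of classes is defined as a union over all representatives; each choice gives
  the same class, so the union collapses to it.\<close>

lemma frac_mult:
  assumes "a \<in> carrier R" "s \<in> S" "b \<in> carrier R" "t \<in> S"
  shows "fr a s \<otimes>\<^bsub>L\<^esub> fr b t = fr (a \<otimes> b) (s \<otimes> t)"
proof -
  have "fr (a' \<otimes> b') (s' \<otimes> t') = fr (a \<otimes> b) (s \<otimes> t)"
    if h1: "(a', s') \<in> fr a s" and h2: "(b', t') \<in> fr b t" for a' s' b' t'
  proof -
    have c: "a' \<in> carrier R" "s' \<in> S" "b' \<in> carrier R" "t' \<in> S" using h1 h2 assms by (auto simp: frac_mem)
    obtain u where u: "u \<in> S" "u \<otimes> (s \<otimes> a') = u \<otimes> (s' \<otimes> a)"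
      using h1 frac_eq_iff[OF c(1,2) assms(1,2)] unfolding frac_mem[OF assms(1,2)] by auto
    obtain v where v: "v \<in> S" "v \<otimes> (t \<otimes> b') = v \<otimes> (t' \<otimes> b)"
      using h2 frac_eq_iff[OF c(3,4) assms(3,4)] unfolding frac_mem[OF assms(3,4)] by auto
    have "(u \<otimes> v) \<otimes> ((s \<otimes> t) \<otimes> (a' \<otimes> b')) = (u \<otimes> (s \<otimes> a')) \<otimes> (v \<otimes> (t \<otimes> b'))"
      using assms c u(1) v(1) by (simp add: m_ac)
    also have "\<dots> = (u \<otimes> v) \<otimes> ((s' \<otimes> t') \<otimes> (a \<otimes> b))"
      unfolding u(2) v(2) using assms c u(1) v(1) by (simp add: m_ac)
    finally show ?thesis
      using assms c u(1) v(1) mult_S frac_eq_iff[of "a' \<otimes> b'" "s' \<otimes> t'" "a \<otimes> b" "s \<otimes> t"] by auto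
  qed
  moreover have "(a, s) \<in> fr a s" "(b, t) \<in> fr b t" using assms by (auto simp: frac_mem)
  ultimately have "(\<Union>(a, s)\<in>fr a s. \<Union>(b, t)\<in>fr b t. fr (a \<otimes> b) (s \<otimes> t)) = fr (a \<otimes> b) (s \<otimes> t)"
    by fast
  then show ?thesis by (simp add: localization_def)
qed

lemma frac_add:
  assumes "a \<in> carrier R" "s \<in> S" "b \<in> carrier R" "t \<in> S"
  shows "fr a s \<oplus>\<^bsub>L\<^esub> fr b t = fr (t \<otimes> a \<oplus> s \<otimes> b) (s \<otimes> t)"
proof -
  have "fr (t' \<otimes> a' \<oplus> s' \<otimes> b') (s' \<otimes> t') = fr (t \<otimes> a \<oplus> s \<otimes> b) (s \<otimes> t)"
    if h1: "(a', s') \<in> fr a s" and h2: "(b', t') \<in> fr b t" for a' s' b' t'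
  proof -
    have c: "a' \<in> carrier R" "s' \<in> S" "b' \<in> carrier R" "t' \<in> S" using h1 h2 assms by (auto simp: frac_mem)
    obtain u where u: "u \<in> S" "u \<otimes> (s \<otimes> a') = u \<otimes> (s' \<otimes> a)"
      using h1 frac_eq_iff[OF c(1,2) assms(1,2)] unfolding frac_mem[OF assms(1,2)] by auto
    obtain v where v: "v \<in> S" "v \<otimes> (t \<otimes> b') = v \<otimes> (t' \<otimes> b)"
      using h2 frac_eq_iff[OF c(3,4) assms(3,4)] unfolding frac_mem[OF assms(3,4)] by auto
    have "(u \<otimes> v) \<otimes> ((s \<otimes> t) \<otimes> (t' \<otimes> a' \<oplus> s' \<otimes> b'))
       = (v \<otimes> t \<otimes> t') \<otimes> (u \<otimes> (s \<otimes> a')) \<oplus> (u \<otimes> s \<otimes> s') \<otimes> (v \<otimes> (t \<otimes> b'))"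
      using assms c u(1) v(1) by (simp add: m_ac r_distr)
    also have "\<dots> = (u \<otimes> v) \<otimes> ((s' \<otimes> t') \<otimes> (t \<otimes> a \<oplus> s \<otimes> b))"
      unfolding u(2) v(2) using assms c u(1) v(1) by (simp add: m_ac r_distr)
    finally show ?thesis
      using assms c u(1) v(1) mult_S
        frac_eq_iff[of "t' \<otimes> a' \<oplus> s' \<otimes> b'" "s' \<otimes> t'" "t \<otimes> a \<oplus> s \<otimes> b" "s \<otimes> t"] by auto
  qed
  moreover have "(a, s) \<in> fr a s" "(b, t) \<in> fr b t" using assms by (auto simp: frac_mem)
  ultimately have "(\<Union>(a, s)\<in>fr a s. \<Union>(b, t)\<in>fr b t. fr (t \<otimes> a \<oplus> s \<otimes> b) (s \<otimes> t))
      = fr (t \<otimes> a \<oplus> s \<otimes> b) (s \<otimes> t)"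
    by fast
  then show ?thesis by (simp add: localization_def)
qed

lemma one_L: "\<one>\<^bsub>L\<^esub> = fr \<one> \<one>" and zero_L: "\<zero>\<^bsub>L\<^esub> = fr \<zero> \<one>"
  by (simp_all add: localization_def)

lemma cring_L: "cring L"
proof (rule cringI)
  show "abelian_group L"
  proof (rule abelian_groupI)
    fix x y assume "x \<in> carrier L" "y \<in> carrier L"
    then show "x \<oplus>\<^bsub>L\<^esub> y \<in> carrier L"
      by (elim carrier_L_cases) (simp add: frac_add mult_S)
  next
    show "\<zero>\<^bsub>L\<^esub> \<in> carrier L" by (simp add: zero_L one_S)
  next
    fix x y z assume "x \<in> carrier L" "y \<in> carrier L" "z \<in> carrier L"
    then show "x \<oplus>\<^bsub>L\<^esub> y \<oplus>\<^bsub>L\<^esub> z = x \<oplus>\<^bsub>L\<^esub> (y \<oplus>\<^bsub>L\<^esub> z)"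
      by (elim carrier_L_cases) (simp add: frac_add mult_S, simp add: m_ac r_distr a_ac)
  next
    fix x y assume "x \<in> carrier L" "y \<in> carrier L"
    then show "x \<oplus>\<^bsub>L\<^esub> y = y \<oplus>\<^bsub>L\<^esub> x"
      by (elim carrier_L_cases) (simp add: frac_add mult_S, simp add: m_ac r_distr a_ac)
  next
    fix x assume "x \<in> carrier L"
    then show "\<zero>\<^bsub>L\<^esub> \<oplus>\<^bsub>L\<^esub> x = x"
      by (elim carrier_L_cases) (simp add: frac_add zero_L one_S)
  next
    fix x assume "x \<in> carrier L"
    then obtain a s where as: "a \<in> carrier R" "s \<in> S" "x = fr a s" by (rule carrier_L_cases)
    have "fr (\<ominus> a) s \<oplus>\<^bsub>L\<^esub> x = \<zero>\<^bsub>L\<^esub>"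
      using as by (simp add: frac_add zero_L mult_S r_minus l_neg)
        (intro frac_eqI, auto simp: mult_S one_S)
    then show "\<exists>y\<in>carrier L. y \<oplus>\<^bsub>L\<^esub> x = \<zero>\<^bsub>L\<^esub>" using as frac_closed[of "\<ominus> a" s] by auto
  qed
next
  show "Group.comm_monoid L"
  proof (rule comm_monoidI)
    fix x y assume "x \<in> carrier L" "y \<in> carrier L"
    then show "x \<otimes>\<^bsub>L\<^esub> y \<in> carrier L"
      by (elim carrier_L_cases) (simp add: frac_mult mult_S)
  next
    show "\<one>\<^bsub>L\<^esub> \<in> carrier L" by (simp add: one_L one_S)
  next
    fix x y z assume "x \<in> carrier L" "y \<in> carrier L" "z \<in> carrier L"
    then show "x \<otimes>\<^bsub>L\<^esub> y \<otimes>\<^bsub>L\<^esub> z = x \<otimes>\<^bsub>L\<^esub> (y \<otimes>\<^bsub>L\<^esub> z)"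
      by (elim carrier_L_cases) (simp add: frac_mult mult_S m_assoc)
  next
    fix x assume "x \<in> carrier L"
    then show "\<one>\<^bsub>L\<^esub> \<otimes>\<^bsub>L\<^esub> x = x"
      by (elim carrier_L_cases) (simp add: frac_mult one_L one_S)
  next
    fix x y assume "x \<in> carrier L" "y \<in> carrier L"
    then show "x \<otimes>\<^bsub>L\<^esub> y = y \<otimes>\<^bsub>L\<^esub> x"
      by (elim carrier_L_cases) (simp add: frac_mult mult_S m_comm)
  qed
next
  fix x y z assume "x \<in> carrier L" "y \<in> carrier L" "z \<in> carrier L"
  then obtain a s b t c r where "a \<in> carrier R" "s \<in> S" "x = fr a s"
    "b \<in> carrier R" "t \<in> S" "y = fr b t" "c \<in> carrier R" "r \<in> S" "z = fr c r"
    by (elim carrier_L_cases) blast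
  then show "(x \<oplus>\<^bsub>L\<^esub> y) \<otimes>\<^bsub>L\<^esub> z = x \<otimes>\<^bsub>L\<^esub> z \<oplus>\<^bsub>L\<^esub> y \<otimes>\<^bsub>L\<^esub> z"
    by (simp add: frac_mult frac_add mult_S) (intro frac_eqI, auto simp: mult_S m_ac r_distr l_distr)
qed

sublocale L: cring L by (rule cring_L)

definition ext :: "'a set \<Rightarrow> ('a \<times> 'a) set set" where
  "ext B = {fr a s | a s. a \<in> B \<and> s \<in> S}"

definition contr :: "('a \<times> 'a) set set \<Rightarrow> 'a set" where
  "contr Q = {a \<in> carrier R. fr a \<one> \<in> Q}"

lemma frac_split: "a \<in> carrier R \<Longrightarrow> s \<in> S \<Longrightarrow> fr a s = fr \<one> s \<otimes>\<^bsub>L\<^esub> fr a \<one>"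
  by (simp add: frac_mult one_S)

lemma frac_split': "a \<in> carrier R \<Longrightarrow> s \<in> S \<Longrightarrow> fr a \<one> = fr s \<one> \<otimes>\<^bsub>L\<^esub> fr a s"
  by (simp add: frac_mult one_S) (intro frac_eqI, auto simp: one_S)

lemma ring_hom_frac: "ring_hom_cring R L (\<lambda>a. fr a \<one>)"
  by (intro ring_hom_cringI ring_hom_memI cring_L is_cring)
     (auto simp: one_S frac_mult frac_add one_L)

text \<open>A fraction may lie in \<open>ext B\<close> through another representative, so its own
  numerator is in \<open>B\<close> only after multiplication by an element of \<open>S\<close>. The
  multipliers in the local regularity conditions below originate here.\<close>

lemma frac_mem_ext_iff:
  assumes "ideal B R" "a \<in> carrier R" "s \<in> S"
  shows "fr a s \<in> ext B \<longleftrightarrow> (\<exists>u\<in>S. u \<otimes> a \<in> B)"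
proof
  interpret B: ideal B R by fact
  assume "fr a s \<in> ext B"
  then obtain b t where b: "b \<in> B" "t \<in> S" "fr a s = fr b t" unfolding ext_def by auto
  then obtain u where u: "u \<in> S" "u \<otimes> (t \<otimes> a) = u \<otimes> (s \<otimes> b)"
    using frac_eq_iff[of a s b t] assms B.Icarr by auto
  have "(u \<otimes> t) \<otimes> a = (u \<otimes> s) \<otimes> b" using u b assms B.Icarr by (simp add: m_assoc)
  also have "\<dots> \<in> B" using u b assms B.I_l_closed by auto
  finally show "\<exists>u\<in>S. u \<otimes> a \<in> B" using u b mult_S by blast
next
  assume "\<exists>u\<in>S. u \<otimes> a \<in> B"
  then obtain u where u: "u \<in> S" "u \<otimes> a \<in> B" by auto
  have "fr a s = fr (u \<otimes> a) (u \<otimes> s)"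
    using u assms by (intro frac_eqI) (auto simp: mult_S m_ac)
  then show "fr a s \<in> ext B" unfolding ext_def using u assms mult_S by blast
qed

lemma ideal_ext:
  assumes "ideal B R" shows "ideal (ext B) L"
proof -
  interpret B: ideal B R by fact
  have zeroB: "\<zero> \<in> B" by (rule additive_subgroup.zero_closed) (rule B.additive_subgroup_axioms)
  show ?thesis
  proof (rule idealI)
    show "subgroup (ext B) (add_monoid L)"
    proof (rule L.add.subgroupI)
      show "ext B \<subseteq> carrier L" unfolding ext_def using B.Icarr by auto
      show "ext B \<noteq> {}" unfolding ext_def using zeroB one_S by blast
      fix x assume "x \<in> ext B"
      then obtain a s where as: "a \<in> B" "s \<in> S" "x = fr a s" unfolding ext_def by auto
      have "fr (\<ominus> a) s \<oplus>\<^bsub>L\<^esub> x = \<zero>\<^bsub>L\<^esub>"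
        using as B.Icarr by (simp add: frac_add zero_L mult_S r_minus l_neg)
         (intro frac_eqI, auto simp: mult_S one_S)
      then have "\<ominus>\<^bsub>L\<^esub> x = fr (\<ominus> a) s"
        using as B.Icarr by (intro L.minus_equality) auto
      then show "\<ominus>\<^bsub>L\<^esub> x \<in> ext B" unfolding ext_def using as B.a_inv_closed by auto
    next
      fix x y assume "x \<in> ext B" "y \<in> ext B"
      then obtain a s b t where as: "a \<in> B" "s \<in> S" "x = fr a s" "b \<in> B" "t \<in> S" "y = fr b t"
        unfolding ext_def by auto
      then have "x \<oplus>\<^bsub>L\<^esub> y = fr (t \<otimes> a \<oplus> s \<otimes> b) (s \<otimes> t)" using B.Icarr by (simp add: frac_add)
      moreover have "t \<otimes> a \<oplus> s \<otimes> b \<in> B" using as by (intro B.a_closed B.I_l_closed) auto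
      ultimately show "x \<oplus>\<^bsub>L\<^esub> y \<in> ext B" unfolding ext_def using as mult_S by blast
    qed
  next
    fix x y assume "x \<in> ext B" "y \<in> carrier L"
    then obtain a s b t where as: "a \<in> B" "s \<in> S" "x = fr a s" "b \<in> carrier R" "t \<in> S" "y = fr b t"
      unfolding ext_def by (auto elim!: carrier_L_cases)
    then have "y \<otimes>\<^bsub>L\<^esub> x = fr (b \<otimes> a) (t \<otimes> s)" using B.Icarr by (simp add: frac_mult)
    moreover have "b \<otimes> a \<in> B" using as B.I_l_closed by auto
    ultimately show "y \<otimes>\<^bsub>L\<^esub> x \<in> ext B" unfolding ext_def using as mult_S by blast
    moreover have "x \<otimes>\<^bsub>L\<^esub> y = y \<otimes>\<^bsub>L\<^esub> x" using as B.Icarr by (intro L.m_comm) auto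
    ultimately show "x \<otimes>\<^bsub>L\<^esub> y \<in> ext B" by simp
  qed (rule L.ring_axioms)
qed

lemma ideal_contr:
  assumes "ideal Q L" shows "ideal (contr Q) R"
proof -
  interpret h: ring_hom_cring R L "\<lambda>a. fr a \<one>" by (rule ring_hom_frac)
  have "ring_hom_ring R L (\<lambda>a. fr a \<one>)" by (intro ring_hom_ringI2 ring_axioms L.ring_axioms h.homh)
  from ring_hom_ring.ideal_vimage[OF this assms] show ?thesis unfolding contr_def .
qed

text \<open>The fractions \<open>a/s\<close> and \<open>a/1\<close> are multiples of each other, so
  an ideal is determined by its elements with denominator 1. Consequently contraction is injective,
  and generators of the contraction generate the ideal.\<close>

lemma ext_contr:
  assumes "ideal Q L" shows "ext (contr Q) = Q"
proof -
  interpret Q: ideal Q L by fact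
  show ?thesis
  proof (intro equalityI subsetI)
    fix x assume "x \<in> ext (contr Q)"
    then obtain a s where as: "a \<in> carrier R" "fr a \<one> \<in> Q" "s \<in> S" "x = fr a s"
      unfolding ext_def contr_def by auto
    show "x \<in> Q" unfolding as(4) frac_split[OF as(1,3)] using as by (intro Q.I_l_closed) auto
  next
    fix x assume x: "x \<in> Q"
    then obtain a s where as: "a \<in> carrier R" "s \<in> S" "x = fr a s"
      using Q.Icarr carrier_L_cases by metis
    have "fr a \<one> \<in> Q" unfolding frac_split'[OF as(1,2)] using x as one_S by (intro Q.I_l_closed) auto
    then show "x \<in> ext (contr Q)" unfolding ext_def contr_def using as by auto
  qed
qed

lemma genideal_frac_image:
  assumes F: "F \<subseteq> carrier R"
  shows "genideal L ((\<lambda>a. fr a \<one>) ` F) = ext (Idl F)"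
proof
  have FI: "ideal (Idl F) R" by (rule genideal_ideal[OF F])
  have Fc: "(\<lambda>a. fr a \<one>) ` F \<subseteq> carrier L" using F one_S by auto
  have "(\<lambda>a. fr a \<one>) ` F \<subseteq> ext (Idl F)" unfolding ext_def using genideal_self[OF F] one_S by auto
  then show "genideal L ((\<lambda>a. fr a \<one>) ` F) \<subseteq> ext (Idl F)"
    by (rule L.genideal_minimal[OF ideal_ext[OF FI]])
  let ?G = "genideal L ((\<lambda>a. fr a \<one>) ` F)"
  have G: "ideal ?G L" by (rule L.genideal_ideal[OF Fc])
  have "F \<subseteq> contr ?G" unfolding contr_def using L.genideal_self[OF Fc] F by auto
  then have "Idl F \<subseteq> contr ?G" by (rule genideal_minimal[OF ideal_contr[OF G]])
  then have "ext (Idl F) \<subseteq> ext (contr ?G)" unfolding ext_def by blast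
  then show "ext (Idl F) \<subseteq> ?G" unfolding ext_contr[OF G] .
qed

lemma noetherian_L:
  assumes "noetherian_ring R" shows "noetherian_ring L"
proof (rule L.noetherian_ringI)
  fix Q assume Q: "ideal Q L"
  obtain F where "F \<subseteq> carrier R" "finite F" "contr Q = Idl F"
    using noetherian_ring.finetely_gen[OF assms ideal_contr[OF Q]] by auto
  then show "\<exists>A\<subseteq>carrier L. finite A \<and> Q = genideal L A"
    using genideal_frac_image ext_contr[OF Q] one_S
    by (intro exI[of _ "(\<lambda>a. fr a \<one>) ` F"]) auto
qed

lemma primeideal_contr:
  assumes "primeideal Q L" shows "primeideal (contr Q) R"
proof -
  interpret Q: primeideal Q L by fact
  show ?thesis
  proof (rule primeidealI[OF ideal_contr is_cring])
    show "ideal Q L" by (rule Q.is_ideal)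
    have "\<one>\<^bsub>L\<^esub> \<notin> Q" using Q.I_notcarr Q.one_imp_carrier by auto
    then have "\<one> \<notin> contr Q" unfolding contr_def one_L by simp
    then show "carrier R \<noteq> contr Q" by auto
  next
    fix a b assume "a \<in> carrier R" "b \<in> carrier R" "a \<otimes> b \<in> contr Q"
    then show "a \<in> contr Q \<or> b \<in> contr Q"
      unfolding contr_def using Q.I_prime[of "fr a \<one>" "fr b \<one>"] one_S by (auto simp: frac_mult)
  qed
qed

lemma contr_strict_mono:
  assumes "ideal P L" "ideal Q L" "P \<subset> Q" shows "contr P \<subset> contr Q"
proof -
  have "contr P \<subseteq> contr Q" unfolding contr_def using assms(3) by auto
  moreover have "contr P \<noteq> contr Q"
  proof
    assume "contr P = contr Q"
    then have "ext (contr P) = ext (contr Q)" by (rule arg_cong)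
    then have "P = Q" unfolding ext_contr[OF assms(1)] ext_contr[OF assms(2)] .
    then show False using assms(3) by blast
  qed
  ultimately show ?thesis by auto
qed

text \<open>Used in both directions: to bound the dimension of a localization by chains in
  \<open>R\<close>, and to obtain chains in \<open>R\<close> from a regular sequence in a
  localization.\<close>

lemma contr_prime_chain:
  assumes "\<forall>i\<le>k. primeideal (P i) L" "\<forall>i<k. P i \<subset> P (Suc i)"
  shows "\<forall>i\<le>k. primeideal (contr (P i)) R" "\<forall>i<k. contr (P i) \<subset> contr (P (Suc i))"
proof -
  show "\<forall>i\<le>k. primeideal (contr (P i)) R" using assms(1) primeideal_contr by blast
  have "ideal (P i) L" if "i \<le> k" for i using assms(1) that primeideal.axioms(1) by blast
  then show "\<forall>i<k. contr (P i) \<subset> contr (P (Suc i))" using assms(2) contr_strict_mono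
    by (meson Suc_leI less_imp_le_nat)
qed

end

section \<open>Localization at a maximal ideal\<close>

locale maximal_localization = cring +
  fixes M assumes maxM: "maximalideal M R"
begin

sublocale M: maximalideal M R by (rule maxM)

lemma primeM: "primeideal M R" by (rule maximalideal_prime[OF maxM])

sublocale mult_subset R "carrier R - M"
proof unfold_locales
  interpret P: primeideal M R by (rule primeM)
  show "\<one> \<in> carrier R - M" using M.I_notcarr M.one_imp_carrier by auto
  show "x \<otimes> y \<in> carrier R - M" if "x \<in> carrier R - M" "y \<in> carrier R - M" for x y
    using that P.I_prime by auto
qed auto

lemma one_notin_ext: "B \<subseteq> M \<Longrightarrow> ideal B R \<Longrightarrow> \<one>\<^bsub>L\<^esub> \<notin> ext B"
  unfolding one_L using frac_mem_ext_iff[of B \<one> \<one>] one_S by auto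

text \<open>A numerator outside \<open>M\<close> would make the fraction a unit and the ideal
  improper.\<close>

lemma proper_ideal_le_ext:
  assumes "ideal Q L" "Q \<noteq> carrier L" shows "Q \<subseteq> ext M"
proof -
  interpret Q: ideal Q L by fact
  have "contr Q \<subseteq> M"
  proof
    fix a assume "a \<in> contr Q"
    then have a: "a \<in> carrier R" "fr a \<one> \<in> Q" unfolding contr_def by auto
    show "a \<in> M"
    proof (rule ccontr)
      assume "a \<notin> M"
      then have aS: "a \<in> carrier R - M" using a by auto
      have "fr \<one> a \<otimes>\<^bsub>L\<^esub> fr a \<one> = \<one>\<^bsub>L\<^esub>"
        using aS one_S unfolding one_L by (subst frac_mult) (simp_all, intro frac_eqI, auto)
      then have "\<one>\<^bsub>L\<^esub> \<in> Q" using Q.I_l_closed[OF a(2), of "fr \<one> a"] aS by auto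
      then show False using assms(2) Q.one_imp_carrier by simp
    qed
  qed
  then show ?thesis using ext_contr[OF assms(1)] unfolding ext_def by blast
qed

lemma maximalideal_L_iff: "maximalideal Q L \<longleftrightarrow> Q = ext M"
proof
  have E: "ideal (ext M) L" by (rule ideal_ext[OF M.is_ideal])
  have ne: "ext M \<noteq> carrier L" using one_notin_ext[OF _ M.is_ideal] L.one_closed by auto
  { assume Q: "maximalideal Q L"
    then have "ideal Q L" "carrier L \<noteq> Q" by (auto simp: maximalideal_def maximalideal_axioms_def)
    then have "Q \<subseteq> ext M" using proper_ideal_le_ext by auto
    then show "Q = ext M"
      using maximalideal.I_maximal[OF Q E] ne ideal.Icarr[OF E] by blast }
  assume "Q = ext M"
  then show "maximalideal Q L"
    using E ne proper_ideal_le_ext by (auto intro!: maximalidealI)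
qed

text \<open>By \<open>frac_mem_ext_iff\<close>, regularity of the images is regularity in
  \<open>R\<close> up to factors outside \<open>M\<close>; this is the form in which the sequence is
  supplied later.\<close>

lemma regular_sequence_L:
  assumes xs: "set xs \<subseteq> M"
    and reg: "\<And>i y. i < length xs \<Longrightarrow> y \<in> carrier R \<Longrightarrow> xs ! i \<otimes> y \<in> Idl (set (take i xs)) \<Longrightarrow>
       \<exists>u\<in>carrier R - M. u \<otimes> y \<in> Idl (set (take i xs))"
  shows "regular_sequence L (map (\<lambda>a. fr a \<one>) xs)"
proof -
  let ?f = "\<lambda>a. fr a \<one>"
  have xsc: "set xs \<subseteq> carrier R" using xs M.Icarr by auto
  have subc: "set (take i xs) \<subseteq> carrier R" for i using xsc set_take_subset by fast
  have gen: "genideal L (set (take i (map ?f xs))) = ext (Idl (set (take i xs)))" for i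
    using genideal_frac_image[OF subc, of i] by (simp add: take_map)
  show ?thesis unfolding regular_sequence_def
  proof (intro conjI allI impI ballI)
    show "set (map ?f xs) \<subseteq> carrier L" using xsc one_S by auto
    have "Idl (set xs) \<subseteq> M" by (rule genideal_minimal[OF M.is_ideal xs])
    then have "\<one>\<^bsub>L\<^esub> \<notin> ext (Idl (set xs))" using one_notin_ext genideal_ideal[OF xsc] by auto
    then show "genideal L (set (map ?f xs)) \<noteq> carrier L" using gen[of "length xs"] L.one_closed by auto
  next
    fix i y assume i: "i < length (map ?f xs)" and y: "y \<in> carrier L"
      and prod: "map ?f xs ! i \<otimes>\<^bsub>L\<^esub> y \<in> genideal L (set (take i (map ?f xs)))"
    obtain b t where b: "b \<in> carrier R" "t \<in> carrier R - M" "y = fr b t"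
      by (rule carrier_L_cases[OF y])
    have I: "ideal (Idl (set (take i xs))) R" by (rule genideal_ideal[OF subc])
    have xi: "xs ! i \<in> carrier R" using i xsc by auto
    have "fr (xs ! i \<otimes> b) t \<in> ext (Idl (set (take i xs)))"
      using prod i b xi one_S unfolding gen by (simp add: frac_mult)
    then obtain u where u: "u \<in> carrier R - M" "u \<otimes> (xs ! i \<otimes> b) \<in> Idl (set (take i xs))"
      using frac_mem_ext_iff[OF I, of "xs ! i \<otimes> b" t] xi b by auto
    \<comment> \<open>The factor \<open>u\<close> that cleared the denominators is absorbed into
      \<open>b\<close>, so that \<open>reg\<close> applies to a multiple of \<open>xs ! i\<close>
      inside the ideal itself.\<close>
    have "xs ! i \<otimes> (u \<otimes> b) \<in> Idl (set (take i xs))" using u xi b by (simp add: m_lcomm)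
    then obtain v where v: "v \<in> carrier R - M" "v \<otimes> (u \<otimes> b) \<in> Idl (set (take i xs))"
      using reg[of i "u \<otimes> b"] i u b by auto
    then have "(v \<otimes> u) \<otimes> b \<in> Idl (set (take i xs))" "v \<otimes> u \<in> carrier R - M"
      using u b mult_S by (auto simp: m_assoc)
    then show "y \<in> genideal L (set (take i (map ?f xs)))"
      unfolding gen using frac_mem_ext_iff[OF I b(1,2)] b(3) by blast
  qed
qed

end

text \<open>At each maximal ideal the sequence gives depth at least \<open>d\<close>, contraction of
  primes gives dimension at most \<open>d\<close>, and \<open>depth_le_krull_dim\<close> forces
  equality.\<close>

lemma (in cring) cohen_macaulay_of_local_sequences:
  assumes noeth: "noetherian_ring R" and nontriv: "carrier R \<noteq> {\<zero>}"
    and chains: "\<And>k P. (\<forall>i\<le>k. primeideal (P i) R) \<Longrightarrow> (\<forall>i<k. P i \<subset> P (Suc i)) \<Longrightarrow> k \<le> d"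
    and seqs: "\<And>M. maximalideal M R \<Longrightarrow> \<exists>xs. set xs \<subseteq> M \<and> length xs = d \<and>
      (\<forall>i<d. \<forall>y\<in>carrier R. xs ! i \<otimes> y \<in> Idl (set (take i xs)) \<longrightarrow>
         (\<exists>u\<in>carrier R - M. u \<otimes> y \<in> Idl (set (take i xs))))"
  shows "cohen_macaulay R" and "krull_dim R = enat d"
proof -
  have loc: "cohen_macaulay_local (localization R (carrier R - M)) \<and> enat d \<le> krull_dim R"
    if M: "maximalideal M R" for M
  proof -
    interpret maximal_localization R M by (intro maximal_localization.intro maximal_localization_axioms.intro is_cring M)
    have le: "krull_dim L \<le> enat d"
    proof (rule krull_dim_leI)
      fix k P assume P: "\<forall>i\<le>k. primeideal (P i) L" "\<forall>i<k. P i \<subset> P (Suc i)"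
      show "k \<le> d"
        by (rule chains[OF contr_prime_chain[OF P]])
    qed
    obtain xs where "set xs \<subseteq> M" "length xs = d" "\<And>i y. i < d \<Longrightarrow> y \<in> carrier R \<Longrightarrow>
       xs ! i \<otimes> y \<in> Idl (set (take i xs)) \<Longrightarrow> \<exists>u\<in>carrier R - M. u \<otimes> y \<in> Idl (set (take i xs))"
      using seqs[OF M] by blast
    then have reg: "regular_sequence L (map (\<lambda>a. fr a \<one>) xs)" using regular_sequence_L[of xs] by auto
    moreover have "set (map (\<lambda>a. fr a \<one>) xs) \<subseteq> ext M"
      unfolding ext_def using \<open>set xs \<subseteq> M\<close> one_S by auto
    ultimately have ge: "enat d \<le> depth L (ext M)" unfolding depth_def \<open>length xs = d\<close>[symmetric]
      by (intro Sup_upper CollectI exI[of _ "map (\<lambda>a. fr a \<one>) xs"]) auto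
    have dim: "krull_dim L = enat d" and dep: "depth L (ext M) = enat d"
      using le ge L.depth_le_krull_dim[of "ext M"] by (auto intro: antisym order_trans)
    have CM: "cohen_macaulay_local L" unfolding cohen_macaulay_local_def
      using cring_L noetherian_L[OF noeth] dim dep by (auto simp: maximalideal_L_iff)
    have "enat d \<le> krull_dim R"
    proof -
      obtain P where P: "\<forall>i\<le>d. primeideal (P i) L" "\<forall>i<d. P i \<subset> P (Suc i)"
        using L.prime_chain_of_regular_sequence[OF reg] \<open>length xs = d\<close> by auto
      show ?thesis
        by (rule krull_dim_geI[OF contr_prime_chain[OF P]])
    qed
    with CM show ?thesis by simp
  qed
  show "cohen_macaulay R" unfolding cohen_macaulay_def using is_cring noeth loc by auto
  have "\<one> \<noteq> \<zero>" using nontriv one_zeroD by blast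
  then have "{\<zero>} \<inter> {\<one>} = {}" by auto
  \<comment> \<open>The bound \<open>enat d \<le> krull_dim R\<close> comes from a localization, so
    some maximal ideal must exist; Zorn's lemma supplies one since the ring is not zero.\<close>
  define A where "A = {I. ideal I R \<and> \<one> \<notin> I}"
  have "\<exists>M\<in>A. \<forall>Y\<in>A. M \<subseteq> Y \<longrightarrow> Y = M"
  proof (rule subset_Zorn_nonempty)
    show "A \<noteq> {}" using zeroideal \<open>\<one> \<noteq> \<zero>\<close> unfolding A_def by auto
  next
    fix C assume C: "C \<noteq> {}" "subset.chain A C"
    then have sub: "C \<subseteq> A" unfolding pred_on.chain_def by auto
    have "subset.chain {I. ideal I R} C"
      using C unfolding pred_on.chain_def A_def by auto
    from chain_Union_is_ideal[OF this] have "ideal (\<Union>C) R" using C(1) by simp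
    then show "\<Union>C \<in> A" using sub C(1) unfolding A_def by blast
  qed
  then obtain M where M: "M \<in> A" and Mmax: "\<And>Y. Y \<in> A \<Longrightarrow> M \<subseteq> Y \<Longrightarrow> Y = M" by auto
  have "maximalideal M R"
  proof (rule maximalidealI)
    show "ideal M R" using M A_def by auto
    show "carrier R \<noteq> M" using M A_def by auto
    fix J assume J: "ideal J R" "M \<subseteq> J" "J \<subseteq> carrier R"
    show "J = M \<or> J = carrier R"
      using Mmax[of J] J ideal.one_imp_carrier[OF J(1)] unfolding A_def by auto
  qed
  then have "enat d \<le> krull_dim R" using loc by blast
  then show "krull_dim R = enat d" using krull_dim_leI[of R d] chains by (metis antisym)
qed

section \<open>Passage to a quotient ring\<close>

lemma zero_FactRing: "\<zero>\<^bsub>R Quot I\<^esub> = I"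
  by (simp add: FactRing_def)

locale ring_epi = ring_hom_cring R A h for R (structure) and A (structure) and h +
  assumes surj: "h ` carrier R = carrier A"
begin

lemma ring_hom_ring_epi: "ring_hom_ring R A h"
  by (intro ring_hom_ringI2 R.ring_axioms S.ring_axioms homh)

lemma surjE: "y \<in> carrier A \<Longrightarrow> \<exists>x\<in>carrier R. h x = y"
  using surj by (metis imageE)

definition preimage :: "'c set \<Rightarrow> 'a set" where
  "preimage Q = {x \<in> carrier R. h x \<in> Q}"

lemma ideal_preimage: "ideal Q A \<Longrightarrow> ideal (preimage Q) R"
  unfolding preimage_def by (rule ring_hom_ring.ideal_vimage[OF ring_hom_ring_epi])

lemma image_preimage: "Q \<subseteq> carrier A \<Longrightarrow> h ` preimage Q = Q"
proof (intro equalityI subsetI)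
  fix y assume "Q \<subseteq> carrier A" "y \<in> Q"
  then obtain x where x: "x \<in> carrier R" "h x = y" using surjE[of y] by blast
  then have "x \<in> preimage Q" unfolding preimage_def using \<open>y \<in> Q\<close> by blast
  then show "y \<in> h ` preimage Q" using x(2) by blast
qed (auto simp: preimage_def)

lemma ideal_image:
  assumes "ideal B R" shows "ideal (h ` B) A"
proof -
  interpret B: ideal B R by fact
  show ?thesis
  proof (rule idealI)
    show "subgroup (h ` B) (add_monoid A)"
      using ring_hom_ring.img_is_add_subgroup[OF ring_hom_ring_epi, of B]
        B.additive_subgroup_axioms additive_subgroup_def by blast
  next
    fix x y assume "x \<in> h ` B" "y \<in> carrier A"
    then obtain b r where br: "b \<in> B" "x = h b" "r \<in> carrier R" "y = h r" using surjE by blast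
    then have "h (r \<otimes> b) = y \<otimes>\<^bsub>A\<^esub> x" "h (b \<otimes> r) = x \<otimes>\<^bsub>A\<^esub> y" using B.Icarr by auto
    then show "y \<otimes>\<^bsub>A\<^esub> x \<in> h ` B" "x \<otimes>\<^bsub>A\<^esub> y \<in> h ` B"
      using br B.I_l_closed B.I_r_closed by (metis imageI)+
  qed (rule S.ring_axioms)
qed

lemma primeideal_preimage:
  assumes "primeideal Q A" shows "primeideal (preimage Q) R"
proof -
  interpret Q: primeideal Q A by fact
  show ?thesis
  proof (rule primeidealI[OF ideal_preimage R.is_cring])
    have "\<one>\<^bsub>A\<^esub> \<notin> Q" using Q.I_notcarr Q.one_imp_carrier by auto
    then have "\<one> \<notin> preimage Q" unfolding preimage_def by simp
    then show "carrier R \<noteq> preimage Q" by auto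
  next
    fix a b assume "a \<in> carrier R" "b \<in> carrier R" "a \<otimes> b \<in> preimage Q"
    then show "a \<in> preimage Q \<or> b \<in> preimage Q"
      unfolding preimage_def using Q.I_prime[of "h a" "h b"] by auto
  qed (rule Q.is_ideal)
qed

lemma preimage_strict_mono:
  assumes "Q' \<subseteq> carrier A" "Q \<subset> Q'" shows "preimage Q \<subset> preimage Q'"
proof -
  obtain y where y: "y \<in> Q'" "y \<notin> Q" using assms(2) by blast
  then obtain x where "x \<in> carrier R" "h x = y" using assms(1) surjE by blast
  then have "x \<in> preimage Q'" "x \<notin> preimage Q" unfolding preimage_def using y by auto
  moreover have "preimage Q \<subseteq> preimage Q'" unfolding preimage_def using assms(2) by auto
  ultimately show ?thesis by blast
qed

lemma maximalideal_preimage: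
  assumes "maximalideal Q A" shows "maximalideal (preimage Q) R"
proof -
  interpret Q: maximalideal Q A by fact
  have one: "\<one>\<^bsub>A\<^esub> \<notin> Q" using Q.I_notcarr Q.one_imp_carrier by auto
  show ?thesis
  proof (rule maximalidealI[OF ideal_preimage[OF Q.is_ideal]])
    have "\<one> \<notin> preimage Q" unfolding preimage_def using one by simp
    then show "carrier R \<noteq> preimage Q" by auto
  next
    fix J assume J: "ideal J R" "preimage Q \<subseteq> J" "J \<subseteq> carrier R"
    interpret J: ideal J R by (rule J)
    have "Q \<subseteq> h ` J" using image_preimage[of Q] J(2) Q.a_subset by blast
    then consider "h ` J = Q" | "h ` J = carrier A"
      using Q.I_maximal[OF ideal_image[OF J(1)]] ideal.Icarr[OF ideal_image[OF J(1)]] by blast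
    then show "J = preimage Q \<or> J = carrier R"
    proof cases
      case 1
      then have "J \<subseteq> preimage Q" unfolding preimage_def using J(3) by blast
      then show ?thesis using J(2) by auto
    next
      case 2
      \<comment> \<open>If \<open>j\<close> in \<open>J\<close> maps to 1, then the difference of 1
        and \<open>j\<close> maps to 0 and lies in \<open>preimage Q\<close>, which is inside
        \<open>J\<close>; hence \<open>J\<close> contains 1.\<close>
      then obtain j where j: "j \<in> J" "h j = \<one>\<^bsub>A\<^esub>" using S.one_closed by (metis imageE)
      have jc: "j \<in> carrier R" using j J(3) by auto
      have "h (\<one> \<ominus> j) = \<zero>\<^bsub>A\<^esub>" using jc j(2) by (simp add: a_minus_def S.r_neg)
      then have "\<one> \<ominus> j \<in> preimage Q" unfolding preimage_def
        using jc additive_subgroup.zero_closed[OF Q.additive_subgroup_axioms]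
        by (metis (mono_tags, lifting) R.minus_closed R.one_closed mem_Collect_eq)
      then have "(\<one> \<ominus> j) \<oplus> j \<in> J" using J(2) j(1) by (intro J.a_closed) auto
      moreover have "(\<one> \<ominus> j) \<oplus> j = \<one>" using jc by (simp add: a_minus_def R.a_assoc R.l_neg)
      ultimately show ?thesis using J.one_imp_carrier by simp
    qed
  qed
qed

text \<open>Two elements with the same image differ by an element of the kernel, so generated ideals
  of the image can be computed upstairs once the kernel is added to the generators.\<close>

lemma genideal_image_iff:
  assumes F: "F \<subseteq> carrier R" and y: "y \<in> carrier R"
  shows "h y \<in> genideal A (h ` F) \<longleftrightarrow> y \<in> genideal R (preimage {\<zero>\<^bsub>A\<^esub>} \<union> F)"
proof
  let ?K = "preimage {\<zero>\<^bsub>A\<^esub>}"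
  have KF: "?K \<union> F \<subseteq> carrier R" using F unfolding preimage_def by auto
  have hF: "h ` F \<subseteq> carrier A" using F by auto
  interpret G: ideal "genideal R (?K \<union> F)" R by (rule R.genideal_ideal[OF KF])
  { assume hy: "h y \<in> genideal A (h ` F)"
    have "ideal (h ` genideal R F) A" by (rule ideal_image[OF R.genideal_ideal[OF F]])
    then have "genideal A (h ` F) \<subseteq> h ` genideal R F"
      using R.genideal_self[OF F] by (intro S.genideal_minimal) auto
    then obtain z where z: "z \<in> genideal R F" "h y = h z" using hy by auto
    have zc: "z \<in> carrier R" using z(1) ideal.Icarr[OF R.genideal_ideal[OF F]] by blast
    have "h (y \<ominus> z) = \<zero>\<^bsub>A\<^esub>" using y zc z(2) by (simp add: a_minus_def S.r_neg)
    then have "y \<ominus> z \<in> genideal R (?K \<union> F)" using R.genideal_self[OF KF] y zc unfolding preimage_def by auto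
    moreover have "z \<in> genideal R (?K \<union> F)" using z(1) R.subset_Idl_subset[OF KF] by blast
    ultimately have "(y \<ominus> z) \<oplus> z \<in> genideal R (?K \<union> F)" by (rule G.a_closed)
    moreover have "(y \<ominus> z) \<oplus> z = y" using y zc by (simp add: a_minus_def R.a_assoc R.l_neg)
    ultimately show "y \<in> genideal R (?K \<union> F)" by simp }
  assume "y \<in> genideal R (?K \<union> F)"
  moreover have "genideal R (?K \<union> F) \<subseteq> preimage (genideal A (h ` F))"
  proof (rule R.genideal_minimal[OF ideal_preimage[OF S.genideal_ideal[OF hF]]])
    have "\<zero>\<^bsub>A\<^esub> \<in> genideal A (h ` F)"
      using additive_subgroup.zero_closed[OF ideal.axioms(1)[OF S.genideal_ideal[OF hF]]] .
    then show "?K \<union> F \<subseteq> preimage (genideal A (h ` F))"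
      unfolding preimage_def using S.genideal_self[OF hF] F by auto
  qed
  ultimately show "h y \<in> genideal A (h ` F)" unfolding preimage_def by auto
qed

lemma noetherian_epi:
  assumes "noetherian_ring R" shows "noetherian_ring A"
proof (rule S.noetherian_ringI)
  fix Q assume Q: "ideal Q A"
  interpret Q: ideal Q A by fact
  obtain F where F: "F \<subseteq> carrier R" "finite F" "preimage Q = genideal R F"
    using noetherian_ring.finetely_gen[OF assms ideal_preimage[OF Q]] by auto
  have hF: "h ` F \<subseteq> carrier A" using F by auto
  have "Q \<subseteq> genideal A (h ` F)"
  proof
    fix q assume q: "q \<in> Q"
    then obtain x where x: "x \<in> carrier R" "h x = q" using surjE Q.Icarr by blast
    then have "x \<in> genideal R F" using q F(3) unfolding preimage_def by auto
    then show "q \<in> genideal A (h ` F)"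
      using genideal_image_iff[OF F(1) x(1)] R.subset_Idl_subset[of "preimage {\<zero>\<^bsub>A\<^esub>} \<union> F" F] F(1) x(2)
      unfolding preimage_def by auto
  qed
  moreover have "F \<subseteq> preimage Q" using R.genideal_self[OF F(1)] F(3) by simp
  then have "h ` F \<subseteq> Q" unfolding preimage_def by auto
  then have "genideal A (h ` F) \<subseteq> Q" by (rule S.genideal_minimal[OF Q])
  ultimately show "\<exists>B\<subseteq>carrier A. finite B \<and> Q = genideal A B" using hF F(2) by blast
qed

end

text \<open>All conditions are moved from the quotient to \<open>R\<close>: primes become primes
  above \<open>I\<close>, and generated ideals become ideals generated together with
  \<open>I\<close>. Chains of primes and regular sequences can then be treated inside the polynomial
  ring.\<close>

theorem (in cring) cohen_macaulay_Quot:
  assumes I: "ideal I R" and proper: "I \<noteq> carrier R" and noeth: "noetherian_ring R"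
    and chains: "\<And>k P. (\<forall>i\<le>k. primeideal (P i) R) \<Longrightarrow> (\<forall>i<k. P i \<subset> P (Suc i)) \<Longrightarrow> I \<subseteq> P (0::nat) \<Longrightarrow> k \<le> d"
    and seqs: "\<And>M. maximalideal M R \<Longrightarrow> I \<subseteq> M \<Longrightarrow> \<exists>xs. set xs \<subseteq> M \<and> length xs = d \<and>
      (\<forall>i<d. \<forall>y\<in>carrier R. xs ! i \<otimes> y \<in> Idl (I \<union> set (take i xs)) \<longrightarrow>
         (\<exists>u\<in>carrier R - M. u \<otimes> y \<in> Idl (I \<union> set (take i xs))))"
  shows "cohen_macaulay (R Quot I) \<and> krull_dim (R Quot I) = enat d"
proof -
  let ?A = "R Quot I" and ?h = "(+>) I"
  interpret I: ideal I R by (rule I)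
  interpret h: ring_hom_cring R ?A ?h by (rule I.rcos_ring_hom_cring[OF is_cring])
  have "?h ` carrier R = carrier ?A" unfolding FactRing_def A_RCOSETS_def' by auto
  then interpret E: ring_epi R ?A ?h
    by (intro ring_epi.intro ring_epi_axioms.intro h.ring_hom_cring_axioms)
  have ker: "E.preimage {\<zero>\<^bsub>?A\<^esub>} = I"
  proof -
    have "?h x = I \<longleftrightarrow> x \<in> I" if "x \<in> carrier R" for x
      using that I.rcos_const_imp_mem a_rcos_zero[OF I] by auto
    moreover have "\<zero>\<^bsub>?A\<^esub> = I" by (rule zero_FactRing)
    ultimately show ?thesis unfolding E.preimage_def using I.Icarr by blast
  qed
  have I_preimage: "I \<subseteq> E.preimage Q" if "ideal Q ?A" for Q
  proof -
    have "E.preimage {\<zero>\<^bsub>?A\<^esub>} \<subseteq> E.preimage Q" unfolding E.preimage_def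
      using additive_subgroup.zero_closed[OF ideal.axioms(1)[OF that]] by (simp add: subset_iff)
    then show ?thesis unfolding ker .
  qed
  have nontriv: "carrier ?A \<noteq> {\<zero>\<^bsub>?A\<^esub>}"
  proof
    assume "carrier ?A = {\<zero>\<^bsub>?A\<^esub>}"
    then have "?h \<one> = \<zero>\<^bsub>?A\<^esub>" using h.hom_closed[OF one_closed] by blast
    then have "\<one> \<in> E.preimage {\<zero>\<^bsub>?A\<^esub>}" unfolding E.preimage_def by blast
    then show False using proper I.one_imp_carrier unfolding ker by blast
  qed
  have ch: "k \<le> d" if P: "\<forall>i\<le>k. primeideal (P i) ?A" "\<forall>i<k. P i \<subset> P (Suc i)" for k P
  proof (rule chains)
    have id: "ideal (P i) ?A" if "i \<le> k" for i using P(1) that primeideal.axioms(1) by blast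
    show "\<forall>i\<le>k. primeideal (E.preimage (P i)) R" by (simp add: P(1) E.primeideal_preimage)
    show "\<forall>i<k. E.preimage (P i) \<subset> E.preimage (P (Suc i))"
    proof (intro allI impI)
      fix i assume "i < k"
      then have sub: "P (Suc i) \<subseteq> carrier ?A"
        by (intro subsetI ideal.Icarr[OF id[of "Suc i"]]) auto
      have "P i \<subset> P (Suc i)" using P(2) \<open>i < k\<close> by simp
      from E.preimage_strict_mono[OF sub this] show "E.preimage (P i) \<subset> E.preimage (P (Suc i))" .
    qed
    show "I \<subseteq> E.preimage (P 0)" by (rule I_preimage[OF id]) simp
  qed
  have sq: "\<exists>ys. set ys \<subseteq> M \<and> length ys = d \<and>
      (\<forall>i<d. \<forall>y\<in>carrier ?A. ys ! i \<otimes>\<^bsub>?A\<^esub> y \<in> genideal ?A (set (take i ys)) \<longrightarrow>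
         (\<exists>u\<in>carrier ?A - M. u \<otimes>\<^bsub>?A\<^esub> y \<in> genideal ?A (set (take i ys))))"
    if M: "maximalideal M ?A" for M
  proof -
    have MI: "ideal M ?A" by (rule maximalideal.axioms(1)[OF M])
    obtain xs where xs: "set xs \<subseteq> E.preimage M" "length xs = d"
      and reg: "\<And>i y. i < d \<Longrightarrow> y \<in> carrier R \<Longrightarrow> xs ! i \<otimes> y \<in> Idl (I \<union> set (take i xs)) \<Longrightarrow>
         \<exists>u\<in>carrier R - E.preimage M. u \<otimes> y \<in> Idl (I \<union> set (take i xs))"
      using seqs[OF E.maximalideal_preimage[OF M] I_preimage[OF MI]] by blast
    have xsc: "set xs \<subseteq> carrier R" using xs(1) unfolding E.preimage_def by blast
    have subc: "set (take i xs) \<subseteq> carrier R" for i using xsc set_take_subset by fast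
    have gen: "?h z \<in> genideal ?A (set (take i (map ?h xs))) \<longleftrightarrow> z \<in> Idl (I \<union> set (take i xs))"
      if "z \<in> carrier R" for z i
      using E.genideal_image_iff[OF subc that, of i] unfolding ker by (simp add: take_map)
    have "\<exists>u\<in>carrier ?A - M. u \<otimes>\<^bsub>?A\<^esub> y \<in> genideal ?A (set (take i (map ?h xs)))"
      if i: "i < d" and y: "y \<in> carrier ?A"
       and p: "map ?h xs ! i \<otimes>\<^bsub>?A\<^esub> y \<in> genideal ?A (set (take i (map ?h xs)))" for i y
    proof -
      obtain z where z: "z \<in> carrier R" "y = ?h z" using y E.surj by (metis imageE)
      have xi: "xs ! i \<in> carrier R" using xsc i xs(2) by auto
      have "?h (xs ! i \<otimes> z) \<in> genideal ?A (set (take i (map ?h xs)))"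
        using p i xs(2) unfolding z(2) h.hom_mult[OF xi z(1)] by simp
      then have "xs ! i \<otimes> z \<in> Idl (I \<union> set (take i xs))" using gen[OF m_closed[OF xi z(1)]] by blast
      then obtain u where u: "u \<in> carrier R - E.preimage M" "u \<otimes> z \<in> Idl (I \<union> set (take i xs))"
        using reg i z by blast
      have "?h (u \<otimes> z) \<in> genideal ?A (set (take i (map ?h xs)))" using gen[of "u \<otimes> z"] u z(1) by blast
      then have "?h u \<otimes>\<^bsub>?A\<^esub> y \<in> genideal ?A (set (take i (map ?h xs)))"
        using h.hom_mult[of u z] u(1) z by simp
      moreover have "?h u \<in> carrier ?A - M" using u(1) h.hom_closed unfolding E.preimage_def by blast
      ultimately show ?thesis by blast
    qed
    moreover have "set (map ?h xs) \<subseteq> M" using xs(1) unfolding E.preimage_def by auto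
    ultimately show ?thesis using xs(2) by (intro exI[of _ "map ?h xs"]) auto
  qed
  show ?thesis
    using h.S.cohen_macaulay_of_local_sequences[OF E.noetherian_epi[OF noeth] nontriv ch sq]
    by (rule conjI)
qed

section \<open>Locally regular sequences\<close>

text \<open>The ring is a subset of a type with ring operations, so that type-class arithmetic and
  its simplification apply; \<open>ideal_poly_ring_iff\<close> connects this view with the ring
  records of the definitions.\<close>

locale subring_set =
  fixes C :: "'a::comm_ring_1 set"
  assumes zero_C [simp]: "0 \<in> C" and one_C [simp]: "1 \<in> C"
    and add_C [simp]: "x \<in> C \<Longrightarrow> y \<in> C \<Longrightarrow> x + y \<in> C"
    and mult_C [simp]: "x \<in> C \<Longrightarrow> y \<in> C \<Longrightarrow> x * y \<in> C"
    and uminus_C [simp]: "x \<in> C \<Longrightarrow> - x \<in> C"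
begin

lemma diff_C [simp]: "x \<in> C \<Longrightarrow> y \<in> C \<Longrightarrow> x - y \<in> C"
  using add_C[of x "- y"] by simp

lemma sum_C [simp]: "(\<And>i. i \<in> A \<Longrightarrow> f i \<in> C) \<Longrightarrow> sum f A \<in> C"
  by (induction A rule: infinite_finite_induct) auto

lemma prod_C [simp]: "(\<And>i. i \<in> A \<Longrightarrow> f i \<in> C) \<Longrightarrow> prod f A \<in> C"
  by (induction A rule: infinite_finite_induct) auto

lemma power_C [simp]: "x \<in> C \<Longrightarrow> x ^ k \<in> C"
  by (induction k) auto

definition is_ideal :: "'a set \<Rightarrow> bool" where
  "is_ideal B \<longleftrightarrow> B \<subseteq> C \<and> 0 \<in> B \<and> (\<forall>x\<in>B. \<forall>y\<in>B. x + y \<in> B) \<and> (\<forall>r\<in>C. \<forall>x\<in>B. r * x \<in> B)"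

lemma is_idealD:
  assumes "is_ideal B"
  shows "x \<in> B \<Longrightarrow> x \<in> C" "0 \<in> B" "x \<in> B \<Longrightarrow> y \<in> B \<Longrightarrow> x + y \<in> B"
    "r \<in> C \<Longrightarrow> x \<in> B \<Longrightarrow> r * x \<in> B" "x \<in> B \<Longrightarrow> y \<in> B \<Longrightarrow> x - y \<in> B"
proof -
  show "x \<in> B \<Longrightarrow> y \<in> B \<Longrightarrow> x - y \<in> B"
  proof -
    assume "x \<in> B" "y \<in> B"
    then have "x + (- 1) * y \<in> B" using assms unfolding is_ideal_def by (metis one_C uminus_C)
    then show ?thesis by simp
  qed
qed (use assms in \<open>auto simp: is_ideal_def\<close>)

definition adjoin :: "'a set \<Rightarrow> 'a \<Rightarrow> 'a set" where
  "adjoin B x = {b + r * x | b r. b \<in> B \<and> r \<in> C}"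

lemma adjI: "b \<in> B \<Longrightarrow> r \<in> C \<Longrightarrow> b + r * x \<in> adjoin B x"
  unfolding adjoin_def by blast

lemma adjE: assumes "z \<in> adjoin B x" obtains b r where "b \<in> B" "r \<in> C" "z = b + r * x"
  using assms unfolding adjoin_def by blast

lemma subset_adjoin: "B \<subseteq> adjoin B x"
  using adjI[of _ B 0 x] by auto

lemma self_adjoin: "is_ideal B \<Longrightarrow> x \<in> adjoin B x"
  using adjI[of 0 B 1 x] is_idealD(2)[of B] by auto

lemma is_ideal_adjoin:
  assumes B: "is_ideal B" and x: "x \<in> C" shows "is_ideal (adjoin B x)"
  unfolding is_ideal_def
proof (intro conjI ballI subsetI)
  show "z \<in> C" if "z \<in> adjoin B x" for z using that x is_idealD(1)[OF B] by (auto elim!: adjE)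
  show "0 \<in> adjoin B x" using adjI[of 0 B 0 x] is_idealD(2)[OF B] by auto
next
  fix y z assume "y \<in> adjoin B x" "z \<in> adjoin B x"
  then obtain b r b' r' where *: "b \<in> B" "r \<in> C" "y = b + r * x" "b' \<in> B" "r' \<in> C" "z = b' + r' * x"
    by (elim adjE) blast
  then have eq: "y + z = (b + b') + (r + r') * x" by (simp add: algebra_simps)
  show "y + z \<in> adjoin B x" unfolding eq using * is_idealD(3)[OF B] by (intro adjI) auto
next
  fix s z assume s: "s \<in> C" "z \<in> adjoin B x"
  then obtain b r where *: "b \<in> B" "r \<in> C" "z = b + r * x" by (elim adjE) blast
  then have eq: "s * z = s * b + (s * r) * x" by (simp add: algebra_simps)
  show "s * z \<in> adjoin B x" unfolding eq using * s is_idealD(4)[OF B] by (intro adjI) auto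
qed

lemma adjoin_minimal: "is_ideal D \<Longrightarrow> B \<subseteq> D \<Longrightarrow> x \<in> D \<Longrightarrow> adjoin B x \<subseteq> D"
  unfolding adjoin_def using is_idealD(3,4)[of D] by blast

text \<open>Only the class of the new generator modulo \<open>B\<close> matters. This later replaces
  an elementary symmetric function by a product.\<close>

lemma adjoin_cong:
  assumes "is_ideal B" "x \<in> C" "y \<in> C" "x - y \<in> B" shows "adjoin B x = adjoin B y"
proof -
  have "adjoin B x \<subseteq> adjoin B y" if "x \<in> C" "y \<in> C" "x - y \<in> B" for x y
  proof (rule adjoin_minimal)
    show "x \<in> adjoin B y" using adjI[OF that(3), of 1 y] by simp
  qed (use that assms(1) subset_adjoin is_ideal_adjoin in auto)
  moreover have "y - x \<in> B" using is_idealD(5)[OF assms(1) is_idealD(2)[OF assms(1)] assms(4)] by simp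
  ultimately show ?thesis using assms by blast
qed

end

locale local_subring = subring_set +
  fixes S
  assumes S_C [simp]: "s \<in> S \<Longrightarrow> s \<in> C" and one_S [simp]: "1 \<in> S"
    and mult_S [simp]: "s \<in> S \<Longrightarrow> t \<in> S \<Longrightarrow> s * t \<in> S"
begin

text \<open>The sequence is weakly regular on the localization of \<open>C / B\<close> at \<open>S\<close>.\<close>

fun locally_regular :: "'a set \<Rightarrow> 'a list \<Rightarrow> bool" where
  "locally_regular B [] = True"
| "locally_regular B (f # fs) = ((\<forall>y\<in>C. f * y \<in> B \<longrightarrow> (\<exists>s\<in>S. s * y \<in> B)) \<and> locally_regular (adjoin B f) fs)"

text \<open>An element of \<open>S\<close> inside \<open>B\<close> kills the whole quotient, and it
  stays available as a multiplier while \<open>B\<close> grows. Properness is not part of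
  \<open>locally_regular\<close>, so such degenerate quotients are harmless.\<close>

lemma locally_regular_trivial: "is_ideal B \<Longrightarrow> set fs \<subseteq> C \<Longrightarrow> s \<in> S \<Longrightarrow> s \<in> B \<Longrightarrow> locally_regular B fs"
proof (induction fs arbitrary: B)
  case (Cons f fs)
  then have "locally_regular (adjoin B f) fs" using is_ideal_adjoin[of B f] subset_adjoin[of B f] by auto
  moreover have "s * y \<in> B" if "y \<in> C" for y
    using is_idealD(4)[OF Cons.prems(1) that Cons.prems(4)] by (simp add: mult.commute)
  ultimately show ?case using Cons.prems(3) by auto
qed simp

text \<open>Up to localization at \<open>S\<close>, the hypotheses say that multiplication by \<open>u\<close> makes
  \<open>0 \<rightarrow> C / B \<rightarrow> C / A \<rightarrow> C / D \<rightarrow> 0\<close> exact.\<close>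

lemma locally_regular_exact:
  assumes "is_ideal A" "is_ideal B" "is_ideal D" "u \<in> C" "set fs \<subseteq> C"
    and "A \<subseteq> D" "u \<in> D"
    and "\<And>z. z \<in> D \<Longrightarrow> \<exists>s\<in>S. \<exists>r\<in>C. s * z - r * u \<in> A"
    and "\<And>b. b \<in> B \<Longrightarrow> u * b \<in> A"
    and "\<And>z. z \<in> C \<Longrightarrow> u * z \<in> A \<Longrightarrow> \<exists>s\<in>S. s * z \<in> B"
    and "locally_regular B fs" "locally_regular D fs"
  shows "locally_regular A fs"
  using assms
proof (induction fs arbitrary: A B D)
  case (Cons f fs)
  note A = is_idealD[OF Cons.prems(1)] and B = is_idealD[OF Cons.prems(2)] and D = is_idealD[OF Cons.prems(3)]
  note AD = Cons.prems(6) and uD = Cons.prems(7) and DA = Cons.prems(8) and BA = Cons.prems(9)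
    and AB = Cons.prems(10)
  have u: "u \<in> C" and f: "f \<in> C" using Cons.prems by auto
  have fB: "\<exists>s\<in>S. s * y \<in> B" if "y \<in> C" "f * y \<in> B" for y using Cons.prems(11) that by simp
  have fD: "\<exists>s\<in>S. s * y \<in> D" if "y \<in> C" "f * y \<in> D" for y using Cons.prems(12) that by simp
  \<comment> \<open>Diagram chase, always up to \<open>S\<close>: \<open>y\<close> vanishes in
    \<open>C / D\<close>, hence agrees with a multiple \<open>r * u\<close> modulo \<open>A\<close>;
    then \<open>f * r\<close> vanishes in \<open>C / B\<close>, and so does
    \<open>r\<close>.\<close>
  have 1: "\<exists>s\<in>S. s * y \<in> A" if y: "y \<in> C" and fy: "f * y \<in> A" for y
  proof -
    obtain s where s: "s \<in> S" "s * y \<in> D" using fD y fy AD by blast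
    obtain s' r where s': "s' \<in> S" "r \<in> C" "s' * (s * y) - r * u \<in> A" using DA[OF s(2)] by blast
    have "u * (f * r) = (s' * s) * (f * y) - f * (s' * (s * y) - r * u)" by (simp add: algebra_simps)
    also have "\<dots> \<in> A" using A(4,5) fy f s s' by simp
    finally obtain t where t: "t \<in> S" "t * (f * r) \<in> B" using AB f s'(2) by (metis mult_C)
    have "f * (t * r) \<in> B" using t(2) by (simp add: mult.left_commute)
    then obtain t' where t': "t' \<in> S" "t' * (t * r) \<in> B" using fB t s' by (metis S_C mult_C)
    have "(t' * t * s' * s) * y = (t' * t) * (s' * (s * y) - r * u) + u * (t' * (t * r))"
      by (simp add: algebra_simps)
    also have "\<dots> \<in> A" using A(3,4) BA[OF t'(2)] s'(3) t t' by simp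
    finally show ?thesis using s s' t t' by (metis mult_S)
  qed
  have "locally_regular (adjoin A f) fs"
  proof (rule Cons.IH)
    show "is_ideal (adjoin A f)" "is_ideal (adjoin B f)" "is_ideal (adjoin D f)" "u \<in> C" "set fs \<subseteq> C"
      using Cons.prems is_ideal_adjoin by auto
    show "adjoin A f \<subseteq> adjoin D f" using AD unfolding adjoin_def by blast
    show "u \<in> adjoin D f" using uD subset_adjoin by blast
    show "locally_regular (adjoin B f) fs" "locally_regular (adjoin D f) fs" using Cons.prems by auto
  next
    fix z assume "z \<in> adjoin D f"
    then obtain d t where d: "d \<in> D" "t \<in> C" "z = d + t * f" by (elim adjE)
    obtain s r where s: "s \<in> S" "r \<in> C" "s * d - r * u \<in> A" using DA[OF d(1)] by blast
    have "s * z - r * u = (s * d - r * u) + (s * t) * f" unfolding d by (simp add: algebra_simps)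
    also have "\<dots> \<in> adjoin A f" using s d by (intro adjI) auto
    finally show "\<exists>s\<in>S. \<exists>r\<in>C. s * z - r * u \<in> adjoin A f" using s by blast
  next
    fix z assume "z \<in> adjoin B f"
    then obtain d t where d: "d \<in> B" "t \<in> C" "z = d + t * f" by (elim adjE)
    have "u * z = u * d + (u * t) * f" unfolding d by (simp add: algebra_simps)
    also have "\<dots> \<in> adjoin A f" using d u BA by (intro adjI) auto
    finally show "u * z \<in> adjoin A f" .
  next
    \<comment> \<open>Injectivity of \<open>u\<close> modulo \<open>f\<close> is the part of the
      snake lemma that needs regularity of \<open>f\<close> on \<open>C / D\<close>: up to
      \<open>S\<close>, the coefficient \<open>t\<close> of \<open>f\<close> lies in
      \<open>D\<close>, so it is a multiple of \<open>u\<close> modulo \<open>A\<close>, and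
      \<open>u\<close> can be cancelled.\<close>
    fix z assume z: "z \<in> C" "u * z \<in> adjoin A f"
    then obtain a t where a: "a \<in> A" "t \<in> C" "u * z = a + t * f" by (elim adjE)
    have "f * t = z * u - a" using a(3) by (simp add: algebra_simps)
    also have "\<dots> \<in> D" using D(4,5) z(1) uD a(1) AD by blast
    finally obtain s where s: "s \<in> S" "s * t \<in> D" using fD a(2) by blast
    obtain s' r where s': "s' \<in> S" "r \<in> C" "s' * (s * t) - r * u \<in> A" using DA[OF s(2)] by blast
    have "u * (s' * s * z - f * r) = (s' * s) * (u * z) - f * r * u" by (simp add: algebra_simps)
    also have "\<dots> = (s' * s) * a + f * (s' * (s * t) - r * u)" unfolding a(3) by (simp add: algebra_simps)
    also have "\<dots> \<in> A" using A(3,4) a s s' f by simp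
    finally obtain t' where t': "t' \<in> S" "t' * (s' * s * z - f * r) \<in> B"
      using AB[of "s' * s * z - f * r"] s s' z f by auto
    have "(t' * s' * s) * z = t' * (s' * s * z - f * r) + (t' * r) * f" by (simp add: algebra_simps)
    also have "\<dots> \<in> adjoin B f" using t' s' by (intro adjI) auto
    finally show "\<exists>s\<in>S. s * z \<in> adjoin B f" using t' s' s by (metis mult_S)
  qed
  with 1 show ?case by simp
qed simp

definition nonzerodivisor :: "'a set \<Rightarrow> 'a \<Rightarrow> bool" where
  "nonzerodivisor B u \<longleftrightarrow> u \<in> C \<and> (\<forall>y\<in>C. u * y \<in> B \<longrightarrow> y \<in> B)"

text \<open>Multiplication by \<open>u\<close> gives the exact sequence \<open>0 \<rightarrow> C/(B,
  p) \<rightarrow> C/(B, u p) \<rightarrow> C/(B, u) \<rightarrow> 0\<close>; its injectivity is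
  where \<open>u\<close> must be a nonzerodivisor modulo \<open>B\<close>.\<close>

lemma locally_regular_adjoin_mult:
  assumes B: "is_ideal B" and u: "nonzerodivisor B u" and p: "p \<in> C" and fs: "set fs \<subseteq> C"
    and "locally_regular (adjoin B u) fs" "locally_regular (adjoin B p) fs"
  shows "locally_regular (adjoin B (u * p)) fs"
proof (rule locally_regular_exact[where B = "adjoin B p" and D = "adjoin B u" and u = u])
  have uC: "u \<in> C" using u unfolding nonzerodivisor_def by simp
  show "is_ideal (adjoin B (u * p))" "is_ideal (adjoin B p)" "is_ideal (adjoin B u)" "u \<in> C"
    using is_ideal_adjoin[OF B] p uC by auto
  show "adjoin B (u * p) \<subseteq> adjoin B u"
  proof (rule adjoin_minimal)
    show "u * p \<in> adjoin B u" using adjI[of 0 B p u] p is_idealD(2)[OF B] by (simp add: mult.commute)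
  qed (use is_ideal_adjoin[OF B uC] subset_adjoin in auto)
  show "u \<in> adjoin B u" by (rule self_adjoin[OF B])
  show "\<exists>s\<in>S. \<exists>r\<in>C. s * z - r * u \<in> adjoin B (u * p)" if "z \<in> adjoin B u" for z
  proof -
    from that obtain b r where b: "b \<in> B" "r \<in> C" "z = b + r * u" by (elim adjE)
    then have "1 * z - r * u \<in> adjoin B (u * p)" using subset_adjoin by auto
    then show ?thesis using b by (intro bexI[of _ 1] bexI[of _ r]) auto
  qed
  show "u * z \<in> adjoin B (u * p)" if "z \<in> adjoin B p" for z
  proof -
    from that obtain b r where b: "b \<in> B" "r \<in> C" "z = b + r * p" by (elim adjE)
    then have "u * z = u * b + r * (u * p)" by (simp add: algebra_simps)
    then show ?thesis using adjI[of "u * b" B r "u * p"] b uC is_idealD(4)[OF B] by simp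
  qed
  show "\<exists>s\<in>S. s * z \<in> adjoin B p" if z: "z \<in> C" "u * z \<in> adjoin B (u * p)" for z
  proof -
    from z obtain b r where b: "b \<in> B" "r \<in> C" "u * z = b + r * (u * p)" by (elim adjE)
    then have "u * (z - r * p) = b" by (simp add: algebra_simps)
    then have "z - r * p \<in> B" using u b z(1) p unfolding nonzerodivisor_def by simp
    then have "1 * z \<in> adjoin B p" using adjI[of "z - r * p" B r p] b(2) by simp
    then show ?thesis using one_S by blast
  qed
qed (use assms in auto)

text \<open>Factors are peeled off one at a time with \<open>locally_regular_adjoin_mult\<close>, so
  regularity modulo a product reduces to regularity modulo each factor.\<close>

lemma locally_regular_adjoin_prod:
  assumes B: "is_ideal B" and fs: "set fs \<subseteq> C" and "finite T"
    and "\<And>v. v \<in> T \<Longrightarrow> nonzerodivisor B (g v)" "\<And>v. v \<in> T \<Longrightarrow> locally_regular (adjoin B (g v)) fs"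
  shows "locally_regular (adjoin B (\<Prod>v\<in>T. g v ^ e v)) fs"
  using assms(3-5)
proof (induction T rule: finite_induct)
  case empty
  \<comment> \<open>The empty product is 1; it generates the unit ideal, where regularity is
    trivial.\<close>
  show ?case using locally_regular_trivial[OF is_ideal_adjoin[OF B] fs one_S self_adjoin[OF B]] by simp
next
  case (insert v T)
  let ?p = "\<Prod>v\<in>T. g v ^ e v"
  have gC: "g w \<in> C" if "w \<in> insert v T" for w using insert.prems(1)[OF that] unfolding nonzerodivisor_def by simp
  have pC: "?p \<in> C" using gC by auto
  have "locally_regular (adjoin B (g v ^ k * ?p)) fs" for k
  proof (induction k)
    case 0 then show ?case using insert by simp
  next
    case (Suc k)
    have "locally_regular (adjoin B (g v * (g v ^ k * ?p))) fs"
      by (rule locally_regular_adjoin_mult[OF B _ _ fs]) (use insert.prems gC pC Suc in auto)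
    then show ?case by (simp add: mult.assoc)
  qed
  then show ?case using insert.hyps by simp
qed

section \<open>Spanned ideals and elementary symmetric functions\<close>

definition ideal_span :: "('v \<Rightarrow> 'a) \<Rightarrow> 'v set \<Rightarrow> 'a set" where
  "ideal_span g T = {\<Sum>t\<in>T. r t * g t | r. \<forall>t. r t \<in> C}"

lemma is_ideal_ideal_span:
  assumes "\<And>t. t \<in> T \<Longrightarrow> g t \<in> C" shows "is_ideal (ideal_span g T)"
  unfolding is_ideal_def
proof (intro conjI ballI subsetI)
  show "z \<in> C" if "z \<in> ideal_span g T" for z using that assms unfolding ideal_span_def by auto
  show "0 \<in> ideal_span g T" unfolding ideal_span_def by (intro CollectI exI[of _ "\<lambda>_. 0"]) auto
next
  fix x y assume "x \<in> ideal_span g T" "y \<in> ideal_span g T"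
  then obtain r r' where "x = (\<Sum>t\<in>T. r t * g t)" "\<forall>t. r t \<in> C" "y = (\<Sum>t\<in>T. r' t * g t)" "\<forall>t. r' t \<in> C"
    unfolding ideal_span_def by auto
  then show "x + y \<in> ideal_span g T" unfolding ideal_span_def
    by (intro CollectI exI[of _ "\<lambda>t. r t + r' t"]) (auto simp: sum.distrib distrib_right)
next
  fix s y assume "s \<in> C" "y \<in> ideal_span g T"
  then obtain r where "s \<in> C" "y = (\<Sum>t\<in>T. r t * g t)" "\<forall>t. r t \<in> C" unfolding ideal_span_def by auto
  then show "s * y \<in> ideal_span g T" unfolding ideal_span_def
    by (intro CollectI exI[of _ "\<lambda>t. s * r t"]) (auto simp: sum_distrib_left mult.assoc)
qed

lemma mem_ideal_span: "finite T \<Longrightarrow> t \<in> T \<Longrightarrow> g t \<in> ideal_span g T"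
  unfolding ideal_span_def
  by (intro CollectI exI[of _ "\<lambda>s. if s = t then 1 else 0"]) (simp add: if_distrib if_distribR sum.delta cong: if_cong)

lemma ideal_span_minimal: "is_ideal D \<Longrightarrow> (\<And>t. t \<in> T \<Longrightarrow> g t \<in> D) \<Longrightarrow> ideal_span g T \<subseteq> D"
proof -
  assume D: "is_ideal D" and g: "\<And>t. t \<in> T \<Longrightarrow> g t \<in> D"
  have "(\<Sum>t\<in>T. r t * g t) \<in> D" if r: "\<forall>t. r t \<in> C" for r
    using g
    by (induction T rule: infinite_finite_induct) (use is_idealD[OF D] r in auto)
  then show ?thesis unfolding ideal_span_def by auto
qed

lemma adjoin_ideal_span:
  assumes "finite T" "\<And>t. t \<in> insert v T \<Longrightarrow> g t \<in> C"
  shows "adjoin (ideal_span g T) (g v) = ideal_span g (insert v T)"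
proof
  have I: "is_ideal (ideal_span g (insert v T))" "is_ideal (ideal_span g T)"
    by (intro is_ideal_ideal_span; simp add: assms(2))+
  have "g t \<in> ideal_span g (insert v T)" if "t \<in> insert v T" for t using mem_ideal_span[of "insert v T" t g] assms(1) that by auto
  then show "adjoin (ideal_span g T) (g v) \<subseteq> ideal_span g (insert v T)"
    using adjoin_minimal[OF I(1)] ideal_span_minimal[OF I(1), of T g] by auto
  show "ideal_span g (insert v T) \<subseteq> adjoin (ideal_span g T) (g v)"
  proof (rule ideal_span_minimal[OF is_ideal_adjoin[OF I(2)]])
    show "g t \<in> adjoin (ideal_span g T) (g v)" if "t \<in> insert v T" for t
    proof (cases "t = v")
      case True then show ?thesis using self_adjoin[OF I(2)] by simp
    next
      case False
      then have "g t \<in> ideal_span g T" using that mem_ideal_span[OF assms(1)] by simp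
      then show ?thesis using subset_adjoin by blast
    qed
  qed (simp add: assms(2))
qed

definition elem_sym :: "('v \<Rightarrow> 'a) \<Rightarrow> 'v set \<Rightarrow> nat \<Rightarrow> 'a" where
  "elem_sym g V k = (\<Sum>A | A \<subseteq> V \<and> card A = k. \<Prod>v\<in>A. g v)"

text \<open>The indices decrease from \<open>k\<close> to 1. As long as \<open>k\<close> of the
  \<open>g v\<close> survive modulo the ideal, the head of the list is their product up to that
  ideal, and killing one more \<open>g v\<close> leaves the situation of the tail.\<close>

fun elem_syms :: "('v \<Rightarrow> 'a) \<Rightarrow> 'v set \<Rightarrow> nat \<Rightarrow> 'a list" where
  "elem_syms g V 0 = []"
| "elem_syms g V (Suc k) = elem_sym g V (Suc k) # elem_syms g V k"

lemma length_elem_syms [simp]: "length (elem_syms g V k) = k"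
  by (induction k) auto

lemma elem_syms_mem:
  assumes "is_ideal D" "finite V" "\<And>v. v \<in> V \<Longrightarrow> g v \<in> D"
  shows "set (elem_syms g V k) \<subseteq> D"
proof (induction k)
  case (Suc k)
  have "(\<Prod>v\<in>A. g v) \<in> D" if A: "A \<subseteq> V" "card A = Suc k" for A
  proof -
    have "finite A" using A assms(2) finite_subset by blast
    obtain v where v: "v \<in> A" using A(2) by fastforce
    have "(\<Prod>w\<in>A - {v}. g w) \<in> C" using A assms(3) is_idealD(1)[OF assms(1)] by (intro prod_C) auto
    then have "(\<Prod>w\<in>A - {v}. g w) * g v \<in> D" using is_idealD(4)[OF assms(1)] assms(3) v A by blast
    then show ?thesis using prod.remove[OF \<open>finite A\<close> v, of g] by (simp add: mult.commute)
  qed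
  then have "(\<And>A. A \<in> F \<Longrightarrow> A \<subseteq> V \<and> card A = Suc k) \<Longrightarrow> (\<Sum>A\<in>F. \<Prod>v\<in>A. g v) \<in> D" for F
    by (induction F rule: infinite_finite_induct) (use is_idealD[OF assms(1)] in auto)
  from this[of "{A. A \<subseteq> V \<and> card A = Suc k}"] show ?case using Suc by (simp add: elem_sym_def)
qed simp

text \<open>Modulo the \<open>g t\<close> with \<open>t \<in> T\<close>, the top elementary symmetric function is the product
  of the remaining \<open>g v\<close>, which splits off one further \<open>g v\<close> at a time.\<close>

lemma locally_regular_elem_syms:
  assumes V: "finite V" and g: "\<And>v. v \<in> V \<Longrightarrow> g v \<in> C"
    and reg: "\<And>T v. T \<subseteq> V \<Longrightarrow> v \<in> V - T \<Longrightarrow> nonzerodivisor (ideal_span g T) (g v)"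
    and "T \<subseteq> V" "card (V - T) = k"
  shows "locally_regular (ideal_span g T) (elem_syms g V k)"
  using assms(4,5)
proof (induction k arbitrary: T)
  case (Suc k)
  let ?B = "ideal_span g T" and ?E = "elem_sym g V (Suc k)" and ?P = "\<Prod>v\<in>V - T. g v ^ 1"
  have fin: "finite T" using V Suc.prems finite_subset by blast
  have B: "is_ideal ?B" using is_ideal_ideal_span g Suc.prems by blast
  have CC: "is_ideal C" unfolding is_ideal_def by auto
  have subC: "set (elem_syms g V j) \<subseteq> C" for j using elem_syms_mem[OF CC V g] by auto
  then have EC: "?E \<in> C" using subC[of "Suc k"] by simp
  have PC: "?P \<in> C" by (intro prod_C power_C) (auto intro: g)
  \<comment> \<open>A subset of size \<open>Suc k\<close> other than \<open>V - T\<close> must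
    contain some \<open>t \<in> T\<close>, so all other summands lie in the ideal.\<close>
  have "?E - ?P \<in> ?B"
  proof -
    let ?F = "{A. A \<subseteq> V \<and> card A = Suc k}"
    have finF: "finite ?F" using V by simp
    have "?E = (\<Prod>v\<in>V - T. g v) + (\<Sum>A\<in>?F - {V - T}. \<Prod>v\<in>A. g v)"
      unfolding elem_sym_def using Suc.prems by (intro sum.remove finF) auto
    then have eq: "?E - ?P = (\<Sum>A\<in>?F - {V - T}. \<Prod>v\<in>A. g v)" by simp
    have "(\<Prod>v\<in>A. g v) \<in> ?B" if A: "A \<in> ?F - {V - T}" for A
    proof -
      have fA: "finite A" using A V finite_subset by blast
      have "\<not> A \<subseteq> V - T"
      proof
        assume "A \<subseteq> V - T"
        then have "A = V - T" using A Suc.prems V by (intro card_subset_eq) auto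
        then show False using A by simp
      qed
      then obtain t where t: "t \<in> A" "t \<in> T" using A by auto
      have "(\<Prod>w\<in>A - {t}. g w) * g t \<in> ?B"
      proof (rule is_idealD(4)[OF B])
        show "(\<Prod>w\<in>A - {t}. g w) \<in> C" by (rule prod_C) (use A g in auto)
      qed (rule mem_ideal_span[OF fin t(2)])
      then show ?thesis using prod.remove[OF fA t(1), of g] by (simp add: mult.commute)
    qed
    then have "F \<subseteq> ?F - {V - T} \<Longrightarrow> (\<Sum>A\<in>F. \<Prod>v\<in>A. g v) \<in> ?B" for F
      by (induction F rule: infinite_finite_induct) (use is_idealD[OF B] in auto)
    then show ?thesis unfolding eq by blast
  qed
  note EP = this
  have nz: "nonzerodivisor ?B (g v)" if "v \<in> V - T" for v using reg Suc.prems that by blast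
  \<comment> \<open>On the quotient, \<open>?E\<close> acts like \<open>?P\<close>, a product of
    nonzerodivisors.\<close>
  have "?E * y \<in> ?B \<Longrightarrow> y \<in> ?B" if y: "y \<in> C" for y
  proof -
    assume Ey: "?E * y \<in> ?B"
    have "?P * y = ?E * y - y * (?E - ?P)" by (simp add: algebra_simps)
    also have "\<dots> \<in> ?B" using is_idealD(4,5)[OF B] Ey EP y by blast
    finally have Py: "?P * y \<in> ?B" .
    have "W \<subseteq> V - T \<Longrightarrow> (\<Prod>v\<in>W. g v) * y \<in> ?B \<Longrightarrow> y \<in> ?B" if "finite W" for W
      using that
    proof (induction W rule: finite_induct)
      case (insert w W)
      have "(\<Prod>v\<in>W. g v) * y \<in> C" using g insert.prems y by (intro mult_C prod_C) auto
      moreover have "g w * ((\<Prod>v\<in>W. g v) * y) \<in> ?B" using insert.prems insert.hyps by (simp add: mult.assoc)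
      ultimately show ?case using nz[of w] insert unfolding nonzerodivisor_def by auto
    qed simp
    from this[of "V - T"] show "y \<in> ?B" using V Py by simp
  qed
  then have first: "\<forall>y\<in>C. ?E * y \<in> ?B \<longrightarrow> (\<exists>s\<in>S. s * y \<in> ?B)" using one_S by (metis mult_1)
  \<comment> \<open>It suffices to consider each factor \<open>g v\<close>, and adjoining
    \<open>g v\<close> moves \<open>v\<close> from \<open>V - T\<close> into \<open>T\<close>, where
    the induction hypothesis applies.\<close>
  have "locally_regular (adjoin ?B ?P) (elem_syms g V k)"
  proof (rule locally_regular_adjoin_prod[OF B subC])
    show "finite (V - T)" using V by simp
    show "nonzerodivisor ?B (g v)" if "v \<in> V - T" for v using nz that .
    show "locally_regular (adjoin ?B (g v)) (elem_syms g V k)" if v: "v \<in> V - T" for v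
    proof -
      have "V - insert v T = (V - T) - {v}" by auto
      then have "card (V - insert v T) = k" using Suc.prems(2) v V by simp
      moreover have "adjoin ?B (g v) = ideal_span g (insert v T)" using v Suc.prems g by (intro adjoin_ideal_span fin) auto
      ultimately show ?thesis using Suc.IH[of "insert v T"] v Suc.prems by simp
    qed
  qed
  then have "locally_regular (adjoin ?B ?E) (elem_syms g V k)" using adjoin_cong[OF B EC PC EP] by simp
  with first show ?case by simp
qed simp

end

section \<open>Monomial ideals\<close>

abbreviation keys where "keys \<equiv> Poly_Mapping.keys"
abbreviation lookup where "lookup \<equiv> Poly_Mapping.lookup"
abbreviation mon :: "mono \<Rightarrow> 'k::field mpol" where "mon u \<equiv> Poly_Mapping.single u 1"

definition polys :: "(nat \<times> nat) set \<Rightarrow> 'k::field mpol set" where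
  "polys V = {p. \<forall>m\<in>keys p. keys m \<subseteq> V}"

lemma poly_ring_polys: "poly_ring V = ring_of_type_algebra \<lparr>carrier := polys V\<rparr>"
  unfolding poly_ring_def polys_def ..

lemma poly_ring_simps [simp]:
  "carrier (poly_ring V) = polys V" "x \<otimes>\<^bsub>poly_ring V\<^esub> y = x * y" "x \<oplus>\<^bsub>poly_ring V\<^esub> y = x + y"
  "\<one>\<^bsub>poly_ring V\<^esub> = 1" "\<zero>\<^bsub>poly_ring V\<^esub> = 0"
  unfolding poly_ring_polys ring_of_type_algebra_def by simp_all

lemma keys_mono_add: "keys (m + m' :: mono) = keys m \<union> keys m'"
  by (auto simp: in_keys_iff lookup_add)

lemma keys_single_subset: "keys (Poly_Mapping.single u c) \<subseteq> {u}"
  by (cases "c = 0") auto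

lemma keys_sum_subset: "keys (sum f A) \<subseteq> (\<Union>a\<in>A. keys (f a))"
proof (induction A rule: infinite_finite_induct)
  case (insert a A)
  then show ?case using Poly_Mapping.keys_add[of "f a" "sum f A"] by auto
qed auto

lemma single_in_polys [simp]: "keys u \<subseteq> V \<Longrightarrow> Poly_Mapping.single u c \<in> polys V"
  unfolding polys_def using keys_single_subset by fast

interpretation polys: subring_set "polys V :: 'k::field mpol set" for V
proof
  show "(1 :: 'k mpol) \<in> polys V" by (simp add: polys_def)
  show "(0 :: 'k mpol) \<in> polys V" by (simp add: polys_def)
  fix x y :: "'k mpol"
  assume x: "x \<in> polys V"
  show "- x \<in> polys V" using x unfolding polys_def by (auto simp: in_keys_iff)
  assume y: "y \<in> polys V"
  show "x + y \<in> polys V" using x y Poly_Mapping.keys_add[of x y] unfolding polys_def by blast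
  show "x * y \<in> polys V"
    using x y keys_mult[of x y] unfolding polys_def by (force simp: keys_mono_add)
qed

lemma cring_poly_ring: "cring (poly_ring V :: 'k::field mpol ring)"
proof (rule cringI)
  show "abelian_group (poly_ring V :: 'k mpol ring)"
  proof (rule abelian_groupI)
    fix x :: "'k mpol" assume "x \<in> carrier (poly_ring V)"
    then show "\<exists>y\<in>carrier (poly_ring V). y \<oplus>\<^bsub>poly_ring V\<^esub> x = \<zero>\<^bsub>poly_ring V\<^esub>"
      by (intro bexI[of _ "- x"]) auto
  qed (auto simp: algebra_simps)
  show "Group.comm_monoid (poly_ring V :: 'k mpol ring)"
    by (rule comm_monoidI) (auto simp: algebra_simps)
qed (auto simp: algebra_simps)

text \<open>Bridge between ideals in the sense of the ring records and the set-based calculus in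
  which the regularity arguments are carried out.\<close>

lemma ideal_poly_ring_iff: "ideal B (poly_ring V) \<longleftrightarrow> polys.is_ideal V (B :: 'k::field mpol set)"
proof
  interpret R: cring "poly_ring V :: 'k mpol ring" by (rule cring_poly_ring)
  { assume "ideal B (poly_ring V)"
    then interpret B: ideal B "poly_ring V" .
    show "polys.is_ideal V B" unfolding polys.is_ideal_def
      using B.a_closed B.I_l_closed B.a_subset additive_subgroup.zero_closed[OF B.additive_subgroup_axioms]
      by auto }
  assume B: "polys.is_ideal V B"
  note BD = polys.is_idealD[OF B]
  have minus: "\<ominus>\<^bsub>poly_ring V\<^esub> x = - x" if "x \<in> polys V" for x :: "'k mpol"
    using that by (intro R.minus_equality) auto
  show "ideal B (poly_ring V)"
  proof (rule idealI)
    show "subgroup B (add_monoid (poly_ring V))"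
    proof (rule R.add.subgroupI)
      show "B \<subseteq> carrier (poly_ring V)" using BD(1) by auto
      show "B \<noteq> {}" using BD(2) by auto
      show "\<ominus>\<^bsub>poly_ring V\<^esub> x \<in> B" if "x \<in> B" for x
        using that BD(1)[OF that] BD(5)[OF BD(2) that] minus by simp
      show "x \<oplus>\<^bsub>poly_ring V\<^esub> y \<in> B" if "x \<in> B" "y \<in> B" for x y using that BD(3) by simp
    qed
  next
    fix a x :: "'k mpol" assume "a \<in> B" "x \<in> carrier (poly_ring V)"
    then show "x \<otimes>\<^bsub>poly_ring V\<^esub> a \<in> B" "a \<otimes>\<^bsub>poly_ring V\<^esub> x \<in> B"
      using BD(4)[of x a] by (auto simp: mult.commute)
  qed (rule R.ring_axioms)
qed

lemma poly_sum_monomials: "p = (\<Sum>m\<in>keys p. Poly_Mapping.single m (lookup p m))"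
proof (rule poly_mapping_eqI)
  fix k
  have "lookup (\<Sum>m\<in>keys p. Poly_Mapping.single m (lookup p m)) k
     = (\<Sum>m\<in>keys p. if m = k then lookup p m else 0)"
    by (simp add: lookup_sum lookup_single when_def)
  also have "\<dots> = lookup p k" by (simp add: sum.delta' in_keys_iff)
  finally show "lookup p k = lookup (\<Sum>m\<in>keys p. Poly_Mapping.single m (lookup p m)) k" ..
qed

lemma lookup_single_mult_add:
  "lookup (Poly_Mapping.single u c * p) (u + m) = c * lookup p (m :: mono)" for p :: "'k::field mpol"
proof -
  have "Poly_Mapping.single u c * p = (\<Sum>w\<in>keys p. Poly_Mapping.single (u + w) (c * lookup p w))"
    by (subst (1) poly_sum_monomials[of p]) (simp add: sum_distrib_left mult_single)
  then have "lookup (Poly_Mapping.single u c * p) (u + m) = (\<Sum>w\<in>keys p. if w = m then c * lookup p w else 0)"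
    by (simp add: lookup_sum lookup_single when_def)
  also have "\<dots> = c * lookup p m" by (simp add: sum.delta' in_keys_iff)
  finally show ?thesis .
qed

lemma keys_mon_mult: "keys (mon u * p) = (+) u ` keys (p :: 'k::field mpol)"
proof
  show "keys (mon u * p) \<subseteq> (+) u ` keys p" using keys_mult[of "mon u" p] by auto
  show "(+) u ` keys p \<subseteq> keys (mon u * p)" by (auto simp: in_keys_iff lookup_single_mult_add)
qed

text \<open>Encoded by its monomials, so that identities of ideals become identities of sets.
  \<open>U\<close> may contain monomials in variables outside \<open>V\<close>; these are filtered
  out by \<open>polys V\<close>.\<close>

definition monomial_ideal :: "(nat \<times> nat) set \<Rightarrow> mono set \<Rightarrow> 'k::field mpol set" where
  "monomial_ideal V U = {p \<in> polys V. keys p \<subseteq> U}"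

definition up_closed :: "mono set \<Rightarrow> bool" where
  "up_closed U \<longleftrightarrow> (\<forall>m\<in>U. \<forall>w. m + w \<in> U)"

lemma is_ideal_monomial_ideal:
  assumes "up_closed U" shows "polys.is_ideal V (monomial_ideal V U :: 'k::field mpol set)"
  unfolding polys.is_ideal_def
proof (intro conjI ballI)
  fix x y :: "'k mpol" assume y: "y \<in> monomial_ideal V U"
  { assume "x \<in> monomial_ideal V U"
    then show "x + y \<in> monomial_ideal V U"
      using y Poly_Mapping.keys_add[of x y] unfolding monomial_ideal_def by auto }
  assume "x \<in> polys V"
  then show "x * y \<in> monomial_ideal V U"
    using y keys_mult[of x y] assms unfolding monomial_ideal_def up_closed_def
    by (fastforce simp: add.commute)
qed (auto simp: monomial_ideal_def)

lemma minus_mono_add: "(\<And>v. lookup u v \<le> lookup m v) \<Longrightarrow> u + (m - u) = (m :: mono)"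
  by (rule poly_mapping_eqI) (simp add: lookup_add lookup_minus)

text \<open>A polynomial of the larger ideal is split into its terms in \<open>U\<close> and the
  remaining terms, each of which is divisible by \<open>u\<close>.\<close>

lemma adjoin_monomial_ideal:
  assumes U: "up_closed U" and u: "keys u \<subseteq> V"
  shows "polys.adjoin V (monomial_ideal V U) (mon u :: 'k::field mpol) = monomial_ideal V (U \<union> range ((+) u))"
proof
  have up: "up_closed (U \<union> range ((+) u))" using U unfolding up_closed_def by (auto simp: add.assoc)
  show "polys.adjoin V (monomial_ideal V U) (mon u :: 'k mpol) \<subseteq> monomial_ideal V (U \<union> range ((+) u))"
  proof (rule polys.adjoin_minimal[OF is_ideal_monomial_ideal[OF up]])
    show "mon u \<in> monomial_ideal V (U \<union> range ((+) u))"
      using u unfolding monomial_ideal_def by (auto intro: image_eqI[of _ _ 0])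
  qed (auto simp: monomial_ideal_def)
  show "monomial_ideal V (U \<union> range ((+) u)) \<subseteq> polys.adjoin V (monomial_ideal V U) (mon u :: 'k mpol)"
  proof
    fix z :: "'k mpol" assume z: "z \<in> monomial_ideal V (U \<union> range ((+) u))"
    let ?s = "\<lambda>m. Poly_Mapping.single m (lookup z m)"
    let ?b = "\<Sum>m\<in>keys z \<inter> U. ?s m" and ?r = "\<Sum>m\<in>keys z - U. Poly_Mapping.single (m - u) (lookup z m)"
    have kV: "keys m \<subseteq> V" if "m \<in> keys z" for m using z that unfolding monomial_ideal_def polys_def by auto
    have mu: "u + (m - u) = m" if "m \<in> keys z - U" for m
      using z that unfolding monomial_ideal_def by auto
    have "?b \<in> monomial_ideal V U"
    proof -
      have "keys ?b \<subseteq> keys z \<inter> U" using keys_sum_subset[of ?s "keys z \<inter> U"] keys_single_subset by fast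
      moreover have "?b \<in> polys V" by (intro polys.sum_C single_in_polys kV) auto
      ultimately show ?thesis unfolding monomial_ideal_def by auto
    qed
    moreover have "?r \<in> polys V"
    proof (intro polys.sum_C single_in_polys)
      fix m assume m: "m \<in> keys z - U"
      show "keys (m - u) \<subseteq> V" using kV[of m] mu[OF m] m keys_mono_add[of u "m - u"] by auto
    qed
    moreover have "z = ?b + ?r * mon u"
    proof -
      have "?r * mon u = (\<Sum>m\<in>keys z - U. ?s m)"
        unfolding sum_distrib_right by (rule sum.cong) (auto simp: mult_single mu add.commute)
      moreover have "z = (\<Sum>m\<in>keys z. ?s m)" by (rule poly_sum_monomials)
      moreover have "(\<Sum>m\<in>keys z. ?s m) = ?b + (\<Sum>m\<in>keys z - U. ?s m)"
        by (subst sum.Int_Diff[of _ _ U]) auto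
      ultimately show ?thesis by simp
    qed
    ultimately show "z \<in> polys.adjoin V (monomial_ideal V U) (mon u)" unfolding polys.adjoin_def by blast
  qed
qed

section \<open>Divisibility by a shifted monomial\<close>

text \<open>Some increasing map sends the columns \<open>1, \<dots>, L\<close> of \<open>a\<close> to columns in \<open>1, \<dots>, n\<close> such that the
  moved monomial divides \<open>m\<close>; the recursion asks whether column \<open>L\<close> goes to column \<open>n\<close>.\<close>

fun shift_divides :: "nat \<Rightarrow> (nat \<Rightarrow> nat \<Rightarrow> nat) \<Rightarrow> nat \<Rightarrow> nat \<Rightarrow> mono \<Rightarrow> bool" where
  "shift_divides c a 0 n m = True"
| "shift_divides c a (Suc L) 0 m = False"
| "shift_divides c a (Suc L) (Suc n) m =
    (shift_divides c a (Suc L) n m \<or> ((\<forall>i\<in>{1..c}. a i (Suc L) \<le> lookup m (i, Suc n)) \<and> shift_divides c a L n m))"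

lemma shift_divides_le: "shift_divides c a L n m \<Longrightarrow> L \<le> n"
  by (induction c a L n m rule: shift_divides.induct) auto

lemma shift_divides_cong:
  "(\<And>i j. i \<in> {1..c} \<Longrightarrow> j \<in> {1..n} \<Longrightarrow> lookup m (i, j) = lookup m' (i, j)) \<Longrightarrow> shift_divides c a L n m = shift_divides c a L n m'"
  by (induction c a L n m rule: shift_divides.induct) auto

lemma shift_divides_mono:
  "shift_divides c a L n m \<Longrightarrow> (\<And>v. lookup m v \<le> lookup m' v) \<Longrightarrow> shift_divides c a L n m'"
  by (induction c a L n m rule: shift_divides.induct) (auto intro: order_trans)

lemma shift_divides_Suc_col: "shift_divides c a L n m \<Longrightarrow> shift_divides c a L (Suc n) m"
  by (cases L) auto

text \<open>Forget the last of the placed columns. This is needed to identify the colon ideal in the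
  exact sequence, and again for the Hilbert series.\<close>

lemma shift_divides_Suc_row: "shift_divides c a (Suc L) n m \<Longrightarrow> shift_divides c a L n m"
  by (induction n) (auto intro: shift_divides_Suc_col)

text \<open>The monomials of the ideal generated by the variables in \<open>T\<close>.\<close>

definition meets :: "(nat \<times> nat) set \<Rightarrow> mono set" where
  "meets T = {m. \<exists>t\<in>T. lookup m t > 0}"

lemma up_closed_meets: "up_closed (meets T)"
  unfolding up_closed_def meets_def by (auto simp: lookup_add)

lemma up_closed_shift_divides: "up_closed {m. shift_divides c a L n m}"
  unfolding up_closed_def by (auto intro: shift_divides_mono simp: lookup_add)

lemma up_closed_Un: "up_closed A \<Longrightarrow> up_closed B \<Longrightarrow> up_closed (A \<union> B)"
  unfolding up_closed_def by auto

lemma range_add_single: "range ((+) (Poly_Mapping.single v 1)) = {m :: mono. lookup m v > 0}"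
proof (intro equalityI subsetI)
  fix m :: mono assume "m \<in> {m. lookup m v > 0}"
  then have "Poly_Mapping.single v 1 + (m - Poly_Mapping.single v 1) = m"
    by (intro minus_mono_add) (auto simp: lookup_single when_def)
  then show "m \<in> range ((+) (Poly_Mapping.single v 1))" by (metis rangeI)
qed (auto simp: lookup_add)

lemma adjoin_monomial_ideal_var:
  assumes "up_closed U" "v \<in> V"
  shows "polys.adjoin V (monomial_ideal V U) (mon (Poly_Mapping.single v 1) :: 'k::field mpol)
    = monomial_ideal V (U \<union> {m. lookup m v > 0})"
  using adjoin_monomial_ideal[OF assms(1), of "Poly_Mapping.single v 1" V] assms(2)
  unfolding range_add_single by simp

locale poly_local = local_subring "polys V" S for V and S :: "'k::field mpol set"
begin

lemma nonzerodivisor_mon: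
  assumes "keys u \<subseteq> V" "\<And>m. u + m \<in> U \<Longrightarrow> m \<in> U"
  shows "nonzerodivisor (monomial_ideal V U) (mon u :: 'k mpol)"
  unfolding nonzerodivisor_def using assms by (auto simp: monomial_ideal_def keys_mon_mult)

text \<open>Deleting columns from the right reduces to ideals generated by variables; every
  step keeps the number of columns containing a killed variable fixed.\<close>

lemma locally_regular_shift_divides:
  assumes V: "V = {1..c} \<times> {1..N}" and fs: "set fs \<subseteq> polys V"
    and vars: "\<And>T. T \<subseteq> V \<Longrightarrow> card T = h \<Longrightarrow> locally_regular (monomial_ideal V (meets T)) fs"
    and "n \<le> N" "T \<subseteq> {1..c} \<times> {Suc n..N}" "card T + n + 1 = h + L" "L \<le> n + 1"
  shows "locally_regular (monomial_ideal V ({m. shift_divides c a L n m} \<union> meets T)) fs"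
  using assms(4-7)
\<comment> \<open>The equation \<open>card T + n + 1 = h + L\<close> says that
  \<open>n + 1 - L\<close> variables are still missing from a set of size \<open>h\<close>: placing
  column \<open>L\<close> in the last column lowers both \<open>n\<close> and \<open>L\<close>,
  while killing a variable of the last column lowers \<open>n\<close> and enlarges
  \<open>T\<close>.\<close>
proof (induction n arbitrary: L T)
  case 0
  have TV: "T \<subseteq> V" using 0 unfolding V by auto
  show ?case
  \<comment> \<open>For \<open>L = 0\<close> the ideal is the unit ideal; for \<open>L = 1\<close>
    nothing can be placed, and \<open>T\<close> already has size \<open>h\<close>.\<close>
  proof (cases L)
    case 0
    show ?thesis by (rule locally_regular_trivial[OF is_ideal_monomial_ideal fs one_S])
      (auto simp: up_closed_def monomial_ideal_def 0)
  next
    case (Suc L')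
    then show ?thesis using 0 TV vars[of T] by simp
  qed
next
  case (Suc n)
  have TV: "T \<subseteq> V" using Suc.prems unfolding V by auto
  have finT: "finite T" using TV unfolding V by (rule finite_subset) simp
  show ?case
  proof (cases L)
    case 0
    show ?thesis by (rule locally_regular_trivial[OF is_ideal_monomial_ideal fs one_S])
      (auto simp: up_closed_def monomial_ideal_def 0)
  next
    case L: (Suc L')
    show ?thesis
    proof (cases "L' = Suc n")
      \<comment> \<open>Here \<open>L\<close> is \<open>n + 2\<close>, too many columns for the
        \<open>n + 1\<close> available ones, so only the variables in \<open>T\<close> remain, and
        their number is \<open>h\<close>.\<close>
      case True
      then have "{m. shift_divides c a L (Suc n) m} = {}" using L shift_divides_le[of c a L "Suc n"] by auto
      moreover have "card T = h" using Suc.prems L True by simp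
      ultimately show ?thesis using vars[OF TV] by simp
    next
      case False
      then have L'n: "L' \<le> n" using Suc.prems L by auto
      let ?col = "{1..c} \<times> {Suc n}"
      \<comment> \<open>\<open>u\<close> is column \<open>L\<close> of \<open>a\<close> placed in
        column \<open>Suc n\<close>. Then \<open>?B\<close> describes the colon ideal of
        \<open>?A\<close> by \<open>u\<close>, and \<open>?D\<close> together with \<open>u\<close>
        describes the sum of \<open>?A\<close> and the ideal of \<open>u\<close>.\<close>
      define u :: mono where "u = (\<Sum>i\<in>{1..c}. Poly_Mapping.single (i, Suc n) (a i L))"
      let ?A = "{m. shift_divides c a L (Suc n) m} \<union> meets T"
      let ?B = "{m. shift_divides c a L' n m} \<union> meets T"
      let ?D = "{m. shift_divides c a L n m} \<union> meets T"
      have colV: "?col \<subseteq> V" unfolding V using Suc.prems by auto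
      have ku: "keys u \<subseteq> ?col"
        unfolding u_def by (rule subset_trans[OF keys_sum_subset]) (use keys_single_subset in fast)
      have lu: "lookup u (i, j) = (if i \<in> {1..c} \<and> j = Suc n then a i L else 0)" for i j
        unfolding u_def by (auto simp: lookup_sum lookup_single when_def cong: if_cong)
      have up: "up_closed ?A" "up_closed ?B" "up_closed ?D"
        by (intro up_closed_Un up_closed_shift_divides up_closed_meets)+
      have ru: "range ((+) u) = {m. \<forall>i\<in>{1..c}. a i L \<le> lookup m (i, Suc n)}"
      proof (intro equalityI subsetI)
        fix m :: mono assume m: "m \<in> {m. \<forall>i\<in>{1..c}. a i L \<le> lookup m (i, Suc n)}"
        have "lookup u v \<le> lookup m v" for v
        proof -
          obtain i j where v: "v = (i, j)" by (cases v)
          show ?thesis unfolding v lu using m by auto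
        qed
        from minus_mono_add[OF this] show "m \<in> range ((+) u)" by (intro range_eqI[of _ _ "m - u"]) (rule sym)
      next
        fix m :: mono assume "m \<in> range ((+) u)"
        then obtain w where "m = u + w" by blast
        then show "m \<in> {m. \<forall>i\<in>{1..c}. a i L \<le> lookup m (i, Suc n)}" by (simp add: lookup_add lu)
      qed
      have mon_prod: "(mon u :: 'k mpol) = (\<Prod>v\<in>?col. mon (Poly_Mapping.single v 1) ^ a (fst v) L)"
      proof -
        have pw: "mon (Poly_Mapping.single v 1) ^ k = (mon (Poly_Mapping.single v k) :: 'k mpol)"
          for v :: "nat \<times> nat" and k
          by (induction k) (auto simp: mult_single single_add[symmetric])
        have "(\<Prod>v\<in>W. mon (Poly_Mapping.single v (a (fst v) L)))
           = (mon (\<Sum>v\<in>W. Poly_Mapping.single v (a (fst v) L)) :: 'k mpol)" for W :: "(nat \<times> nat) set"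
          by (induction W rule: infinite_finite_induct) (auto simp: mult_single)
        moreover have "(\<Sum>v\<in>?col. Poly_Mapping.single v (a (fst v) L)) = u"
          unfolding u_def
          by (rule sum.reindex_bij_witness[of _ "\<lambda>i. (i, Suc n)" fst]) auto
        ultimately show ?thesis unfolding pw u_def by simp
      qed
      have notT: "u + m \<in> meets T \<Longrightarrow> m \<in> meets T" if "keys u \<subseteq> ?col" for u m
      proof -
        assume "u + m \<in> meets T"
        then obtain t where t: "t \<in> T" "lookup (u + m) t > 0" unfolding meets_def by auto
        have "t \<notin> ?col" using t(1) Suc.prems by auto
        then have "lookup u t = 0" using that by (meson in_keys_iff subsetD)
        then show "m \<in> meets T" using t unfolding meets_def by (auto simp: lookup_add)
      qed
      have shift_divides_u: "shift_divides c a l n (u + m) = shift_divides c a l n m" if "keys u \<subseteq> ?col" for u m l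
      proof (rule shift_divides_cong)
        fix i j assume "j \<in> {1..n}"
        then have "(i, j) \<notin> ?col" by auto
        then have "lookup u (i, j) = 0" using that by (meson in_keys_iff subsetD)
        then show "lookup (u + m) (i, j) = lookup m (i, j)" by (simp add: lookup_add)
      qed
      \<comment> \<open>\<open>u\<close> is a product of powers of variables of one column, and that
        column is invisible to \<open>?D\<close>; so each of its variables is a nonzerodivisor there
        and may be adjoined separately, which adds it to \<open>T\<close>.\<close>
      have D: "locally_regular (monomial_ideal V (?D \<union> range ((+) u))) fs"
      proof -
        have "locally_regular (polys.adjoin V (monomial_ideal V ?D) (\<Prod>v\<in>?col. mon (Poly_Mapping.single v 1) ^ a (fst v) L)) fs"
        proof (rule locally_regular_adjoin_prod[OF is_ideal_monomial_ideal[OF up(3)] fs])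
          fix v assume v: "v \<in> ?col"
          have kv: "keys (Poly_Mapping.single v 1 :: mono) \<subseteq> ?col" using v by simp
          show "nonzerodivisor (monomial_ideal V ?D) (mon (Poly_Mapping.single v 1))"
            by (rule nonzerodivisor_mon) (use kv colV shift_divides_u[OF kv] notT[OF kv] in auto)
          have "v \<notin> T" using v Suc.prems by auto
          have "locally_regular (monomial_ideal V ({m. shift_divides c a L n m} \<union> meets (insert v T))) fs"
            by (rule Suc.IH) (use Suc.prems v L L'n \<open>v \<notin> T\<close> finT in auto)
          moreover have "{m. shift_divides c a L n m} \<union> meets (insert v T) = ?D \<union> {m. lookup m v > 0}"
            unfolding meets_def by auto
          ultimately show "locally_regular (polys.adjoin V (monomial_ideal V ?D) (mon (Poly_Mapping.single v 1))) fs"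
            unfolding adjoin_monomial_ideal_var[OF up(3) subsetD[OF colV v]] by simp
        qed simp
        then show ?thesis unfolding mon_prod[symmetric] adjoin_monomial_ideal[OF up(3) subset_trans[OF ku colV]] .
      qed
      have B: "locally_regular (monomial_ideal V ?B) fs"
        by (rule Suc.IH) (use Suc.prems L L'n in auto)
      have step: "shift_divides c a L (Suc n) m \<longleftrightarrow> shift_divides c a L n m \<or> (m \<in> range ((+) u) \<and> shift_divides c a L' n m)" for m
        unfolding ru L by simp
      have upD: "up_closed (?D \<union> range ((+) u))" 
        by (rule up_closed_Un[OF up(3)]) (auto simp: up_closed_def add.assoc)
      have uV: "keys u \<subseteq> V" using ku colV by auto
      show ?thesis
      proof (rule locally_regular_exact[OF is_ideal_monomial_ideal[OF up(1)] is_ideal_monomial_ideal[OF up(2)] is_ideal_monomial_ideal[OF upD]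
            single_in_polys[OF uV] fs])
        show "monomial_ideal V ?A \<subseteq> monomial_ideal V (?D \<union> range ((+) u))"
          unfolding monomial_ideal_def using step by auto
        show "mon u \<in> monomial_ideal V (?D \<union> range ((+) u))"
          using uV unfolding monomial_ideal_def by (auto intro: image_eqI[of _ _ 0])
        show "locally_regular (monomial_ideal V ?B) fs" "locally_regular (monomial_ideal V (?D \<union> range ((+) u))) fs" by fact+
      next
        fix z :: "'k mpol" assume "z \<in> monomial_ideal V (?D \<union> range ((+) u))"
        then have "z \<in> polys.adjoin V (monomial_ideal V ?D) (mon u)" unfolding adjoin_monomial_ideal[OF up(3) uV] .
        then obtain b r where b: "b \<in> monomial_ideal V ?D" "r \<in> polys V" "z = b + r * mon u"
          by (elim polys.adjE)
        have "b \<in> monomial_ideal V ?A" using b(1) step unfolding monomial_ideal_def by auto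
        then have "1 * z - r * mon u \<in> monomial_ideal V ?A" using b(3) by simp
        then show "\<exists>s\<in>S. \<exists>r\<in>polys V. s * z - r * mon u \<in> monomial_ideal V ?A" using b(2) one_S by blast
      next
        fix b :: "'k mpol" assume b: "b \<in> monomial_ideal V ?B"
        have "u + m \<in> ?A" if "m \<in> ?B" for m
          using that step[of "u + m"] shift_divides_u[OF ku] up_closed_meets[of T]
          unfolding up_closed_def by (auto simp: add.commute)
        then show "mon u * b \<in> monomial_ideal V ?A"
          using b uV unfolding monomial_ideal_def by (auto simp: keys_mon_mult)
      next
        \<comment> \<open>If all \<open>L\<close> columns already fit before column
          \<open>Suc n\<close>, forgetting the last of them shows \<open>m \<in> ?B\<close>;
          otherwise the recursion gives it directly. Killed variables do not occur in
          \<open>u\<close>.\<close>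
        fix z :: "'k mpol" assume z: "z \<in> polys V" "mon u * z \<in> monomial_ideal V ?A"
        have "m \<in> ?B" if "u + m \<in> ?A" for m
          using that step[of "u + m"] shift_divides_u[OF ku, of _ m] notT[OF ku, of m] shift_divides_Suc_row[of c a L' n m] L by auto
        then have "1 * z \<in> monomial_ideal V ?B" using z unfolding monomial_ideal_def by (auto simp: keys_mon_mult)
        then show "\<exists>s\<in>S. s * z \<in> monomial_ideal V ?B" using one_S by blast
      qed
    qed
  qed
qed

end

section \<open>Zariski's lemma\<close>

lemma set_map2_subset:
  "(\<And>a b. a \<in> set Ks \<Longrightarrow> b \<in> set Ls \<Longrightarrow> f a b \<in> H) \<Longrightarrow> set (map2 f Ks Ls) \<subseteq> H"
  by (auto dest: set_zip_leftD set_zip_rightD)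

lemma (in ring) combine_unique:
  assumes K: "subfield K R" and ind: "independent K Us"
    and Ks: "set Ks \<subseteq> K" "length Ks = length Us" and Ls: "set Ls \<subseteq> K" "length Ls = length Us"
    and eq: "combine Ks Us = combine Ls Us"
  shows "Ks = Ls"
proof -
  have Kc: "K \<subseteq> carrier R" by (rule subfieldE(3)[OF K])
  have Us: "set Us \<subseteq> carrier R" by (rule independent_in_carrier[OF ind])
  have mK: "\<ominus> \<one> \<in> K" using subringE(3,5)[OF subfieldE(1)[OF K]] by auto
  let ?N = "map ((\<otimes>) (\<ominus> \<one>)) Ls"
  have N: "set ?N \<subseteq> K" "length ?N = length Us"
    using Ls mK subringE(6)[OF subfieldE(1)[OF K]] by auto
  let ?D = "map2 (\<oplus>) Ks ?N"
  have DK: "set ?D \<subseteq> K"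
    by (rule set_map2_subset) (use Ks(1) N(1) subringE(7)[OF subfieldE(1)[OF K]] in blast)
  have "combine ?D Us = combine Ks Us \<oplus> combine ?N Us"
    using combine_add[of Ks Us ?N] Ks N Kc Us by auto
  also have "combine ?N Us = \<ominus> \<one> \<otimes> combine Ls Us"
    using combine_r_distr[of Ls Us "\<ominus> \<one>"] Ls Kc Us by auto
  also have "\<dots> = \<ominus> (combine Ks Us)"
    unfolding eq using combine_in_carrier[of Ls Us] Ls Kc Us l_minus by auto
  also have "combine Ks Us \<oplus> \<ominus> (combine Ks Us) = \<zero>"
    using combine_in_carrier[of Ks Us] Ks Kc Us r_neg by auto
  finally have zero: "set (take (length Us) ?D) \<subseteq> {\<zero>}"
    using independent_imp_trivial_combine[OF K ind DK] by simp
  show ?thesis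
  proof (rule nth_equalityI)
    fix i assume i: "i < length Ks"
    have "?D ! i \<in> set (take (length Us) ?D)" using i Ks(2) Ls(2) by (metis length_map length_zip min.idem nth_mem take_all order_refl)
    then have "Ks ! i \<oplus> \<ominus> \<one> \<otimes> Ls ! i = \<zero>" using zero i Ks(2) Ls(2) by auto
    moreover have "Ks ! i \<in> carrier R" "Ls ! i \<in> carrier R" using i Ks Ls Kc nth_mem by (metis subsetD)+
    ultimately show "Ks ! i = Ls ! i" using l_minus minus_equality by (metis l_one one_closed add.inv_solve_right l_zero zero_closed minus_minus a_inv_closed r_neg1 add.m_comm)
  qed (use Ks Ls in simp)
qed

text \<open>With \<open>w\<close> a power of \<open>z\<close>, this passes from
  \<open>z [^] Suc j\<close> times the inverse of \<open>1 + z\<close> to \<open>z [^] j\<close>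
  times that inverse; iteration removes the power altogether.\<close>

lemma (in ring) geometric_step:
  assumes "w \<in> carrier R" "z \<in> carrier R" "i \<in> carrier R" "(\<one> \<oplus> z) \<otimes> i = \<one>"
  shows "w \<otimes> i = w \<oplus> \<ominus> ((w \<otimes> z) \<otimes> i)"
proof -
  have "w = w \<otimes> ((\<one> \<oplus> z) \<otimes> i)" using assms by simp
  also have "\<dots> = w \<otimes> i \<oplus> (w \<otimes> z) \<otimes> i" using assms(1-3) by (simp add: l_distr r_distr m_assoc)
  finally have "w \<oplus> \<ominus> ((w \<otimes> z) \<otimes> i) = (w \<otimes> i \<oplus> (w \<otimes> z) \<otimes> i) \<oplus> \<ominus> ((w \<otimes> z) \<otimes> i)" by simp
  also have "\<dots> = w \<otimes> i" using assms(1-3) by (simp add: a_assoc r_neg)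
  finally show ?thesis ..
qed

context field
begin

text \<open>Evaluation at a transcendental element identifies the simple extension with a polynomial
  ring, whose units are the constants.\<close>

lemma simple_extension_inverse_mem:
  assumes K: "subfield K R" and x: "x \<in> carrier R" and tr: "(transcendental over K) x"
    and y: "y \<in> simple_extension K x" and z: "z \<in> simple_extension K x" and yz: "y \<otimes> z = \<one>"
  shows "y \<in> K"
proof -
  have Ksub: "subring K R" by (rule subfieldE(1)[OF K])
  interpret UP: domain "K[X]" by (rule univ_poly_is_domain[OF Ksub])
  interpret h: ring_hom_ring "K[X]" R "\<lambda>p. eval p x" by (rule eval_ring_hom[OF Ksub x])
  have inj: "inj_on (\<lambda>p. eval p x) (carrier (K[X]))" using tr unfolding over_def transcendental_def by simp
  obtain p q where p: "p \<in> carrier (K[X])" "y = eval p x" and q: "q \<in> carrier (K[X])" "z = eval q x"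
    using y z unfolding simple_extension_as_eval_img[OF subringE(1)[OF Ksub] x] by auto
  have "eval (p \<otimes>\<^bsub>K[X]\<^esub> q) x = eval \<one>\<^bsub>K[X]\<^esub> x"
    using h.hom_mult[OF p(1) q(1)] h.hom_one yz p(2) q(2) by simp
  then have "p \<otimes>\<^bsub>K[X]\<^esub> q = \<one>\<^bsub>K[X]\<^esub>"
    using inj_onD[OF inj] p(1) q(1) UP.m_closed UP.one_closed by blast
  moreover from this have "q \<otimes>\<^bsub>K[X]\<^esub> p = \<one>\<^bsub>K[X]\<^esub>" using UP.m_comm[OF p(1) q(1)] by simp
  ultimately have "p \<in> Units (K[X])" using p(1) q(1) unfolding Units_def by blast
  then obtain k where "k \<in> K" "p = [k]" unfolding univ_poly_units[OF K] by auto
  then show ?thesis using p(2) subringE(1)[OF Ksub] by auto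
qed

text \<open>If \<open>K(x)\<close> were the field of fractions of a polynomial ring \<open>K[x]\<close>, then a common
  denominator \<open>u\<close> of all structure constants of \<open>carrier R\<close> over \<open>K(x)\<close> would be divisible by
  all primes of \<open>K[x]\<close>; \<open>1 + x u\<close> shows that this is impossible.\<close>

lemma transcendental_not_finitely_generated:
  assumes K: "subfield K R" and x: "x \<in> carrier R" and tr: "(transcendental over K) x"
    and xs: "set xs \<subseteq> carrier R" and gen: "finite_extension K (x # xs) = carrier R"
    and fin: "finite_dimension (generate_field R (insert x K)) (carrier R)"
  shows False
proof -
  define A where "A = simple_extension K x"
  define E where "E = generate_field R (insert x K)"
  have Ksub: "subring K R" by (rule subfieldE(1)[OF K])
  have Kc: "K \<subseteq> carrier R" by (rule subringE(1)[OF Ksub])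
  have KA: "K \<subseteq> A" unfolding A_def by (rule simple_extension_incl[OF Kc x])
  have xA: "x \<in> A" unfolding A_def by (rule simple_extension_mem[OF Ksub x])
  have Asub: "subring A R" unfolding A_def by (rule simple_extension_is_subring[OF Ksub x])
  note A = subringE[OF Asub]
  have Ac: "a \<in> A \<Longrightarrow> a \<in> carrier R" for a using A(1) by auto
  have E: "subfield E R" unfolding E_def using Kc x by (intro generate_field_is_subfield) auto
  have Ec: "E \<subseteq> carrier R" by (rule subfieldE(3)[OF E])
  \<comment> \<open>\<open>Fr\<close> is the fraction field of \<open>A\<close> inside
    \<open>R\<close>; it is a subfield containing \<open>K\<close> and \<open>x\<close>, so it
    contains \<open>E\<close>.\<close>
  define Fr where "Fr = {e \<in> carrier R. \<exists>q\<in>A - {\<zero>}. q \<otimes> e \<in> A}"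
  have AFr: "A \<subseteq> Fr"
  proof
    fix a assume a: "a \<in> A"
    have "\<one> \<in> A - {\<zero>}" using A(3) by simp
    moreover have "\<one> \<otimes> a \<in> A" using a Ac by simp
    ultimately show "a \<in> Fr" unfolding Fr_def using a Ac by blast
  qed
  have Frsub: "subring Fr R"
  proof (rule subringI)
    show "Fr \<subseteq> carrier R" unfolding Fr_def by auto
    show "\<one> \<in> Fr" using AFr A(3) by auto
  next
    fix h assume "h \<in> Fr"
    then obtain q where q: "h \<in> carrier R" "q \<in> A - {\<zero>}" "q \<otimes> h \<in> A" unfolding Fr_def by auto
    have "q \<otimes> \<ominus> h = \<ominus> (q \<otimes> h)" using q Ac by (simp add: r_minus)
    then have "q \<otimes> \<ominus> h \<in> A" using A(5)[OF q(3)] by simp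
    then show "\<ominus> h \<in> Fr" unfolding Fr_def using q by auto
  next
    fix h k assume "h \<in> Fr" "k \<in> Fr"
    then obtain q s where q: "h \<in> carrier R" "q \<in> A - {\<zero>}" "q \<otimes> h \<in> A"
      "k \<in> carrier R" "s \<in> A - {\<zero>}" "s \<otimes> k \<in> A" unfolding Fr_def by auto
    have c: "q \<in> carrier R" "s \<in> carrier R" using q Ac by auto
    have qs: "q \<otimes> s \<in> A - {\<zero>}" using q A(6) c integral_iff by auto
    have "(q \<otimes> s) \<otimes> (h \<otimes> k) = (q \<otimes> h) \<otimes> (s \<otimes> k)" using q c by (simp add: m_ac)
    then have "(q \<otimes> s) \<otimes> (h \<otimes> k) \<in> A" using A(6)[OF q(3,6)] by simp
    then show "h \<otimes> k \<in> Fr" unfolding Fr_def using q qs by blast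
    have "(q \<otimes> s) \<otimes> (h \<oplus> k) = s \<otimes> (q \<otimes> h) \<oplus> q \<otimes> (s \<otimes> k)" using q c by (simp add: m_ac r_distr)
    moreover have "s \<otimes> (q \<otimes> h) \<in> A" "q \<otimes> (s \<otimes> k) \<in> A" using A(6) q by auto
    ultimately have "(q \<otimes> s) \<otimes> (h \<oplus> k) \<in> A" using A(7) by simp
    then show "h \<oplus> k \<in> Fr" unfolding Fr_def using q qs by blast
  qed
  have "subfield Fr R"
  proof (rule subfieldI'[OF Frsub])
    fix k assume "k \<in> Fr - {\<zero>}"
    then obtain q where q: "k \<in> carrier R" "k \<noteq> \<zero>" "q \<in> A - {\<zero>}" "q \<otimes> k \<in> A" unfolding Fr_def by auto
    have qc: "q \<in> carrier R" using q Ac by auto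
    have kU: "k \<in> Units R" using q by (simp add: field_Units)
    have "q \<otimes> k \<in> A - {\<zero>}" using q qc integral_iff by auto
    moreover have "(q \<otimes> k) \<otimes> inv k = q" using kU qc q(1) by (simp add: m_assoc)
    ultimately have "(q \<otimes> k) \<otimes> inv k \<in> A" "q \<otimes> k \<in> A - {\<zero>}" using q(3) by auto
    then show "inv k \<in> Fr" unfolding Fr_def using Units_inv_closed[OF kU] by blast
  qed
  then have EFr: "E \<subseteq> Fr" unfolding E_def
    using generate_field_min_subfield1[of "insert x K" Fr] Kc x AFr KA xA by auto
  have common: "\<exists>u\<in>A - {\<zero>}. \<forall>e\<in>F. u \<otimes> e \<in> A" if "finite F" "F \<subseteq> Fr" for F
    using that
  proof (induction F rule: finite_induct)
    case empty
    have "\<one> \<in> A - {\<zero>}" using A(3) by simp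
    then show ?case by blast
  next
    case (insert e F)
    then obtain u where u: "u \<in> A - {\<zero>}" "\<forall>e\<in>F. u \<otimes> e \<in> A" by auto
    obtain q where q: "e \<in> carrier R" "q \<in> A - {\<zero>}" "q \<otimes> e \<in> A" using insert.prems unfolding Fr_def by auto
    have c: "u \<in> carrier R" "q \<in> carrier R" using u q Ac by auto
    have "(u \<otimes> q) \<otimes> d \<in> A" if d: "d \<in> insert e F" for d
    proof (cases "d = e")
      case True
      have "(u \<otimes> q) \<otimes> e = u \<otimes> (q \<otimes> e)" using c q by (simp add: m_assoc)
      then show ?thesis using True A(6) u q by simp
    next
      case False
      then have dF: "d \<in> F" using d by simp
      then have "d \<in> carrier R" using insert.prems unfolding Fr_def by auto
      then have "(u \<otimes> q) \<otimes> d = q \<otimes> (u \<otimes> d)" using c by (simp add: m_ac)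
      then show ?thesis using A(6) u q dF by simp
    qed
    moreover have "u \<otimes> q \<in> A - {\<zero>}" using u q A(6) c integral_iff by auto
    ultimately show ?case by blast
  qed
  obtain n where "dimension n E (carrier R)" using fin unfolding E_def finite_dimension_def by auto
  then obtain Vs where Vs: "set Vs \<subseteq> carrier R" "independent E Vs" "Span E Vs = carrier R"
    using exists_base[OF E] by blast
  have "\<exists>Ks. set Ks \<subseteq> E \<and> length Ks = length Vs \<and> y = combine Ks Vs" if "y \<in> carrier R" for y
    using Span_mem_iff_length_version[OF E Vs(1), of y] that Vs(3) by simp
  then obtain co where co: "\<And>y. y \<in> carrier R \<Longrightarrow> set (co y) \<subseteq> E \<and> length (co y) = length Vs \<and> y = combine (co y) Vs"
    by metis
  \<comment> \<open>The finitely many elements whose coordinates over the basis \<open>Vs\<close>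
    matter: 1, and the products of basis elements with generators.\<close>
  define Y where "Y = insert \<one> ((\<lambda>(v, z). v \<otimes> z) ` (set Vs \<times> set xs))"
  have Yc: "Y \<subseteq> carrier R" unfolding Y_def using Vs(1) xs by auto
  have "finite (\<Union>y\<in>Y. set (co y))" unfolding Y_def by simp
  moreover have "(\<Union>y\<in>Y. set (co y)) \<subseteq> Fr" using co Yc EFr by blast
  ultimately obtain u where u: "u \<in> A - {\<zero>}" "\<And>y e. y \<in> Y \<Longrightarrow> e \<in> set (co y) \<Longrightarrow> u \<otimes> e \<in> A"
    using common[of "\<Union>y\<in>Y. set (co y)"] by blast
  have uc: "u \<in> carrier R" using u Ac by auto
  have upA: "u [^] (k::nat) \<in> A" for k
  proof (induction k)
    case 0 show ?case using A(3) by simp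
  next
    case (Suc k) then show ?case using A(6) u by simp
  qed
  \<comment> \<open>\<open>B\<close> is \<open>A\<close> with \<open>u\<close> inverted; it contains
    the coordinates of all elements of \<open>Y\<close>.\<close>
  define B where "B = {e \<in> carrier R. \<exists>k::nat. u [^] k \<otimes> e \<in> A}"
  have Bc: "B \<subseteq> carrier R" unfolding B_def by auto
  have AB: "A \<subseteq> B"
  proof
    fix a assume a: "a \<in> A"
    then have "u [^] (0::nat) \<otimes> a \<in> A" using Ac by simp
    then show "a \<in> B" unfolding B_def using a Ac by blast
  qed
  have Bmult: "h \<otimes> k \<in> B" and Badd: "h \<oplus> k \<in> B" if hk: "h \<in> B" "k \<in> B" for h k
  proof -
    obtain i j :: nat where ij: "h \<in> carrier R" "u [^] i \<otimes> h \<in> A" "k \<in> carrier R" "u [^] j \<otimes> k \<in> A"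
      using hk unfolding B_def by auto
    have pw: "u [^] (i + j) = u [^] i \<otimes> u [^] j" using uc by (simp add: nat_pow_mult)
    have "u [^] (i + j) \<otimes> (h \<otimes> k) = (u [^] i \<otimes> h) \<otimes> (u [^] j \<otimes> k)" unfolding pw using ij uc by (simp add: m_ac)
    then have "u [^] (i + j) \<otimes> (h \<otimes> k) \<in> A" using A(6)[OF ij(2,4)] by simp
    then show "h \<otimes> k \<in> B" unfolding B_def using ij by blast
    have "u [^] (i + j) \<otimes> (h \<oplus> k) = u [^] j \<otimes> (u [^] i \<otimes> h) \<oplus> u [^] i \<otimes> (u [^] j \<otimes> k)"
      unfolding pw using ij uc by (simp add: m_ac r_distr)
    moreover have "\<dots> \<in> A" using A(6,7) upA ij by simp
    ultimately have "u [^] (i + j) \<otimes> (h \<oplus> k) \<in> A" by (simp only:)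
    then show "h \<oplus> k \<in> B" unfolding B_def using ij by blast
  qed
  have coB: "set (co y) \<subseteq> B" if "y \<in> Y" for y
  proof
    fix e assume e: "e \<in> set (co y)"
    then have "u [^] (1::nat) \<otimes> e \<in> A" using u(2)[OF that] uc by simp
    then show "e \<in> B" unfolding B_def using e co[of y] that Yc Ec by blast
  qed
  \<comment> \<open>\<open>T\<close> is the \<open>B\<close>-span of the basis. By the choice of
    \<open>u\<close> it is closed under multiplication by the generators.\<close>
  define T where "T = {combine Ks Vs | Ks. set Ks \<subseteq> B \<and> length Ks = length Vs}"
  have TI: "combine Ks Vs \<in> T" if "set Ks \<subseteq> B" "length Ks = length Vs" for Ks
    unfolding T_def using that by blast
  have Tc: "T \<subseteq> carrier R" unfolding T_def using Bc Vs(1) combine_in_carrier by blast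
  have Tadd: "s \<oplus> t \<in> T" if st: "s \<in> T" "t \<in> T" for s t
  proof -
    obtain Ks Ls where *: "set Ks \<subseteq> B" "length Ks = length Vs" "s = combine Ks Vs"
      "set Ls \<subseteq> B" "length Ls = length Vs" "t = combine Ls Vs" using st unfolding T_def by auto
    have "s \<oplus> t = combine (map2 (\<oplus>) Ks Ls) Vs"
      using combine_add[of Ks Vs Ls] * Bc Vs(1) by auto
    moreover have "set (map2 (\<oplus>) Ks Ls) \<subseteq> B"
      by (rule set_map2_subset) (use * Badd in blast)
    ultimately show ?thesis using TI[of "map2 (\<oplus>) Ks Ls"] * by simp
  qed
  have Tsmult: "b \<otimes> t \<in> T" if bt: "b \<in> B" "t \<in> T" for b t
  proof -
    obtain Ks where *: "set Ks \<subseteq> B" "length Ks = length Vs" "t = combine Ks Vs"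
      using bt unfolding T_def by auto
    have "b \<otimes> t = combine (map ((\<otimes>) b) Ks) Vs"
      using combine_r_distr[of Ks Vs b] * Bc Vs(1) bt(1) by auto
    moreover have "set (map ((\<otimes>) b) Ks) \<subseteq> B" using * Bmult bt(1) by auto
    ultimately show ?thesis using TI[of "map ((\<otimes>) b) Ks"] * by simp
  qed
  have YT: "y \<in> T" if "y \<in> Y" for y
    using TI[of "co y"] coB[OF that] co[of y] that Yc by auto
  have zeroT: "\<zero> \<in> T"
    using Tsmult[of \<zero> \<one>] YT[of \<one>] A(2) AB unfolding Y_def by auto
  have Tcomb: "combine Ks Ws \<in> T" if "set Ks \<subseteq> B" "set Ws \<subseteq> T" for Ks Ws
    using that
  proof (induction Ks Ws rule: combine.induct)
    case (1 k Ks w Ws)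
    then show ?case using Tadd Tsmult by auto
  qed (auto simp: zeroT)
  have Tz: "z \<otimes> t \<in> T" if z: "z \<in> set xs" and t: "t \<in> T" for z t
  proof -
    obtain Ks where *: "set Ks \<subseteq> B" "length Ks = length Vs" "t = combine Ks Vs"
      using t unfolding T_def by auto
    have zc: "z \<in> carrier R" using z xs by auto
    have tc: "t \<in> carrier R" using t Tc by auto
    have "t \<otimes> z = combine Ks (map (\<lambda>v. v \<otimes> z) Vs)"
      using combine_l_distr[of Ks Vs z] * Bc Vs(1) zc by auto
    moreover have "set (map (\<lambda>v. v \<otimes> z) Vs) \<subseteq> T" using YT z unfolding Y_def by auto
    ultimately have "t \<otimes> z \<in> T" using Tcomb[OF *(1)] by simp
    then show ?thesis using m_comm[OF tc zc] by simp
  qed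
  \<comment> \<open>The multipliers of \<open>T\<close> form a subring containing \<open>K\<close>,
    \<open>x\<close> and the other generators, hence everything; since \<open>T\<close> contains 1,
    it is the whole field.\<close>
  define H where "H = {t \<in> carrier R. \<forall>s\<in>T. t \<otimes> s \<in> T}"
  have "subring H R"
  proof (rule subringI)
    show "H \<subseteq> carrier R" unfolding H_def by auto
    show "\<one> \<in> H" unfolding H_def using Tc by auto
    have m1: "\<ominus> \<one> \<in> B" using A(3,5) AB by blast
  next
    fix h assume h: "h \<in> H"
    have m1: "\<ominus> \<one> \<in> B" using A(3,5) AB by blast
    have "\<ominus> h \<otimes> s \<in> T" if s: "s \<in> T" for s
    proof -
      have "h \<in> carrier R" "s \<in> carrier R" using h s Tc unfolding H_def by auto
      then have "\<ominus> h \<otimes> s = \<ominus> \<one> \<otimes> (h \<otimes> s)" by (simp add: l_minus)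
      then show ?thesis using Tsmult[OF m1, of "h \<otimes> s"] h s unfolding H_def by simp
    qed
    then show "\<ominus> h \<in> H" using h unfolding H_def by auto
  next
    fix h k assume h: "h \<in> H" and k: "k \<in> H"
    have "(h \<otimes> k) \<otimes> s \<in> T \<and> (h \<oplus> k) \<otimes> s \<in> T" if s: "s \<in> T" for s
    proof -
      have c: "h \<in> carrier R" "k \<in> carrier R" "s \<in> carrier R" using h k s Tc unfolding H_def by auto
      have "(h \<otimes> k) \<otimes> s = h \<otimes> (k \<otimes> s)" "(h \<oplus> k) \<otimes> s = h \<otimes> s \<oplus> k \<otimes> s"
        using c by (auto simp: m_assoc l_distr)
      then show ?thesis using h k s Tadd unfolding H_def by auto
    qed
    then show "h \<otimes> k \<in> H" "h \<oplus> k \<in> H" using h k unfolding H_def by blast+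
  qed
  moreover have "K \<subseteq> H" "set (x # xs) \<subseteq> H"
    unfolding H_def using Tsmult Tz KA xA AB Bc xs by auto
  ultimately have carH: "carrier R \<subseteq> H"
    using finite_extension_subring_incl[of H K "x # xs"] unfolding gen by simp
  have oneT: "\<one> \<in> T" by (rule YT) (simp add: Y_def)
  have carT: "carrier R \<subseteq> T"
  proof
    fix t assume t: "t \<in> carrier R"
    then have "t \<otimes> \<one> \<in> T" using carH oneT unfolding H_def by blast
    then show "t \<in> T" using t by simp
  qed
  \<comment> \<open>Some coordinate of 1 is nonzero. Scaling by its inverse makes every
    \<open>e \<in> E\<close> a coordinate of some element; as all elements lie in \<open>T\<close>,
    uniqueness of coordinates puts \<open>e\<close> into \<open>B\<close>.\<close>
  obtain Ks where Ks: "set Ks \<subseteq> E" "length Ks = length Vs" "\<one> = combine Ks Vs"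
    using co[of \<one>] by auto
  have "\<not> set Ks \<subseteq> {\<zero>}"
  proof
    assume "set Ks \<subseteq> {\<zero>}"
    then have "combine Ks Us = \<zero>" if "set Us \<subseteq> carrier R" for Us
      using that by (induction Ks Us rule: combine.induct) auto
    from this[OF Vs(1)] Ks(3) show False by simp
  qed
  then obtain l where l: "l < length Ks" "Ks ! l \<noteq> \<zero>" by (metis in_set_conv_nth subsetI singletonI)
  have lE: "Ks ! l \<in> E - {\<zero>}" using l Ks(1) by auto
  have EB: "E \<subseteq> B"
  proof
    fix e assume e: "e \<in> E"
    note Esub = subringE[OF subfieldE(1)[OF E]]
    have iE: "inv (Ks ! l) \<in> E" "inv (Ks ! l) \<otimes> Ks ! l = \<one>" using subfield_m_inv[OF E lE] by auto
    define d where "d = e \<otimes> inv (Ks ! l)"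
    have dE: "d \<in> E" unfolding d_def using Esub(6) e iE by auto
    have dc: "d \<in> carrier R" using dE Ec by auto
    have "d \<in> T" using dc carT by auto
    then obtain Ls where Ls: "set Ls \<subseteq> B" "length Ls = length Vs" "d = combine Ls Vs"
      unfolding T_def by auto
    have "d = d \<otimes> combine Ks Vs" unfolding Ks(3)[symmetric] using dc by simp
    also have "\<dots> = combine (map ((\<otimes>) d) Ks) Vs"
      using combine_r_distr[of Ks Vs d] Ks Ec Vs(1) dc by auto
    finally have d1: "d = combine (map ((\<otimes>) d) Ks) Vs" .
    have d2: "d = combine (co d) Vs" "set (co d) \<subseteq> E" "length (co d) = length Vs" using co[OF dc] by auto
    have "set (map ((\<otimes>) d) Ks) \<subseteq> E" using dE Ks(1) Esub(6) by auto
    then have eq1: "map ((\<otimes>) d) Ks = co d"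
      using combine_unique[OF E Vs(2), of "map ((\<otimes>) d) Ks" "co d"] d1 d2 Ks(2) by simp
    have LsE: "set Ls \<subseteq> E"
    proof -
      have "B \<subseteq> E"
      proof
        fix b assume "b \<in> B"
        then obtain k :: nat where b: "b \<in> carrier R" "u [^] k \<otimes> b \<in> A" unfolding B_def by auto
        have AE: "A \<subseteq> E" unfolding A_def E_def
          by (rule simple_extension_subring_incl[OF subfieldE(1)])
             (use E generate_field.incl[of _ "insert x K" R] in \<open>auto simp: E_def\<close>)
        have "u [^] k \<noteq> \<zero>"
          by (induction k) (use u(1) uc integral_iff in auto)
        then have "u [^] k \<in> E - {\<zero>}" using upA[of k] AE by auto
        then have "inv (u [^] k) \<in> E" "inv (u [^] k) \<otimes> u [^] k = \<one>" using subfield_m_inv[OF E] by auto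
        moreover from this have "b = inv (u [^] k) \<otimes> (u [^] k \<otimes> b)"
          using b uc Ec by (subst m_assoc[symmetric]) auto
        ultimately show "b \<in> E" using Esub(6) b(2) AE by (metis subsetD)
      qed
      then show ?thesis using Ls(1) by auto
    qed
    have "Ls = co d" using combine_unique[OF E Vs(2) LsE Ls(2) d2(2,3)] Ls(3) d2(1) by simp
    then have "d \<otimes> Ks ! l \<in> B" using eq1 Ls(1,2) l Ks(2) by (metis length_map nth_map nth_mem subsetD)
    moreover have "d \<otimes> Ks ! l = e" unfolding d_def using iE e lE Ec by (simp add: m_assoc subsetD)
    ultimately show "e \<in> B" by simp
  qed
  \<comment> \<open>\<open>q\<close> is invertible in \<open>E \<subseteq> B\<close>, so some
    \<open>u [^] k\<close> times its inverse lies in \<open>A\<close>. As \<open>q\<close> is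
    congruent to 1 modulo \<open>x \<otimes> u\<close>, the power can be removed by
    \<open>geometric_step\<close>, and \<open>q\<close> becomes a unit of a polynomial ring.\<close>
  define q where "q = \<one> \<oplus> x \<otimes> u"
  have xu: "x \<otimes> u \<in> A" using A(6) xA u(1) by auto
  have qA: "q \<in> A" unfolding q_def using A(3,7) xu by auto
  have AE: "A \<subseteq> E" unfolding A_def E_def
    by (rule simple_extension_subring_incl[OF subfieldE(1)])
       (use E generate_field.incl[of _ "insert x K" R] in \<open>auto simp: E_def\<close>)
  \<comment> \<open>If \<open>x \<otimes> u\<close> were a nonzero constant, \<open>x\<close> would
    be a unit of the polynomial ring and hence a constant itself.\<close>
  have xuK: "x \<otimes> u \<notin> K"
  proof
    assume c: "x \<otimes> u \<in> K"
    show False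
    proof (cases "x \<otimes> u = \<zero>")
      case True
      then have "x = \<zero>" using u(1) x uc integral_iff by auto
      then show False using zero_is_algebraic[OF Ksub] tr by (simp add: over_def)
    next
      case False
      then have i: "inv (x \<otimes> u) \<in> K" "(x \<otimes> u) \<otimes> inv (x \<otimes> u) = \<one>"
        using subfield_m_inv[OF K, of "x \<otimes> u"] c by auto
      have "x \<otimes> (u \<otimes> inv (x \<otimes> u)) = \<one>" using i x uc Kc by (simp add: m_assoc[symmetric] subsetD)
      moreover have "u \<otimes> inv (x \<otimes> u) \<in> A" using A(6) u(1) i(1) KA by auto
      ultimately have "x \<in> K" using simple_extension_inverse_mem[OF K x tr] xA unfolding A_def by blast
      then show False using algebraic_self[OF Ksub] tr by (simp add: over_def)
    qed
  qed
  have "q \<noteq> \<zero>"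
  proof
    assume "q = \<zero>"
    then have "\<ominus> \<one> = x \<otimes> u" unfolding q_def using x uc by (intro minus_equality) (simp_all add: a_comm)
    moreover have "\<ominus> \<one> \<in> K" using subringE(3,5)[OF Ksub] by blast
    ultimately show False using xuK by simp
  qed
  then have qi: "inv q \<in> E" "q \<otimes> inv q = \<one>" using subfield_m_inv[OF E, of q] qA AE by auto
  have qc: "q \<in> carrier R" using qA Ac by auto
  have ic: "inv q \<in> carrier R" using qi Ec by auto
  obtain k :: nat where k: "u [^] k \<otimes> inv q \<in> A" using qi EB unfolding B_def by auto
  have "(x \<otimes> u) [^] j \<otimes> inv q \<in> A \<Longrightarrow> inv q \<in> A" for j :: nat
  proof (induction j)
    case 0 then show ?case using ic by simp
  next
    case (Suc j)
    let ?w = "(x \<otimes> u) [^] j"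
    have wA: "?w \<in> A"
    proof (induction j)
      case 0 show ?case using A(3) by simp
    next
      case (Suc j) then show ?case using A(6) xu by simp
    qed
    have wc: "?w \<in> carrier R" using wA Ac by auto
    have eq: "?w \<otimes> inv q = ?w \<oplus> \<ominus> ((x \<otimes> u) [^] Suc j \<otimes> inv q)"
      using geometric_step[OF wc _ ic, of "x \<otimes> u"] qi(2) x uc unfolding q_def by simp
    have "?w \<otimes> inv q \<in> A" unfolding eq using A(5,7) wA Suc.prems by auto
    then show ?case by (rule Suc.IH)
  qed
  moreover have "(x \<otimes> u) [^] k \<otimes> inv q \<in> A"
  proof -
    have "x [^] k \<in> A" for k :: nat
    proof (induction k)
      case 0 show ?case using A(3) by simp
    next
      case (Suc k) then show ?case using A(6) xA by simp
    qed
    moreover have "(x \<otimes> u) [^] k \<otimes> inv q = x [^] k \<otimes> (u [^] k \<otimes> inv q)"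
      using x uc ic by (simp add: nat_pow_distrib m_assoc)
    ultimately show ?thesis using A(6) k by simp
  qed
  ultimately have "inv q \<in> A" by blast
  then have "q \<in> K" using simple_extension_inverse_mem[OF K x tr] qA qi(2) unfolding A_def by blast
  then have "q \<oplus> \<ominus> \<one> \<in> K" using subringE(3,5,7)[OF Ksub] by auto
  moreover have "q \<oplus> \<ominus> \<one> = x \<otimes> u" unfolding q_def using x uc by algebra
  ultimately show False using xuK by simp
qed

text \<open>Induction over the generators for all base fields at once. If \<open>x\<close> is
  algebraic, the tower law combines the finite extension by \<open>x\<close> with the induction
  hypothesis; otherwise the hypothesis over the field generated by \<open>x\<close> contradicts
  \<open>transcendental_not_finitely_generated\<close>.\<close>

theorem zariski_lemma:
  assumes "subfield K R" "set xs \<subseteq> carrier R" "finite_extension K xs = carrier R"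
  shows "finite_dimension K (carrier R)"
  using assms
proof (induction xs arbitrary: K)
  case Nil
  then have "K = carrier R" by simp
  then show ?case using dimension_one[OF Nil.prems(1)] finite_dimensionI by metis
next
  case (Cons x xs)
  note K = Cons.prems(1)
  have Ksub: "subring K R" by (rule subfieldE(1)[OF K])
  have Kc: "K \<subseteq> carrier R" by (rule subringE(1)[OF Ksub])
  have x: "x \<in> carrier R" and xs: "set xs \<subseteq> carrier R" using Cons.prems by auto
  have over: "finite_dimension E (carrier R)" if E: "subfield E R" "insert x K \<subseteq> E" for E
  proof (rule Cons.IH[OF E(1) xs])
    have Ec: "E \<subseteq> carrier R" by (rule subfieldE(3)[OF E(1)])
    have sub: "subring (finite_extension E xs) R"
      by (rule finite_extension_is_subring[OF subfieldE(1)[OF E(1)] xs])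
    have "E \<subseteq> finite_extension E xs" by (rule finite_extension_incl[OF Ec xs])
    moreover have "set xs \<subseteq> finite_extension E xs" by (rule finite_extension_mem[OF subfieldE(1)[OF E(1)] xs])
    ultimately have "finite_extension K (x # xs) \<subseteq> finite_extension E xs"
      using E(2) by (intro finite_extension_subring_incl[OF sub]) auto
    then show "finite_extension E xs = carrier R"
      using Cons.prems(3) finite_extension_in_carrier[OF Ec xs] by auto
  qed
  show ?case
  proof (cases "(algebraic over K) x")
    case True
    let ?E = "simple_extension K x"
    have E: "subfield ?E R" using simple_extension_is_subfield[OF K x] True by simp
    have "insert x K \<subseteq> ?E" using simple_extension_incl[OF Kc x] simple_extension_mem[OF Ksub x] by auto
    then have "finite_dimension ?E (carrier R)" by (rule over[OF E])
    moreover have "finite_dimension K ?E" using finite_dimension_simple_extension[OF K x] True by simp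
    ultimately show ?thesis using telescopic_base_dim(1)[OF K E] by blast
  next
    case False
    let ?E = "generate_field R (insert x K)"
    have "insert x K \<subseteq> carrier R" using Kc x by auto
    then have "finite_dimension ?E (carrier R)"
      by (intro over generate_field_is_subfield) (auto intro: generate_field.incl)
    then show ?thesis
      using transcendental_not_finitely_generated[OF K x _ xs Cons.prems(3)] False by (auto simp: over_def)
  qed
qed

end

section \<open>Locally regular sequences in maximal ideals\<close>

abbreviation var :: "nat \<times> nat \<Rightarrow> 'k::field mpol" where "var v \<equiv> mon (Poly_Mapping.single v 1)"
abbreviation cst :: "'k::field \<Rightarrow> 'k mpol" where "cst \<equiv> Poly_Mapping.single 0"

definition embed_poly :: "nat \<times> nat \<Rightarrow> 'k::field poly \<Rightarrow> 'k mpol" where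
  "embed_poly v q = poly (map_poly cst q) (var v)"

lemma embed_poly_0 [simp]: "embed_poly v 0 = 0"
  unfolding embed_poly_def by simp

lemma embed_poly_pCons: "embed_poly v (pCons a q) = cst a + var v * embed_poly v q"
  unfolding embed_poly_def by (simp add: map_poly_pCons)

lemma embed_poly_add: "embed_poly v (p + q) = embed_poly v p + embed_poly v q"
  by (induction p q rule: poly_induct2) (simp_all add: embed_poly_pCons single_add algebra_simps)

lemma embed_poly_smult: "embed_poly v (smult c q) = cst c * embed_poly v q"
  by (induction q) (simp_all add: embed_poly_pCons mult_single algebra_simps)

lemma embed_poly_mult: "embed_poly v (p * q) = embed_poly v p * embed_poly v q"
  by (induction p) (simp_all add: embed_poly_pCons embed_poly_add embed_poly_smult algebra_simps)

lemma embed_poly_diff: "embed_poly v (p - q) = embed_poly v p - embed_poly v q"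
  using embed_poly_add[of v "p - q" q] by simp

lemma embed_poly_monom: "embed_poly v (Polynomial.monom c k) = Poly_Mapping.single (Poly_Mapping.single v k) c"
  by (induction k) (simp_all add: embed_poly_pCons monom_0 monom_Suc mult_single single_add[symmetric])

lemma embed_poly_in_polys: "v \<in> V \<Longrightarrow> embed_poly v q \<in> polys V"
  by (induction q) (simp_all add: embed_poly_pCons)

text \<open>Different powers of \<open>v\<close> are different monomials, so the coefficient at
  exponent \<open>degree q\<close> is the leading coefficient of \<open>q\<close>.\<close>

lemma embed_poly_eq_0: assumes "embed_poly v q = 0" shows "q = 0"
proof -
  have embed_poly_sum: "embed_poly v (sum f A) = (\<Sum>i\<in>A. embed_poly v (f i))" for f and A :: "nat set"
    by (induction A rule: infinite_finite_induct) (auto simp: embed_poly_add)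
  have "embed_poly v q = (\<Sum>i\<le>degree q. Poly_Mapping.single (Poly_Mapping.single v i) (coeff q i))"
    by (subst poly_as_sum_of_monoms[of q, symmetric]) (simp only: embed_poly_sum embed_poly_monom)
  moreover have "Poly_Mapping.single v i = Poly_Mapping.single v j \<longleftrightarrow> i = j" for i j :: nat
    by (metis lookup_single_eq)
  ultimately have "lookup (embed_poly v q) (Poly_Mapping.single v (degree q))
     = (\<Sum>i\<le>degree q. if i = degree q then coeff q i else 0)"
    by (simp add: lookup_sum lookup_single when_def)
  then show ?thesis using assms by simp
qed

lemma mon_add: "mon (u + w) = mon u * mon w"
  by (simp add: mult_single)

text \<open>The remainder modulo \<open>G\<close> with respect to the variable \<open>v\<close>, the other variables being
  treated as constants.\<close>

definition normal_form_mon :: "nat \<times> nat \<Rightarrow> 'k::field poly \<Rightarrow> mono \<Rightarrow> 'k mpol" where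
  "normal_form_mon v G m = mon (m - Poly_Mapping.single v (lookup m v)) * embed_poly v (Polynomial.monom 1 (lookup m v) mod G)"

definition normal_form :: "nat \<times> nat \<Rightarrow> 'k::field poly \<Rightarrow> 'k mpol \<Rightarrow> 'k mpol" where
  "normal_form v G p = (\<Sum>m\<in>keys p. cst (lookup p m) * normal_form_mon v G m)"

lemma normal_form_superset:
  assumes "finite A" "keys p \<subseteq> A" shows "normal_form v G p = (\<Sum>m\<in>A. cst (lookup p m) * normal_form_mon v G m)"
  unfolding normal_form_def by (rule sum.mono_neutral_left[OF assms]) (auto simp: in_keys_iff)

lemma normal_form_add: "normal_form v G (p + q) = normal_form v G p + normal_form v G q"
proof -
  let ?A = "keys p \<union> keys q"
  have "normal_form v G (p + q) = (\<Sum>m\<in>?A. cst (lookup (p + q) m) * normal_form_mon v G m)"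
    by (rule normal_form_superset) (use Poly_Mapping.keys_add[of p q] in auto)
  also have "\<dots> = (\<Sum>m\<in>?A. cst (lookup p m) * normal_form_mon v G m) + (\<Sum>m\<in>?A. cst (lookup q m) * normal_form_mon v G m)"
    by (simp add: lookup_add single_add distrib_right sum.distrib)
  also have "\<dots> = normal_form v G p + normal_form v G q"
    by (simp add: normal_form_superset[of ?A, symmetric])
  finally show ?thesis .
qed

lemma normal_form_0 [simp]: "normal_form v G 0 = 0"
  unfolding normal_form_def by simp

lemma normal_form_sum: "normal_form v G (sum f A) = (\<Sum>i\<in>A. normal_form v G (f i))"
  by (induction A rule: infinite_finite_induct) (auto simp: normal_form_add)

lemma normal_form_single: "normal_form v G (Poly_Mapping.single m c) = cst c * normal_form_mon v G m"
proof -
  have "normal_form v G (Poly_Mapping.single m c) = (\<Sum>m'\<in>{m}. cst (lookup (Poly_Mapping.single m c) m') * normal_form_mon v G m')"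
    by (rule normal_form_superset) (use keys_single_subset in auto)
  then show ?thesis by simp
qed

lemma normal_form_mon_add:
  assumes "lookup w v = 0" shows "normal_form_mon v G (w + m) = mon w * normal_form_mon v G m"
proof -
  have "w + m - Poly_Mapping.single v (lookup m v) = w + (m - Poly_Mapping.single v (lookup m v))"
    by (rule poly_mapping_eqI) (simp add: lookup_add lookup_minus lookup_single when_def assms)
  then show ?thesis unfolding normal_form_mon_def using assms
    by (simp add: lookup_add mon_add mult.assoc)
qed

lemma mult_eq_sum_monomials: "p * q = (\<Sum>m\<in>keys p. Poly_Mapping.single m (lookup p m) * q)"
  by (subst (1) poly_sum_monomials[of p]) (simp add: sum_distrib_right)

lemma normal_form_mult_single:
  assumes "lookup w v = 0"
  shows "normal_form v G (Poly_Mapping.single w c * p) = Poly_Mapping.single w c * normal_form v G p"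
proof -
  have "Poly_Mapping.single w c * p = (\<Sum>m\<in>keys p. Poly_Mapping.single (w + m) (c * lookup p m))"
    by (subst (1) poly_sum_monomials[of p]) (simp add: sum_distrib_left mult_single)
  then have "normal_form v G (Poly_Mapping.single w c * p) = (\<Sum>m\<in>keys p. cst (c * lookup p m) * (mon w * normal_form_mon v G m))"
    by (simp add: normal_form_sum normal_form_single normal_form_mon_add[OF assms])
  also have "\<dots> = (\<Sum>m\<in>keys p. Poly_Mapping.single w c * (cst (lookup p m) * normal_form_mon v G m))"
  proof (rule sum.cong[OF refl])
    fix m
    have "cst (c * lookup p m) * mon w = Poly_Mapping.single w c * cst (lookup p m)" by (simp add: mult_single)
    then show "cst (c * lookup p m) * (mon w * normal_form_mon v G m) = Poly_Mapping.single w c * (cst (lookup p m) * normal_form_mon v G m)"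
      by (simp add: mult.assoc[symmetric])
  qed
  also have "\<dots> = Poly_Mapping.single w c * normal_form v G p" unfolding normal_form_def by (simp add: sum_distrib_left)
  finally show ?thesis .
qed

text \<open>Reduction changes only the power of \<open>v\<close> in a monomial, so factors free of
  \<open>v\<close> pass through.\<close>

lemma normal_form_mult_free:
  assumes "h \<in> polys W" "v \<notin> W" shows "normal_form v G (h * p) = h * normal_form v G p"
proof -
  have "lookup m v = 0" if "m \<in> keys h" for m
  proof -
    have "v \<notin> keys m" using assms that unfolding polys_def by blast
    then show ?thesis by (simp add: in_keys_iff)
  qed
  then show ?thesis
    unfolding mult_eq_sum_monomials[of h p] normal_form_sum mult_eq_sum_monomials[of h "normal_form v G p"]
    by (intro sum.cong refl) (simp add: normal_form_mult_single)
qed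

text \<open>Stated for an arbitrary \<open>q\<close> in place of \<open>G\<close>, because the
  induction moves one factor \<open>v\<close> at a time from \<open>q\<close> to
  \<open>m\<close>.\<close>

lemma normal_form_embed_poly_mult_mon:
  "normal_form v G (embed_poly v q * mon m) = mon (m - Poly_Mapping.single v (lookup m v)) * embed_poly v ((q * Polynomial.monom 1 (lookup m v)) mod G)"
proof (induction q arbitrary: m)
  case (pCons a q)
  let ?k = "lookup m v" and ?m' = "Poly_Mapping.single v 1 + m"
  have k': "lookup ?m' v = Suc ?k" by (simp add: lookup_add)
  have m0: "?m' - Poly_Mapping.single v (Suc ?k) = m - Poly_Mapping.single v ?k"
    by (rule poly_mapping_eqI) (simp add: lookup_add lookup_minus lookup_single when_def)
  have "embed_poly v (pCons a q) * mon m = Poly_Mapping.single m a + embed_poly v q * mon ?m'"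
    by (simp add: embed_poly_pCons algebra_simps mult_single)
  then have "normal_form v G (embed_poly v (pCons a q) * mon m) = cst a * normal_form_mon v G m + normal_form v G (embed_poly v q * mon ?m')"
    by (simp add: normal_form_add normal_form_single)
  also have "\<dots> = mon (m - Poly_Mapping.single v ?k) *
     (cst a * embed_poly v (Polynomial.monom 1 ?k mod G) + embed_poly v ((q * Polynomial.monom 1 (Suc ?k)) mod G))"
    unfolding pCons.IH k' m0 normal_form_mon_def by (simp add: algebra_simps)
  also have "cst a * embed_poly v (Polynomial.monom 1 ?k mod G) + embed_poly v ((q * Polynomial.monom 1 (Suc ?k)) mod G)
     = embed_poly v ((smult a (Polynomial.monom 1 ?k) + q * Polynomial.monom 1 (Suc ?k)) mod G)"
    by (simp add: poly_mod_add_left mod_smult_left embed_poly_add embed_poly_smult)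
  also have "smult a (Polynomial.monom 1 ?k) + q * Polynomial.monom 1 (Suc ?k) = pCons a q * Polynomial.monom 1 ?k"
    by (simp add: monom_Suc mult_pCons_right)
  finally show ?case .
qed simp

lemma normal_form_embed_poly_mult: "normal_form v G (embed_poly v G * p) = 0"
proof -
  have *: "embed_poly v G * p = (\<Sum>m\<in>keys p. cst (lookup p m) * (embed_poly v G * mon m))"
  proof -
    have 1: "embed_poly v G * p = (\<Sum>m\<in>keys p. embed_poly v G * Poly_Mapping.single m (lookup p m))"
      by (subst (1) poly_sum_monomials[of p]) (simp add: sum_distrib_left)
    have 2: "embed_poly v G * Poly_Mapping.single m c = cst c * (embed_poly v G * mon m)" for m c
    proof -
      have "Poly_Mapping.single m c = cst c * mon m" by (simp add: mult_single)
      then show ?thesis by (simp only: mult.left_commute)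
    qed
    show ?thesis by (rule trans[OF 1 sum.cong[OF refl 2]])
  qed
  show ?thesis unfolding * normal_form_sum
    by (rule sum.neutral) (auto simp: normal_form_mult_single normal_form_embed_poly_mult_mon)
qed

lemma normal_form_in_polys:
  assumes "v \<in> V" "p \<in> polys V" shows "normal_form v G p \<in> polys V"
  unfolding normal_form_def
proof (rule polys.sum_C)
  fix m assume "m \<in> keys p"
  then have "keys m \<subseteq> V" using assms(2) unfolding polys_def by auto
  then have "keys (m - Poly_Mapping.single v (lookup m v)) \<subseteq> V"
    by (auto simp: in_keys_iff lookup_minus subset_iff)
  then show "cst (lookup p m) * normal_form_mon v G m \<in> polys V"
    unfolding normal_form_mon_def using embed_poly_in_polys[OF assms(1)] by (intro polys.mult_C single_in_polys) auto
qed

text \<open>The quotients of the powers of \<open>v\<close> by \<open>G\<close> assemble to the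
  cofactor \<open>r\<close>.\<close>

lemma minus_normal_form:
  assumes v: "v \<in> V" and p: "p \<in> polys V"
  shows "\<exists>r\<in>polys V. p - normal_form v G p = r * embed_poly v G"
proof -
  let ?m0 = "\<lambda>m. m - Poly_Mapping.single v (lookup m v)"
  let ?r = "\<Sum>m\<in>keys p. cst (lookup p m) * (mon (?m0 m) * embed_poly v (Polynomial.monom 1 (lookup m v) div G))"
  have "?r \<in> polys V"
  proof (rule polys.sum_C)
    fix m assume "m \<in> keys p"
    then have "keys m \<subseteq> V" using p unfolding polys_def by auto
    then have "keys (?m0 m) \<subseteq> V"
      by (auto simp: in_keys_iff lookup_minus subset_iff)
    then show "cst (lookup p m) * (mon (?m0 m) * embed_poly v (Polynomial.monom 1 (lookup m v) div G)) \<in> polys V"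
      using embed_poly_in_polys[OF v] by (intro polys.mult_C single_in_polys) auto
  qed
  moreover have "p - normal_form v G p = ?r * embed_poly v G"
  proof -
    have mm: "mon m - normal_form_mon v G m = mon (?m0 m) * embed_poly v (Polynomial.monom 1 (lookup m v) div G) * embed_poly v G" for m
    proof -
      have "?m0 m + Poly_Mapping.single v (lookup m v) = m"
        by (rule poly_mapping_eqI) (simp add: lookup_add lookup_minus lookup_single when_def)
      then have "mon m = mon (?m0 m) * embed_poly v (Polynomial.monom 1 (lookup m v))"
        unfolding embed_poly_monom by (simp add: mult_single)
      then have "mon m - normal_form_mon v G m = mon (?m0 m) * embed_poly v (Polynomial.monom 1 (lookup m v) - Polynomial.monom 1 (lookup m v) mod G)"
        unfolding normal_form_mon_def embed_poly_diff by (simp add: algebra_simps)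
      also have "Polynomial.monom 1 (lookup m v) - Polynomial.monom 1 (lookup m v) mod G = (Polynomial.monom 1 (lookup m v) div G) * G"
        by (simp add: minus_mod_eq_div_mult)
      finally show ?thesis by (simp add: embed_poly_mult mult.assoc)
    qed
    have "p = (\<Sum>m\<in>keys p. cst (lookup p m) * mon m)"
      by (subst (1) poly_sum_monomials[of p]) (simp add: mult_single)
    then have "p - normal_form v G p = (\<Sum>m\<in>keys p. cst (lookup p m) * (mon m - normal_form_mon v G m))"
      unfolding normal_form_def by (simp add: sum_subtractf algebra_simps)
    also have "\<dots> = ?r * embed_poly v G" unfolding mm by (simp add: sum_distrib_right mult.assoc)
    finally show ?thesis .
  qed
  ultimately show ?thesis by blast
qed

context poly_local
begin

text \<open>Composing the reductions for all \<open>t \<in> T\<close> gives a projection with kernel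
  \<open>ideal_span g T\<close>, linear over the polynomials in the remaining variables. It stands
  in for the fact that the quotient is a free module over these polynomials.\<close>

lemma normal_form_projection:
  assumes "finite T" "T \<subseteq> V" and g: "\<And>v. v \<in> V \<Longrightarrow> g v = embed_poly v (G v :: 'k poly)"
  shows "\<exists>\<Phi>. (\<forall>p\<in>polys V. \<Phi> p \<in> polys V \<and> p - \<Phi> p \<in> ideal_span g T) \<and> (\<forall>p q. \<Phi> (p + q) = \<Phi> p + \<Phi> q) \<and>
     (\<forall>h\<in>polys (V - T). \<forall>p. \<Phi> (h * p) = h * \<Phi> p) \<and> (\<forall>z\<in>ideal_span g T. \<Phi> z = (0 :: 'k mpol))"
  using assms(1,2)
proof (induction T rule: finite_induct)
  case empty
  show ?case by (rule exI[of _ id]) (auto simp: ideal_span_def intro!: exI[of _ "\<lambda>_. 0"])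
next
  case (insert t T)
  then have t: "t \<in> V" "T \<subseteq> V" by auto
  have gV: "g v \<in> polys V" if "v \<in> V" for v using g[OF that] embed_poly_in_polys[OF that] by simp
  obtain \<Phi> where \<Phi>': "(\<forall>p\<in>polys V. \<Phi> p \<in> polys V \<and> p - \<Phi> p \<in> ideal_span g T) \<and> (\<forall>p q. \<Phi> (p + q) = \<Phi> p + \<Phi> q) \<and>
     (\<forall>h\<in>polys (V - T). \<forall>p. \<Phi> (h * p) = h * \<Phi> p) \<and> (\<forall>z\<in>ideal_span g T. \<Phi> z = (0 :: 'k mpol))"
    using insert.IH[OF t(2)] by (rule exE)
  then have \<Phi>: "\<And>p. p \<in> polys V \<Longrightarrow> \<Phi> p \<in> polys V" "\<And>p. p \<in> polys V \<Longrightarrow> p - \<Phi> p \<in> ideal_span g T"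
    "\<And>p q. \<Phi> (p + q) = \<Phi> p + \<Phi> q" "\<And>h p. h \<in> polys (V - T) \<Longrightarrow> \<Phi> (h * p) = h * \<Phi> p"
    "\<And>z. z \<in> ideal_span g T \<Longrightarrow> \<Phi> z = 0" by blast+
  have adjoin: "adjoin (ideal_span g T) (g t) = ideal_span g (insert t T)"
    by (rule adjoin_ideal_span[OF insert.hyps(1)]) (use gV t in auto)
  define \<Psi> where "\<Psi> p = normal_form t (G t) (\<Phi> p)" for p
  have "\<Psi> p \<in> polys V \<and> p - \<Psi> p \<in> ideal_span g (insert t T)" if p: "p \<in> polys V" for p
  proof
    show "\<Psi> p \<in> polys V" unfolding \<Psi>_def by (intro normal_form_in_polys t \<Phi> p)
    obtain r where r: "r \<in> polys V" "\<Phi> p - normal_form t (G t) (\<Phi> p) = r * embed_poly t (G t)"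
      using minus_normal_form[OF t(1) \<Phi>(1)[OF p]] by blast
    then have "p - \<Psi> p = (p - \<Phi> p) + r * g t" unfolding \<Psi>_def g[OF t(1)] by (simp add: algebra_simps)
    also have "\<dots> \<in> adjoin (ideal_span g T) (g t)" by (intro adjI \<Phi> p r)
    finally show "p - \<Psi> p \<in> ideal_span g (insert t T)" unfolding adjoin .
  qed
  moreover have "\<Psi> (p + q) = \<Psi> p + \<Psi> q" for p q unfolding \<Psi>_def by (simp add: \<Phi>(3) normal_form_add)
  moreover have "\<Psi> (h * p) = h * \<Psi> p" if h: "h \<in> polys (V - insert t T)" for h p
  proof -
    have "h \<in> polys (V - T)" using h unfolding polys_def by blast
    then show ?thesis unfolding \<Psi>_def using \<Phi>(4) normal_form_mult_free[OF h] by simp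
  qed
  \<comment> \<open>Since \<open>t \<notin> T\<close>, the factor \<open>g t\<close> passes through
    \<open>\<Phi>\<close>, and the new reduction then kills the product.\<close>
  moreover have "\<Psi> z = 0" if z: "z \<in> ideal_span g (insert t T)" for z
  proof -
    obtain b r where b: "b \<in> ideal_span g T" "r \<in> polys V" "z = b + r * g t" using z unfolding adjoin[symmetric] by (elim adjE)
    have "g t \<in> polys (V - T)" unfolding g[OF t(1)] by (rule embed_poly_in_polys) (use t insert.hyps in auto)
    then have "\<Phi> z = embed_poly t (G t) * \<Phi> r"
      unfolding b(3) using \<Phi>(3,4,5) b(1) g[OF t(1)] by (metis add_0 mult.commute)
    then show ?thesis unfolding \<Psi>_def by (simp add: normal_form_embed_poly_mult)
  qed
  ultimately show ?case by (intro exI[of _ \<Psi>]) blast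
qed

text \<open>If \<open>g v * y\<close> lies in the ideal, the projection gives
  \<open>g v * \<Phi> y = 0\<close> in a domain, so \<open>\<Phi> y = 0\<close>, which means that
  \<open>y\<close> lies in the ideal.\<close>

lemma nonzerodivisor_ideal_span:
  assumes "finite V" and g: "\<And>v. v \<in> V \<Longrightarrow> g v = embed_poly v (G v :: 'k poly)" and G: "\<And>v. v \<in> V \<Longrightarrow> G v \<noteq> 0"
    and T: "T \<subseteq> V" and v: "v \<in> V - T"
  shows "nonzerodivisor (ideal_span g T) (g v)"
  unfolding nonzerodivisor_def
proof (intro conjI ballI impI)
  show "g v \<in> polys V" using v g[of v] embed_poly_in_polys[of v V] by auto
  fix y assume y: "y \<in> polys V" "g v * y \<in> ideal_span g T"
  have finT: "finite T" using T assms(1) finite_subset by blast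
  obtain \<Phi> where \<Phi>: "y - \<Phi> y \<in> ideal_span g T" "\<And>h p. h \<in> polys (V - T) \<Longrightarrow> \<Phi> (h * p) = h * \<Phi> p"
    "\<And>z. z \<in> ideal_span g T \<Longrightarrow> \<Phi> z = 0"
    using normal_form_projection[OF finT T g] y(1) by blast
  have "g v \<in> polys (V - T)" using v g[of v] embed_poly_in_polys[of v "V - T"] by auto
  then have "g v * \<Phi> y = 0" using \<Phi>(2)[of "g v" y] \<Phi>(3)[OF y(2)] by simp
  moreover have "g v \<noteq> 0" using embed_poly_eq_0[of v "G v"] g[of v] G[of v] v by auto
  ultimately have "\<Phi> y = 0" by simp
  then show "y \<in> ideal_span g T" using \<Phi>(1) by simp
qed

end

lemma mon_sum: "(mon (sum f A) :: 'k::field mpol) = (\<Prod>v\<in>A. mon (f v))"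
  by (induction A rule: infinite_finite_induct) (auto simp: mon_add)

lemma var_power: "var v ^ k = mon (Poly_Mapping.single v k)"
  by (induction k) (auto simp: mult_single single_add[symmetric])

lemma polys_induct [consumes 1, case_names const var add mult]:
  assumes p: "p \<in> polys V"
    and const: "\<And>c. P (cst c)" and var: "\<And>v. v \<in> V \<Longrightarrow> P (var v)"
    and add: "\<And>p q. p \<in> polys V \<Longrightarrow> q \<in> polys V \<Longrightarrow> P p \<Longrightarrow> P q \<Longrightarrow> P (p + q)"
    and mult: "\<And>p q. p \<in> polys V \<Longrightarrow> q \<in> polys V \<Longrightarrow> P p \<Longrightarrow> P q \<Longrightarrow> P (p * q)"
  shows "P (p :: 'k::field mpol)"
proof -
  have one: "P 1" using const[of 1] by simp
  have zero: "P 0" using const[of 0] by simp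
  have pw: "P (var v ^ k)" if "v \<in> V" for v k
  proof (induction k)
    case (Suc k)
    have "var v ^ k \<in> polys V" using that by (intro polys.power_C) simp
    then show ?case using mult[OF _ _ var[OF that] Suc] that by simp
  qed (simp add: one)
  have pr: "A \<subseteq> V \<Longrightarrow> P (\<Prod>v\<in>A. var v ^ e v)" for A e
  proof (induction A rule: infinite_finite_induct)
    case (insert v A)
    have "(\<Prod>v\<in>A. var v ^ e v) \<in> polys V" using insert by (intro polys.prod_C polys.power_C) auto
    moreover have "var v ^ e v \<in> polys V" using insert by (intro polys.power_C) auto
    ultimately have "P (var v ^ e v * (\<Prod>v\<in>A. var v ^ e v))"
      by (intro mult pw) (use insert in auto)
    then show ?case using insert.hyps by simp
  qed (auto simp: one)
  have mo: "P (Poly_Mapping.single m c)" if m: "keys m \<subseteq> V" for m c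
  proof -
    have eq: "mon m = (\<Prod>v\<in>keys m. var v ^ lookup m v)"
      unfolding var_power mon_sum[symmetric] poly_sum_monomials[symmetric] ..
    have "P (mon m)" unfolding eq by (rule pr[OF m])
    then have "P (cst c * mon m)" using mult const m by simp
    then show ?thesis by (simp add: mult_single)
  qed
  have "A \<subseteq> keys p \<Longrightarrow> P (\<Sum>m\<in>A. Poly_Mapping.single m (lookup p m)) \<and> (\<Sum>m\<in>A. Poly_Mapping.single m (lookup p m)) \<in> polys V" for A
  proof (induction A rule: infinite_finite_induct)
    case (insert m A)
    then have "keys m \<subseteq> V" using p unfolding polys_def by auto
    then show ?case using insert add[OF _ _ mo] by auto
  qed (auto simp: zero)
  from this[of "keys p"] show ?thesis using poly_sum_monomials[of p] by simp
qed

lemma subfield_constants: "subfield (range cst) (poly_ring V :: 'k::field mpol ring)"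
proof -
  interpret R: cring "poly_ring V :: 'k mpol ring" by (rule cring_poly_ring)
  have minus: "\<ominus>\<^bsub>poly_ring V\<^esub> x = - x" if "x \<in> polys V" for x :: "'k mpol"
    using that by (intro R.minus_equality) auto
  show ?thesis
  proof (rule R.subfieldI)
    have "subring (range cst) (poly_ring V :: 'k mpol ring)"
    proof (rule R.subringI)
      show "range cst \<subseteq> carrier (poly_ring V :: 'k mpol ring)" by auto
      show "\<one>\<^bsub>poly_ring V\<^esub> \<in> range (cst :: 'k \<Rightarrow> _)" using single_one by (simp add: image_iff) (metis single_one)
      fix x y :: "'k mpol" assume x: "x \<in> range cst"
      then obtain a where a: "x = cst a" by auto
      have "- x = cst (- a)" unfolding a by (simp add: single_uminus)
      then show "\<ominus>\<^bsub>poly_ring V\<^esub> x \<in> range cst" using minus[of x] a by auto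
      assume "y \<in> range cst"
      then obtain b where b: "y = cst b" by auto
      have "x * y = cst (a * b)" "x + y = cst (a + b)" unfolding a b by (auto simp: mult_single single_add)
      then show "x \<otimes>\<^bsub>poly_ring V\<^esub> y \<in> range cst" "x \<oplus>\<^bsub>poly_ring V\<^esub> y \<in> range cst" by auto
    qed
    then show "subcring (range cst) (poly_ring V :: 'k mpol ring)"
      by (rule R.subcringI) (auto simp: mult.commute)
    show "Units (poly_ring V \<lparr>carrier := range cst\<rparr>) = range (cst :: 'k \<Rightarrow> _) - {\<zero>\<^bsub>poly_ring V\<^esub>}"
    proof (intro equalityI subsetI)
      fix x :: "'k mpol" assume "x \<in> Units (poly_ring V \<lparr>carrier := range cst\<rparr>)"
      then show "x \<in> range cst - {\<zero>\<^bsub>poly_ring V\<^esub>}" unfolding Units_def by auto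
    next
      fix x :: "'k mpol" assume "x \<in> range cst - {\<zero>\<^bsub>poly_ring V\<^esub>}"
      then obtain a where a: "x = cst a" by auto
      then have "a \<noteq> 0" using \<open>x \<in> range cst - {\<zero>\<^bsub>poly_ring V\<^esub>}\<close> by auto
      have "cst (1 / a) * x = 1" "x * cst (1 / a) = 1" unfolding a using \<open>a \<noteq> 0\<close> by (auto simp: mult_single)
      then show "x \<in> Units (poly_ring V \<lparr>carrier := range cst\<rparr>)" unfolding Units_def using a by auto
    qed
  qed
qed

text \<open>Translates coefficient lists with the leading coefficient first, the format of
  \<open>univ_poly\<close>, into the type \<open>poly\<close>.\<close>

fun list_poly :: "'a::comm_ring_1 list \<Rightarrow> 'a poly" where
  "list_poly [] = 0"
| "list_poly (c # cs) = Polynomial.monom c (length cs) + list_poly cs"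

lemma coeff_list_poly: "i \<ge> length cs \<Longrightarrow> coeff (list_poly cs) i = 0"
  by (induction cs) auto

lemma list_poly_nonzero: "c \<noteq> 0 \<Longrightarrow> list_poly (c # cs) \<noteq> 0"
  using coeff_list_poly[of cs "length cs"] by (auto dest!: arg_cong[of _ _ "\<lambda>p. coeff p (length cs)"])

text \<open>The residue field is generated over the constants by the images of the variables, so it
  is finite-dimensional by \<open>zariski_lemma\<close> and the image of \<open>v\<close> is
  algebraic; lifting the coefficients of a relation yields \<open>G\<close>.\<close>

lemma maximal_ideal_univariate:
  assumes M: "maximalideal M (poly_ring V)" and V: "finite V" and v: "v \<in> V"
  shows "\<exists>G :: 'k::field poly. G \<noteq> 0 \<and> embed_poly v G \<in> M"
proof -
  let ?R = "poly_ring V :: 'k mpol ring" and ?F = "poly_ring V Quot M"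
  let ?h = "\<lambda>x. M +>\<^bsub>poly_ring V\<^esub> x"
  interpret R: cring ?R by (rule cring_poly_ring)
  interpret M: maximalideal M ?R by (rule M)
  interpret F: field ?F by (rule M.quotient_is_field[OF R.is_cring])
  have hom: "ring_hom_ring ?R ?F ?h" by (rule M.rcos_ring_hom_ring)
  note hmult = ring_hom_mult[OF M.rcos_ring_hom] and hadd = ring_hom_add[OF M.rcos_ring_hom]
    and hone = ring_hom_one[OF M.rcos_ring_hom] and hclosed = ring_hom_closed[OF M.rcos_ring_hom]
  let ?K = "?h ` range cst"
  have K: "subfield ?K ?F"
    by (rule ring_hom_ring.img_is_subfield(2)[OF hom subfield_constants F.one_not_zero])
  obtain vs where vs: "set vs = V" using finite_list[OF V] by auto
  let ?xs = "map (\<lambda>v. ?h (var v)) vs"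
  have xsc: "set ?xs \<subseteq> carrier ?F" using vs hclosed by auto
  have Kc: "?K \<subseteq> carrier ?F" by (rule subfieldE(3)[OF K])
  have carF: "carrier ?F = ?h ` polys V" unfolding FactRing_def A_RCOSETS_def' by auto
  let ?W = "F.finite_extension ?K ?xs"
  have gen: "?W = carrier ?F"
  proof
    show "?W \<subseteq> carrier ?F" by (rule F.finite_extension_in_carrier[OF Kc xsc])
    have sub: "subring ?W ?F" by (rule F.finite_extension_is_subring[OF subfieldE(1)[OF K] xsc])
    have KW: "?K \<subseteq> ?W" by (rule F.finite_extension_incl[OF Kc xsc])
    have xW: "set ?xs \<subseteq> ?W" by (rule F.finite_extension_mem[OF subfieldE(1)[OF K] xsc])
    have "?h p \<in> ?W" if "p \<in> polys V" for p using that
    proof (induction rule: polys_induct)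
      case (const c)
      show ?case by (rule subsetD[OF KW]) blast
    next
      case (var w)
      show ?case by (rule subsetD[OF xW]) (use var vs in auto)
    next
      case (add p q)
      have "?h (p + q) = ?h p \<oplus>\<^bsub>?F\<^esub> ?h q" using hadd[of p q] add.hyps by simp
      then show ?case using subringE(7)[OF sub add.IH] by simp
    next
      case (mult p q)
      have "?h (p * q) = ?h p \<otimes>\<^bsub>?F\<^esub> ?h q" using hmult[of p q] mult.hyps by simp
      then show ?case using subringE(6)[OF sub mult.IH] by simp
    qed
    then show "carrier ?F \<subseteq> ?W" unfolding carF by blast
  qed
  have fin: "F.finite_dimension ?K (carrier ?F)" by (rule F.zariski_lemma[OF K xsc gen])
  have hv: "?h (var v) \<in> carrier ?F" by (rule hclosed) (use v in simp)
  have alg: "(F.algebraic over ?K) (?h (var v))"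
    by (rule F.finite_dimension_imp_algebraic[OF K F.carrier_is_subring fin hv])
  obtain p where p: "p \<in> carrier (univ_poly ?F ?K)" "p \<noteq> []" "F.eval p (?h (var v)) = \<zero>\<^bsub>?F\<^esub>"
    by (rule F.algebraicE[OF subfieldE(1)[OF K] hv alg])
  have pK: "set p \<subseteq> ?K" "hd p \<noteq> \<zero>\<^bsub>?F\<^esub>"
    using p(1,2) unfolding univ_poly_carrier[symmetric] polynomial_def by auto
  obtain cs where cs: "p = map (\<lambda>c. ?h (cst c)) cs"
  proof -
    have "\<forall>y\<in>set p. \<exists>c. y = ?h (cst c)" using pK(1) by blast
    then show ?thesis using that unfolding ex_map_conv[symmetric] by blast
  qed
  have hzero: "?h 0 = \<zero>\<^bsub>?F\<^esub>" 
    using R.a_rcos_zero[OF M.is_ideal, of 0] additive_subgroup.zero_closed[OF M.additive_subgroup_axioms]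
    by (simp add: zero_FactRing)
  have hpow: "?h (var v) [^]\<^bsub>?F\<^esub> n = ?h (var v ^ n)" for n :: nat
  proof (induction n)
    case 0 show ?case using hone by simp
  next
    case (Suc n)
    have "(var v ^ n :: 'k mpol) \<in> polys V" using v by (intro polys.power_C) simp
    then show ?case using Suc hmult[of "var v ^ n" "var v"] v by (simp add: mult.commute)
  qed
  have "F.eval (map (\<lambda>c. ?h (cst c)) cs) (?h (var v)) = ?h (embed_poly v (list_poly cs))"
  proof (induction cs)
    case Nil show ?case by (simp add: hzero)
  next
    case (Cons c cs)
    have vn: "(var v ^ n :: 'k mpol) \<in> polys V" for n using v by (intro polys.power_C) simp
    have em: "embed_poly v (list_poly cs) \<in> polys V" by (rule embed_poly_in_polys[OF v])
    have split: "embed_poly v (list_poly (c # cs)) = cst c * var v ^ length cs + embed_poly v (list_poly cs)"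
      by (simp only: list_poly.simps embed_poly_add embed_poly_monom var_power mult_single) simp
    have "?h (embed_poly v (list_poly (c # cs))) = ?h (cst c) \<otimes>\<^bsub>?F\<^esub> ?h (var v ^ length cs) \<oplus>\<^bsub>?F\<^esub> ?h (embed_poly v (list_poly cs))"
    proof -
      have "?h (cst c * var v ^ length cs + embed_poly v (list_poly cs))
         = ?h (cst c * var v ^ length cs) \<oplus>\<^bsub>?F\<^esub> ?h (embed_poly v (list_poly cs))"
        using hadd[of "cst c * var v ^ length cs" "embed_poly v (list_poly cs)"] vn em by (simp del: One_nat_def)
      moreover have "?h (cst c * var v ^ length cs) = ?h (cst c) \<otimes>\<^bsub>?F\<^esub> ?h (var v ^ length cs)"
        using hmult[of "cst c" "var v ^ length cs"] vn by (simp del: One_nat_def)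
      ultimately show ?thesis unfolding split by (simp only:)
    qed
    then show ?case using Cons by (simp add: hpow del: One_nat_def)
  qed
  then have "?h (embed_poly v (list_poly cs)) = M" using p(3) unfolding cs by (simp add: zero_FactRing)
  then have "embed_poly v (list_poly cs) \<in> M"
    using M.rcos_const_imp_mem[of "embed_poly v (list_poly cs)"] embed_poly_in_polys[OF v, of "list_poly cs"] by simp
  moreover have "list_poly cs \<noteq> 0"
  proof -
    obtain c cs' where c: "cs = c # cs'" using p(2) cs by (cases cs) auto
    have hd: "hd p = ?h (cst c)" unfolding cs c by (simp only: list.map list.sel)
    have "c \<noteq> 0"
    proof
      assume "c = 0"
      then have "hd p = ?h 0" using hd by (simp only: single_zero)
      then show False using pK(2) hzero by (simp only: simp_thms)
    qed
    then show ?thesis unfolding c by (rule list_poly_nonzero)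
  qed
  ultimately show ?thesis by blast
qed

text \<open>\<open>locally_regular\<close> adjoins one element at a time, whereas the Cohen-Macaulay
  criterion uses ideals generated by initial segments; both describe the same ideals.\<close>

lemma (in poly_local) locally_regular_nth:
  assumes "is_ideal B" "set fs \<subseteq> polys V" "locally_regular B fs" "i < length fs" "y \<in> polys V"
    "fs ! i * y \<in> genideal (poly_ring V) (B \<union> set (take i fs))"
  shows "\<exists>s\<in>S. s * y \<in> genideal (poly_ring V) (B \<union> set (take i fs))"
  using assms
proof (induction fs arbitrary: B i)
  case (Cons f fs)
  interpret R: cring "poly_ring V :: 'k mpol ring" by (rule cring_poly_ring)
  note B = Cons.prems(1)
  have Bc: "B \<subseteq> polys V" using is_idealD(1)[OF B] by auto
  have f: "f \<in> polys V" using Cons.prems by simp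
  have gI: "is_ideal (genideal (poly_ring V) A)" if "A \<subseteq> polys V" for A
    unfolding ideal_poly_ring_iff[symmetric] by (rule R.genideal_ideal) (use that in simp)
  show ?case
  proof (cases i)
    case 0
    have "genideal (poly_ring V) B = B"
      using R.genideal_self[of B] R.genideal_minimal[of B B] B Bc unfolding ideal_poly_ring_iff by auto
    then show ?thesis using Cons.prems 0 by simp
  next
    case (Suc j)
    have adjc: "adjoin B f \<subseteq> polys V" using is_idealD(1)[OF is_ideal_adjoin[OF B f]] by auto
    have tc: "set (take j fs) \<subseteq> polys V" using Cons.prems(2) set_take_subset[of j fs] by auto
    have eq: "genideal (poly_ring V) (adjoin B f \<union> set (take j fs)) = genideal (poly_ring V) (B \<union> set (take i (f # fs)))"
      (is "?l = ?r")
    proof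
      have rc: "B \<union> set (take i (f # fs)) \<subseteq> polys V" using Bc tc f Suc by auto
      have lc: "adjoin B f \<union> set (take j fs) \<subseteq> polys V" using adjc tc by auto
      have sr: "B \<union> set (take i (f # fs)) \<subseteq> ?r" by (rule R.genideal_self) (use rc in simp)
      have sl: "adjoin B f \<union> set (take j fs) \<subseteq> ?l" by (rule R.genideal_self) (use lc in simp)
      show "?l \<subseteq> ?r"
      proof (rule R.genideal_minimal)
        show "ideal ?r (poly_ring V)" using gI[OF rc] unfolding ideal_poly_ring_iff .
        have "adjoin B f \<subseteq> ?r" by (rule adjoin_minimal[OF gI[OF rc]]) (use sr Suc in auto)
        then show "adjoin B f \<union> set (take j fs) \<subseteq> ?r" using sr Suc by auto
      qed
      show "?r \<subseteq> ?l"
      proof (rule R.genideal_minimal)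
        show "ideal ?l (poly_ring V)" using gI[OF lc] unfolding ideal_poly_ring_iff .
        show "B \<union> set (take i (f # fs)) \<subseteq> ?l" using sl subset_adjoin[of B f] self_adjoin[OF B, of f] Suc by auto
      qed
    qed
    have "\<exists>s\<in>S. s * y \<in> genideal (poly_ring V) (adjoin B f \<union> set (take j fs))"
      by (rule Cons.IH[OF is_ideal_adjoin[OF B f]]) (use Cons.prems Suc eq in auto)
    then show ?thesis unfolding eq .
  qed
qed simp

theorem local_regular_sequence:
  fixes M :: "'k::field mpol set" and a :: "nat \<Rightarrow> nat \<Rightarrow> nat"
  assumes M: "maximalideal M (poly_ring V)" and V: "V = {1..c} \<times> {1..n}" and L: "L \<le> n"
  defines "I \<equiv> monomial_ideal V {m. shift_divides c a L n m}" and "d \<equiv> c * n - (n + 1 - L)"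
  shows "\<exists>fs. set fs \<subseteq> M \<and> length fs = d \<and> (\<forall>i<d. \<forall>y\<in>polys V.
    fs ! i * y \<in> genideal (poly_ring V) (I \<union> set (take i fs)) \<longrightarrow>
    (\<exists>s\<in>polys V - M. s * y \<in> genideal (poly_ring V) (I \<union> set (take i fs))))"
proof -
  interpret R: cring "poly_ring V :: 'k mpol ring" by (rule cring_poly_ring)
  interpret P: primeideal M "poly_ring V" by (rule R.maximalideal_prime[OF M])
  have fV: "finite V" unfolding V by simp
  have oneM: "1 \<notin> M" using P.I_notcarr P.one_imp_carrier by auto
  have MI: "polys.is_ideal V M" using P.is_ideal unfolding ideal_poly_ring_iff .
  have "s * t \<notin> M" if "s \<in> polys V - M" "t \<in> polys V - M" for s t
    using P.I_prime[of s t] that by auto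
  then interpret poly_local V "polys V - M"
    by unfold_locales (use oneM in auto)
  obtain G0 :: "nat \<times> nat \<Rightarrow> 'k poly" where G0: "\<And>v. v \<in> V \<Longrightarrow> G0 v \<noteq> 0 \<and> embed_poly v (G0 v) \<in> M"
    using maximal_ideal_univariate[OF M fV] by metis
  \<comment> \<open>For a variable in \<open>M\<close> the polynomial is replaced by the variable
    itself, so that ideals generated by such variables have the form
    \<open>ideal_span g T\<close>.\<close>
  define G where "G v = (if var v \<in> M then [:0, 1:] else G0 v)" for v
  define g where "g v = embed_poly v (G v)" for v
  have embed_poly_x: "embed_poly v [:0, 1:] = var v" for v by (simp add: embed_poly_pCons)
  have G: "G v \<noteq> 0" "g v \<in> M" if "v \<in> V" for v
    using G0[OF that] unfolding g_def G_def by (auto simp: embed_poly_x)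
  have gc: "g v \<in> polys V" if "v \<in> V" for v unfolding g_def by (rule embed_poly_in_polys[OF that])
  let ?fs = "elem_syms g V d"
  have fsM: "set ?fs \<subseteq> M" by (rule elem_syms_mem[OF MI fV G(2)])
  then have fsc: "set ?fs \<subseteq> polys V" using polys.is_idealD(1)[OF MI] by auto
  have vars: "locally_regular (monomial_ideal V (meets T)) ?fs" if T: "T \<subseteq> V" "card T = n + 1 - L" for T
  \<comment> \<open>A variable of \<open>T\<close> outside \<open>M\<close> is invertible locally,
    and the ideal degenerates; only sets of variables inside \<open>M\<close> need the symmetric
    functions.\<close>
  proof (cases "\<forall>v\<in>T. var v \<in> M")
    case True
    have finT: "finite T" using T fV finite_subset by blast
    have "W \<subseteq> T \<Longrightarrow> monomial_ideal V (meets W) = ideal_span g W" if "finite W" for W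
      using that
    proof (induction W rule: finite_induct)
      case empty
      have "(monomial_ideal V (meets {}) :: 'k mpol set) = {0}" unfolding monomial_ideal_def meets_def by auto
      moreover have "ideal_span g {} = {0}" unfolding ideal_span_def by (auto intro: exI[of _ "\<lambda>_. 0"])
      ultimately show ?case by simp
    next
      case (insert w W)
      have w: "w \<in> V" "W \<subseteq> V" using insert.prems T by auto
      have gw: "g w = var w" unfolding g_def G_def using insert.prems True by (simp add: embed_poly_x)
      have m: "meets (insert w W) = meets W \<union> {m. lookup m w > 0}" unfolding meets_def by auto
      have "ideal_span g (insert w W) = polys.adjoin V (ideal_span g W) (g w)"
        by (rule adjoin_ideal_span[symmetric, OF insert.hyps(1)]) (use gc w in auto)
      also have "\<dots> = polys.adjoin V (monomial_ideal V (meets W)) (var w)" using insert gw by simp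
      also have "\<dots> = monomial_ideal V (meets (insert w W))" unfolding m by (rule adjoin_monomial_ideal_var[OF up_closed_meets w(1)])
      finally show ?case ..
    qed
    then have eq: "monomial_ideal V (meets T) = ideal_span g T" using finT by blast
    have cV: "card V = c * n" unfolding V by simp
    have cd: "card (V - T) = d" using card_Diff_subset[OF finT T(1)] T(2) cV unfolding d_def by simp
    have nz: "nonzerodivisor (ideal_span g W) (g v)" if "W \<subseteq> V" "v \<in> V - W" for W v
      by (rule nonzerodivisor_ideal_span[OF fV, of g G]) (use G that in \<open>auto simp: g_def\<close>)
    show ?thesis unfolding eq by (rule locally_regular_elem_syms[OF fV gc nz T(1) cd])
  next
    case False
    then obtain v where v: "v \<in> T" "var v \<notin> M" by auto
    have vV: "v \<in> V" using v T by auto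
    show ?thesis
    proof (rule locally_regular_trivial[OF is_ideal_monomial_ideal[OF up_closed_meets] fsc])
      show "var v \<in> polys V - M" using v vV by simp
      have "Poly_Mapping.single v 1 \<in> meets T" unfolding meets_def using v(1)
        by (intro CollectI bexI[of _ v]) simp_all
      then show "var v \<in> monomial_ideal V (meets T)" unfolding monomial_ideal_def using vV by simp
    qed
  qed
  \<comment> \<open>Starting without killed variables, the final sets have size
    \<open>n + 1 - L\<close>, so that exactly \<open>d\<close> variables survive.\<close>
  have "locally_regular (monomial_ideal V ({m. shift_divides c a L n m} \<union> meets {})) ?fs"
    by (rule locally_regular_shift_divides[OF V fsc vars]) (use L in auto)
  then have reg: "locally_regular I ?fs" unfolding I_def by (simp add: meets_def)
  have II: "polys.is_ideal V I" unfolding I_def by (rule is_ideal_monomial_ideal[OF up_closed_shift_divides])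
  show ?thesis
  proof (intro exI[of _ ?fs] conjI allI impI ballI fsM)
    show "length ?fs = d" by simp
    fix i and y :: "'k mpol"
    assume "i < d" "y \<in> polys V" "?fs ! i * y \<in> genideal (poly_ring V) (I \<union> set (take i ?fs))"
    then show "\<exists>s\<in>polys V - M. s * y \<in> genideal (poly_ring V) (I \<union> set (take i ?fs))"
      by (intro locally_regular_nth[OF II fsc reg]) simp_all
  qed
qed

section \<open>The Hilbert basis theorem\<close>

text \<open>Repeatedly pick an index beyond the previous one at which the remaining tail attains its
  minimum.\<close>

lemma monotone_subsequence_nat:
  fixes s :: "nat \<Rightarrow> nat"
  shows "\<exists>\<phi>. strict_mono \<phi> \<and> (\<forall>i. s (\<phi> i) \<le> s (\<phi> (Suc i)))"
proof -
  have "\<exists>k\<ge>n. \<forall>j\<ge>n. s k \<le> s j" for n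
    using ex_has_least_nat[of "\<lambda>k. k \<ge> n" n s] by auto
  then obtain g where g: "\<And>n. g n \<ge> n" "\<And>n j. j \<ge> n \<Longrightarrow> s (g n) \<le> s j" by metis
  define \<phi> where "\<phi> = rec_nat (g 0) (\<lambda>_ k. g (Suc k))"
  have Suc: "\<phi> (Suc i) = g (Suc (\<phi> i))" for i unfolding \<phi>_def by simp
  have "\<phi> i < \<phi> (Suc i)" for i unfolding Suc using g(1)[of "Suc (\<phi> i)"] by simp
  then have "strict_mono \<phi>" by (simp add: strict_mono_Suc_iff)
  moreover have "s (\<phi> i) \<le> s (\<phi> (Suc i))" for i
  proof (cases i)
    case 0
    have "\<phi> 0 = g 0" unfolding \<phi>_def by simp
    then show ?thesis using g(2)[of 0] 0 by simp
  next
    case (Suc j)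
    have "Suc (\<phi> j) \<le> g (Suc (\<phi> i))"
      using g(1)[of "Suc (\<phi> i)"] g(1)[of "Suc (\<phi> j)"] Suc \<open>\<And>i. \<phi> (Suc i) = g (Suc (\<phi> i))\<close> by (simp add: le_trans)
    then show ?thesis unfolding \<open>\<And>i. \<phi> (Suc i) = g (Suc (\<phi> i))\<close>[of i] Suc \<open>\<And>i. \<phi> (Suc i) = g (Suc (\<phi> i))\<close>[of j]
      using g(2) Suc \<open>\<And>i. \<phi> (Suc i) = g (Suc (\<phi> i))\<close> by auto
  qed
  ultimately show ?thesis by blast
qed

text \<open>Passing to a subsequence once per variable makes all exponents monotone simultaneously;
  its first two terms then serve.\<close>

lemma dickson:
  fixes f :: "nat \<Rightarrow> mono"
  assumes V: "finite V" and f: "\<And>i. keys (f i) \<subseteq> V"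
  shows "\<exists>i j. i < j \<and> (\<forall>v. lookup (f i) v \<le> lookup (f j) v)"
proof -
  have "\<exists>\<phi>. strict_mono \<phi> \<and> (\<forall>v\<in>V. \<forall>i. lookup (f (\<phi> i)) v \<le> lookup (f (\<phi> (Suc i))) v)"
    using V
  proof (induction V rule: finite_induct)
    case empty
    show ?case by (rule exI[of _ id]) (auto simp: strict_mono_def)
  next
    case (insert w W)
    then obtain \<phi> where \<phi>: "strict_mono \<phi>" "\<And>v i. v \<in> W \<Longrightarrow> lookup (f (\<phi> i)) v \<le> lookup (f (\<phi> (Suc i))) v" by auto
    have \<phi>m: "lookup (f (\<phi> i)) v \<le> lookup (f (\<phi> j)) v" if "v \<in> W" "i \<le> j" for v i j
      using that(2) by (rule lift_Suc_mono_le[of "\<lambda>i. lookup (f (\<phi> i)) v", rotated]) (rule \<phi>(2)[OF that(1)])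
    obtain \<psi> where \<psi>: "strict_mono \<psi>" "\<And>i. lookup (f (\<phi> (\<psi> i))) w \<le> lookup (f (\<phi> (\<psi> (Suc i)))) w"
      using monotone_subsequence_nat[of "\<lambda>i. lookup (f (\<phi> i)) w"] by auto
    have "strict_mono (\<lambda>i. \<phi> (\<psi> i))" using strict_mono_o[OF \<phi>(1) \<psi>(1)] by (simp only: comp_def)
    moreover have "\<psi> i \<le> \<psi> (Suc i)" for i using \<psi>(1) by (simp add: strict_mono_less_eq)
    ultimately show ?case using \<phi>m \<psi>(2) by (intro exI[of _ "\<lambda>i. \<phi> (\<psi> i)"]) auto
  qed
  then obtain \<phi> where \<phi>: "strict_mono \<phi>" "\<And>v i. v \<in> V \<Longrightarrow> lookup (f (\<phi> i)) v \<le> lookup (f (\<phi> (Suc i))) v" by auto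
  have "lookup (f (\<phi> 0)) v \<le> lookup (f (\<phi> 1)) v" for v
  proof (cases "v \<in> V")
    case True then show ?thesis using \<phi>(2)[of v 0] by simp
  next
    case False
    then have "v \<notin> keys (f (\<phi> 0))" using f by blast
    then show ?thesis by (simp add: in_keys_iff)
  qed
  moreover have "\<phi> 0 < \<phi> 1" using \<phi>(1) by (simp add: strict_mono_less)
  ultimately show ?thesis by blast
qed

text \<open>The order on \<open>mono\<close> is lexicographic, based on the order of index pairs
  from \<open>Product_Lexorder\<close>; here it begins its use as a monomial order.\<close>

lemma mono_zero_le: "0 \<le> (w :: mono)"
proof -
  have "\<not> w < 0" by (simp add: less_poly_mapping.rep_eq less_fun_def)
  then show ?thesis by simp
qed

lemma mono_le_of_divides:
  assumes "\<And>v. lookup u v \<le> lookup m v" shows "u \<le> (m :: mono)"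
proof -
  have "u + 0 \<le> u + (m - u)" by (rule add_left_mono) (rule mono_zero_le)
  then show ?thesis unfolding minus_mono_add[OF assms] by simp
qed

text \<open>In an infinite descent, \<open>dickson\<close> finds a term dividing a later one; the
  later term would then be both smaller and at least as large.\<close>

lemma wf_mono_order:
  assumes "finite V" shows "wf {(m, m'). keys m \<subseteq> V \<and> keys m' \<subseteq> V \<and> m < (m' :: mono)}"
  unfolding wf_iff_no_infinite_down_chain
proof
  assume "\<exists>f. \<forall>i. (f (Suc i), f i) \<in> {(m, m'). keys m \<subseteq> V \<and> keys m' \<subseteq> V \<and> m < (m' :: mono)}"
  then obtain f where f: "\<And>i. keys (f i) \<subseteq> V" "\<And>i. f (Suc i) < (f i :: mono)" by blast
  obtain i j where ij: "i < j" "\<And>v. lookup (f i) v \<le> lookup (f j) v" using dickson[OF assms f(1)] by blast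
  have "f j < f i" using ij(1)
  proof (induction j)
    case (Suc j)
    then show ?case using f(2)[of j] by (cases "i = j") (auto intro: less_trans)
  qed simp
  then show False using mono_le_of_divides[OF ij(2)] by simp
qed

text \<open>Generators are chosen greedily, each outside the ideal of the earlier ones and with
  minimal leading monomial. If this never stopped, \<open>dickson\<close> would give two of them
  with one leading monomial dividing the other, and cancelling the leading term would produce an
  element below the minimum.\<close>

theorem noetherian_poly_ring:
  assumes V: "finite V" shows "noetherian_ring (poly_ring V :: 'k::field mpol ring)"
proof -
  interpret R: cring "poly_ring V :: 'k mpol ring" by (rule cring_poly_ring)
  show ?thesis
  proof (rule R.noetherian_ringI, rule ccontr)
    fix I :: "'k mpol set"
    assume I: "ideal I (poly_ring V)"
      and no: "\<not> (\<exists>A\<subseteq>carrier (poly_ring V). finite A \<and> I = genideal (poly_ring V) A)"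
    have II: "polys.is_ideal V I" using I unfolding ideal_poly_ring_iff .
    note ID = polys.is_idealD[OF II]
    define gen :: "'k mpol set \<Rightarrow> 'k mpol set" where "gen = genideal (poly_ring V)"
    have genI: "polys.is_ideal V (gen F)" if "F \<subseteq> I" for F
    proof -
      have "F \<subseteq> carrier (poly_ring V)" using that ID(1) by auto
      from R.genideal_ideal[OF this] show ?thesis unfolding gen_def ideal_poly_ring_iff .
    qed
    have gen_self: "F \<subseteq> gen F" if "F \<subseteq> I" for F
      unfolding gen_def by (rule R.genideal_self) (use that ID(1) in auto)
    define lm :: "'k mpol \<Rightarrow> mono" where "lm p = Max (keys p)" for p
    let ?r = "{(m, m'). keys m \<subseteq> V \<and> keys m' \<subseteq> V \<and> m < (m' :: mono)}"
    have step: "\<exists>p\<in>I - gen F. \<forall>q\<in>I - gen F. (lm q, lm p) \<notin> ?r" if F: "finite F" "F \<subseteq> I" for F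
    proof -
      have "gen F \<subseteq> I" unfolding gen_def by (rule R.genideal_minimal[OF I F(2)])
      moreover have "I \<noteq> gen F" using no F ID(1) unfolding gen_def by auto
      ultimately have "lm ` (I - gen F) \<noteq> {}" by auto
      then obtain x where x: "x \<in> lm ` (I - gen F)" by blast
      obtain m where m: "m \<in> lm ` (I - gen F)" "\<And>m'. (m', m) \<in> ?r \<Longrightarrow> m' \<notin> lm ` (I - gen F)"
        by (rule wfE_min[OF wf_mono_order[OF V] x]) blast
      from m(1) obtain p where p: "p \<in> I - gen F" "m = lm p" by blast
      then show ?thesis using m(2) by (intro bexI[of _ p]) auto
    qed
    define sel where "sel F = (SOME p. p \<in> I - gen F \<and> (\<forall>q\<in>I - gen F. (lm q, lm p) \<notin> ?r))" for F
    have sel: "sel F \<in> I - gen F \<and> (\<forall>q\<in>I - gen F. (lm q, lm (sel F)) \<notin> ?r)" if "finite F" "F \<subseteq> I" for F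
      unfolding sel_def by (rule someI_ex) (use step[OF that] in blast)
    \<comment> \<open>\<open>ps n\<close> lists the first \<open>n\<close> choices.\<close>
    define ps where "ps = rec_nat [] (\<lambda>_ l. l @ [sel (set l)])"
    have ps0: "ps 0 = []" and psS: "ps (Suc n) = ps n @ [sel (set (ps n))]" for n unfolding ps_def by simp_all
    define p where "p n = sel (set (ps n))" for n
    have psI: "set (ps n) \<subseteq> I" for n
    proof (induction n)
      case (Suc n) then show ?case using sel[of "set (ps n)"] by (auto simp: psS)
    qed (simp add: ps0)
    have pI: "p n \<in> I - gen (set (ps n))" and pmin: "q \<in> I - gen (set (ps n)) \<Longrightarrow> (lm q, lm (p n)) \<notin> ?r" for n q
      using sel[OF finite_set psI] unfolding p_def by auto
    have pin: "p i \<in> set (ps j)" if "i < j" for i j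
      using that by (induction j) (auto simp: psS p_def less_Suc_eq)
    have nz: "q \<noteq> 0" if "q \<in> I - gen (set (ps n))" for q n
      using that polys.is_idealD(2)[OF genI[OF psI]] by blast
    have lmk: "lm q \<in> keys q" if "q \<noteq> 0" for q unfolding lm_def by (rule Max_in) (use that in auto)
    have lmV: "keys (lm q) \<subseteq> V" if "q \<in> I" "q \<noteq> 0" for q
      using lmk[OF that(2)] ID(1)[OF that(1)] unfolding polys_def by blast
    have pnz: "p n \<noteq> 0" and pII: "p n \<in> I" for n using nz[OF pI] pI by auto
    obtain i j where ij: "i < j" "\<And>v. lookup (lm (p i)) v \<le> lookup (lm (p j)) v"
      using dickson[OF V, of "\<lambda>n. lm (p n)"] lmV[OF pII pnz] by blast
    define w where "w = lm (p j) - lm (p i)"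
    have wp: "lm (p i) + w = lm (p j)" unfolding w_def by (rule minus_mono_add[OF ij(2)])
    \<comment> \<open>\<open>c\<close> and \<open>w\<close> make the leading terms cancel in
      \<open>q\<close>; and \<open>q\<close> stays outside the ideal of the earlier choices because
      it differs from \<open>p j\<close> by a multiple of \<open>p i\<close>.\<close>
    define c where "c = lookup (p j) (lm (p j)) / lookup (p i) (lm (p i))"
    define q where "q = p j - Poly_Mapping.single w c * p i"
    have wV: "keys w \<subseteq> V" using lmV[OF pII pnz, of j] wp keys_mono_add[of "lm (p i)" w] by auto
    have G: "polys.is_ideal V (gen (set (ps j)))" by (rule genI[OF psI])
    have piG: "Poly_Mapping.single w c * p i \<in> gen (set (ps j))"
      using polys.is_idealD(4)[OF G single_in_polys[OF wV]] gen_self[OF psI] pin[OF ij(1)] by blast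
    have "q \<in> I" unfolding q_def using ID(5)[OF pII[of j] ID(4)[OF single_in_polys[OF wV] pII]] .
    moreover have "q \<notin> gen (set (ps j))"
    proof
      assume "q \<in> gen (set (ps j))"
      then have "q + Poly_Mapping.single w c * p i \<in> gen (set (ps j))" using polys.is_idealD(3)[OF G] piG by blast
      then show False using pI[of j] unfolding q_def by simp
    qed
    ultimately have q: "q \<in> I - gen (set (ps j))" by blast
    have qnz: "q \<noteq> 0" by (rule nz[OF q])
    have le: "m \<le> lm (p j)" if "m \<in> keys (p j)" for m unfolding lm_def using that by simp
    have lei: "m \<le> lm (p i)" if "m \<in> keys (p i)" for m unfolding lm_def using that by simp
    have "m < lm (p j)" if m: "m \<in> keys q" for m
    proof -
      have "m \<in> keys (p j) \<or> m \<in> keys (Poly_Mapping.single w c * p i)"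
        using m unfolding q_def by (auto simp: in_keys_iff lookup_minus)
      then have "m \<le> lm (p j)"
      proof
        assume "m \<in> keys (Poly_Mapping.single w c * p i)"
        then obtain m' where m': "m' \<in> keys (p i)" "m = w + m'"
          using keys_mult[of "Poly_Mapping.single w c" "p i"] keys_single_subset[of w c] by blast
        have "w + m' \<le> w + lm (p i)" by (rule add_left_mono[OF lei[OF m'(1)]])
        then show ?thesis using wp m'(2) by (simp add: add.commute)
      qed (rule le)
      moreover have "lookup q (lm (p j)) = 0"
      proof -
        have "lookup (Poly_Mapping.single w c * p i) (w + lm (p i)) = c * lookup (p i) (lm (p i))"
          by (rule lookup_single_mult_add)
        moreover have "lookup (p i) (lm (p i)) \<noteq> 0" using lmk[OF pnz[of i]] by (simp add: in_keys_iff)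
        ultimately show ?thesis unfolding q_def lookup_minus using wp by (simp add: c_def add.commute)
      qed
      then have "m \<noteq> lm (p j)" using m by (auto simp: in_keys_iff)
      ultimately show ?thesis by simp
    qed
    then have "lm q < lm (p j)" using lmk[OF qnz] by blast
    then have "(lm q, lm (p j)) \<in> ?r" using lmV[OF _ qnz] q lmV[OF pII pnz] by auto
    then show False using pmin[OF q] by blast
  qed
qed

section \<open>Chains of prime ideals\<close>

fun power_list :: "'a::comm_monoid_mult list \<Rightarrow> nat list \<Rightarrow> 'a" where
  "power_list (x # xs) (e # es) = x ^ e * power_list xs es"
| "power_list _ _ = 1"

text \<open>Bounding each exponent separately, and not the degree, makes the number of admissible
  monomials at most a plain power, which suits the counting below.\<close>

definition exponents_le :: "nat \<Rightarrow> 'k::field mpol \<Rightarrow> bool" where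
  "exponents_le B p \<longleftrightarrow> (\<forall>m\<in>keys p. \<forall>v. lookup m v \<le> B)"

lemma exponents_le_mult: "exponents_le A p \<Longrightarrow> exponents_le B q \<Longrightarrow> exponents_le (A + B) (p * q)"
  unfolding exponents_le_def using keys_mult[of p q] by (fastforce simp: lookup_add intro: add_mono)

lemma exponents_le_one: "exponents_le B 1"
  unfolding exponents_le_def by simp

lemma exponents_le_mono: "exponents_le A p \<Longrightarrow> A \<le> B \<Longrightarrow> exponents_le B p"
  unfolding exponents_le_def using order_trans by blast

lemma exponents_le_power: "exponents_le A p \<Longrightarrow> exponents_le (k * A) (p ^ k)"
  by (induction k) (auto simp: exponents_le_one intro: exponents_le_mult)

lemma exponents_le_power_list:
  assumes "\<forall>x\<in>set xs. exponents_le D x" "\<forall>e\<in>set es. e \<le> N" "length es = length xs"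
  shows "exponents_le (length xs * (N * D)) (power_list xs es)"
  using assms
proof (induction xs es rule: power_list.induct)
  case (1 x xs e es)
  have "exponents_le (e * D) (x ^ e)" using 1 by (intro exponents_le_power) auto
  then have "exponents_le (N * D) (x ^ e)" by (rule exponents_le_mono) (use 1 in auto)
  then show ?case using 1 exponents_le_mult[of "N * D" "x ^ e"] by auto
qed (auto simp: exponents_le_one)

lemma exponents_le_exists: "finite Y \<Longrightarrow> \<exists>D. \<forall>x\<in>Y. exponents_le D x"
proof (induction Y rule: finite_induct)
  case (insert x Y)
  then obtain D where D: "\<forall>x\<in>Y. exponents_le D x" by auto
  have fin: "finite (insert 0 (\<Union>m\<in>keys x. lookup m ` keys m))" by simp
  let ?E = "Max (insert 0 (\<Union>m\<in>keys x. lookup m ` keys m))"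
  have "exponents_le ?E x" unfolding exponents_le_def
  proof (intro ballI allI)
    fix m v assume m: "m \<in> keys x"
    show "lookup m v \<le> ?E"
    proof (cases "v \<in> keys m")
      case True
      then show ?thesis using m by (intro Max_ge[OF fin]) blast
    qed (simp add: in_keys_iff)
  qed
  then have "\<forall>y\<in>insert x Y. exponents_le (max D ?E) y"
    using D exponents_le_mono[OF _ max.cobounded1[of D ?E]] exponents_le_mono[OF _ max.cobounded2[of ?E D]] by auto
  then show ?case by blast
qed simp

interpretation mpol: vector_space "\<lambda>(c :: 'k::field) (p :: 'k mpol). Poly_Mapping.single 0 c * p"
  by unfold_locales (auto simp: algebra_simps single_add mult_single mult.assoc[symmetric])

lemma card_bounded_monomials:
  assumes "finite W"
  shows "finite {m :: mono. keys m \<subseteq> W \<and> (\<forall>v. lookup m v \<le> B)}"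
    "card {m :: mono. keys m \<subseteq> W \<and> (\<forall>v. lookup m v \<le> B)} \<le> (B + 1) ^ card W"
proof -
  let ?M = "{m :: mono. keys m \<subseteq> W \<and> (\<forall>v. lookup m v \<le> B)}"
  let ?f = "\<lambda>m :: mono. restrict (lookup m) W"
  have inj: "inj_on ?f ?M"
  proof (rule inj_onI)
    fix m m' :: mono assume m: "m \<in> ?M" "m' \<in> ?M" "?f m = ?f m'"
    show "m = m'"
    proof (rule poly_mapping_eqI)
      fix v
      show "lookup m v = lookup m' v"
      proof (cases "v \<in> W")
        case True
        then show ?thesis using fun_cong[OF m(3), of v] by simp
      next
        case False
        then have "v \<notin> keys m" "v \<notin> keys m'" using m by auto
        then show ?thesis by (simp add: in_keys_iff)
      qed
    qed
  qed
  have sub: "?f ` ?M \<subseteq> (\<Pi>\<^sub>E v\<in>W. {..B})" by auto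
  have fin: "finite (\<Pi>\<^sub>E v\<in>W. {..B})" using assms by (intro finite_PiE) auto
  show "finite ?M" using finite_imageD[OF finite_subset[OF sub fin] inj] .
  have "card ?M \<le> card (\<Pi>\<^sub>E v\<in>W. {..B})" by (rule card_inj_on_le[OF inj sub fin])
  also have "\<dots> = (B + 1) ^ card W" using assms by (simp add: card_PiE)
  finally show "card ?M \<le> (B + 1) ^ card W" .
qed

text \<open>A counting argument: with exponents up to \<open>N\<close> there are
  \<open>(N + 1) ^ k\<close> exponent lists, and their power products lie in the span of at most
  \<open>(B + 1) ^ card W\<close> monomials, where \<open>B\<close> is linear in \<open>N\<close>.
  As \<open>k > card W\<close>, the first number wins for large \<open>N\<close>.\<close>

lemma algebraic_dependence:
  fixes xs :: "'k::field mpol list"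
  assumes W: "finite W" and xs: "set xs \<subseteq> polys W" and len: "length xs > card W"
  shows "\<exists>A c. finite A \<and> (\<forall>es\<in>A. length es = length xs) \<and>
    (\<Sum>es\<in>A. Poly_Mapping.single 0 (c es) * power_list xs es) = (0 :: 'k mpol) \<and> (\<exists>es\<in>A. c es \<noteq> 0)"
proof -
  obtain D where D: "\<forall>x\<in>set xs. exponents_le D x" using exponents_le_exists[of "set xs"] by auto
  define d where "d = card W"
  define k where "k = length xs"
  define E where "E = k * D + 1"
  \<comment> \<open>\<open>E\<close> is chosen such that \<open>B + 1 \<le> E * (N + 1)\<close>, and
    \<open>N = E ^ d\<close> is just large enough to absorb the resulting constant factor
    \<open>E ^ d\<close>.\<close>
  define N where "N = E ^ d"
  define B where "B = k * (N * D)"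
  let ?A = "{es. set es \<subseteq> {..N} \<and> length es = k}"
  have finA: "finite ?A" by (rule finite_lists_length_eq) simp
  have cardA: "card ?A = (N + 1) ^ k" using card_lists_length_eq[of "{..N}" k] by simp
  have "B + 1 \<le> E * (N + 1)" unfolding B_def E_def by (simp add: algebra_simps)
  then have "(B + 1) ^ d \<le> (E * (N + 1)) ^ d" by (intro power_mono) auto
  also have "\<dots> = N * (N + 1) ^ d" by (simp only: power_mult_distrib N_def[symmetric])
  also have "\<dots> < (N + 1) ^ Suc d" by simp
  also have "\<dots> \<le> (N + 1) ^ k" using len unfolding d_def k_def by (intro power_increasing) auto
  finally have lt: "(B + 1) ^ d < card ?A" unfolding cardA .
  let ?M = "{m :: mono. keys m \<subseteq> W \<and> (\<forall>v. lookup m v \<le> B)}"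
  let ?T = "(mon :: mono \<Rightarrow> 'k mpol) ` ?M"
  have finT: "finite ?T" using card_bounded_monomials(1)[OF W] by simp
  have cardT: "card ?T \<le> (B + 1) ^ d"
    using card_image_le[OF card_bounded_monomials(1)[OF W], of mon B] card_bounded_monomials(2)[OF W, of B]
    unfolding d_def by (rule order_trans)
  have inT: "power_list xs es \<in> mpol.span ?T" if es: "es \<in> ?A" for es
  proof -
    let ?p = "power_list xs es"
    have "exponents_le B ?p" unfolding B_def k_def by (rule exponents_le_power_list[OF D]) (use es k_def in auto)
    moreover have "?p \<in> polys W" using xs
    proof (induction xs es rule: power_list.induct)
      case (1 x xs e es)
      then show ?case by simp
    qed auto
    ultimately have M: "m \<in> ?M" if "m \<in> keys ?p" for m using that unfolding exponents_le_def polys_def by auto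
    have "?p = (\<Sum>m\<in>keys ?p. Poly_Mapping.single 0 (lookup ?p m) * mon m)"
      by (subst (1) poly_sum_monomials[of ?p]) (simp add: mult_single)
    also have "\<dots> \<in> mpol.span ?T"
      by (intro mpol.span_sum mpol.span_scale mpol.span_base) (use M in auto)
    finally show ?thesis .
  qed
  show ?thesis
  proof (cases "inj_on (power_list xs) ?A")
    case True
    let ?S = "power_list xs ` ?A"
    have "card ?S = card ?A" by (rule card_image[OF True])
    have "mpol.dependent ?S"
    proof (rule ccontr)
      assume "\<not> mpol.dependent ?S"
      then have "card ?S \<le> card ?T" using mpol.independent_span_bound[OF finT, of ?S] inT by auto
      then show False using \<open>card ?S = card ?A\<close> lt cardT by linarith
    qed
    then obtain u where u: "\<exists>v\<in>?S. u v \<noteq> 0" "(\<Sum>v\<in>?S. Poly_Mapping.single 0 (u v) * v) = 0"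
      using mpol.dependent_finite[of ?S] finA by auto
    have "(\<Sum>es\<in>?A. Poly_Mapping.single 0 (u (power_list xs es)) * power_list xs es) = 0"
      using u(2) sum.reindex[OF True, of "\<lambda>v. Poly_Mapping.single 0 (u v) * v"] by (simp add: comp_def)
    then show ?thesis using finA u(1) unfolding k_def
      by (intro exI[of _ ?A] exI[of _ "\<lambda>es. u (power_list xs es)"]) (auto simp: k_def)
  next
    case False
    \<comment> \<open>Two equal power products already form a relation, with coefficients 1 and
      -1.\<close>
    then obtain es fs where ef: "es \<in> ?A" "fs \<in> ?A" "es \<noteq> fs" "power_list xs es = power_list xs fs"
      unfolding inj_on_def by blast
    let ?c = "\<lambda>gs. if gs = es then 1 else - 1 :: 'k"
    have "(\<Sum>gs\<in>{es, fs}. Poly_Mapping.single 0 (?c gs) * power_list xs gs) = (0 :: 'k mpol)"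
      using ef by (simp add: single_uminus)
    then show ?thesis using ef unfolding k_def
      by (intro exI[of _ "{es, fs}"] exI[of _ ?c]) (auto simp: k_def)
  qed
qed

text \<open>The coefficients of a polynomial relation are forced to vanish one after the other, in
  the lexicographic order of the exponents.\<close>

lemma prime_chain_independent:
  fixes P :: "nat \<Rightarrow> 'k::field mpol set"
  assumes "\<And>i. i \<le> length xs \<Longrightarrow> primeideal (P i) (poly_ring V)"
    and "\<And>i. i < length xs \<Longrightarrow> P i \<subseteq> P (Suc i) \<and> xs ! i \<in> P (Suc i) \<and> xs ! i \<notin> P i"
    and "finite A" "\<And>es. es \<in> A \<Longrightarrow> length es = length xs"
    and "(\<Sum>es\<in>A. Poly_Mapping.single 0 (c es) * power_list xs es) \<in> P 0"
  shows "\<forall>es\<in>A. c es = 0"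
  using assms
proof (induction xs arbitrary: P A c)
  case Nil
  interpret P: primeideal "P 0" "poly_ring V" using Nil.prems(1) by simp
  have PI: "polys.is_ideal V (P 0)" using P.is_ideal unfolding ideal_poly_ring_iff .
  have one: "1 \<notin> P 0" using P.I_notcarr P.one_imp_carrier by auto
  show ?case
  proof
    fix es assume es: "es \<in> A"
    then have "es = []" using Nil.prems(4) by simp
    have "A = {[]}" using Nil.prems(4) es \<open>es = []\<close> by auto
    then have c: "(Poly_Mapping.single 0 (c es) :: 'k mpol) \<in> P 0" using Nil.prems(5) \<open>es = []\<close> by simp
    show "c es = 0"
    proof (rule ccontr)
      assume "c es \<noteq> 0"
      then have "(1 :: 'k mpol) = Poly_Mapping.single 0 (1 / c es) * Poly_Mapping.single 0 (c es)"
        by (simp add: mult_single)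
      also have "\<dots> \<in> P 0" by (rule polys.is_idealD(4)[OF PI _ c]) simp
      finally show False using one by simp
    qed
  qed
next
  case (Cons x xs)
  interpret P: primeideal "P 0" "poly_ring V" using Cons.prems(1) by simp
  interpret Q: primeideal "P 1" "poly_ring V" using Cons.prems(1) by simp
  have PI: "polys.is_ideal V (P 0)" using P.is_ideal unfolding ideal_poly_ring_iff .
  have QI: "polys.is_ideal V (P 1)" using Q.is_ideal unfolding ideal_poly_ring_iff .
  have PP: "primeideal (P i) (poly_ring V)" if "i \<le> Suc (length xs)" for i using Cons.prems(1) that by simp
  have x: "x \<in> P 1" "x \<notin> P 0" "P 0 \<subseteq> P 1" using Cons.prems(2)[of 0] by auto
  have xV: "x \<in> polys V" using polys.is_idealD(1)[OF QI x(1)] .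
  have xsV: "set xs \<subseteq> polys V"
  proof
    fix y assume "y \<in> set xs"
    then obtain i where i: "i < length xs" "y = xs ! i" by (metis in_set_conv_nth)
    then have "y \<in> P (Suc (Suc i))" using Cons.prems(2)[of "Suc i"] by simp
    moreover have "polys.is_ideal V (P (Suc (Suc i)))"
      using PP[of "Suc (Suc i)"] i unfolding ideal_poly_ring_iff[symmetric] by (simp add: primeideal.axioms(1))
    ultimately show "y \<in> polys V" using polys.is_idealD(1) by blast
  qed
  have plV: "power_list xs es \<in> polys V" for es using xsV
    by (induction xs es rule: power_list.induct) auto
  show ?case
  proof (rule ccontr)
    assume "\<not> ?case"
    define S where "S = {es\<in>A. c es \<noteq> 0}"
    have S: "S \<noteq> {}" "finite S" using \<open>\<not> ?case\<close> Cons.prems(3) unfolding S_def by auto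
    have lenS: "es \<noteq> []" "length (tl es) = length xs" if "es \<in> S" for es
      using Cons.prems(4)[of es] that unfolding S_def by auto
    \<comment> \<open>\<open>e\<close> is the smallest exponent of \<open>x\<close> that occurs.
      Since \<open>x\<close> is not in the prime \<open>P 0\<close>, the factor \<open>x ^ e\<close>
      can be cancelled; modulo \<open>P 1\<close>, which contains \<open>x\<close>, only the terms
      with exponent \<open>e\<close> survive, and these form a relation of
      \<open>xs\<close>.\<close>
    define e where "e = Min (hd ` S)"
    have e: "e \<in> hd ` S" "\<And>es. es \<in> S \<Longrightarrow> e \<le> hd es" unfolding e_def using S by auto
    let ?c = "\<lambda>es. Poly_Mapping.single 0 (c es) :: 'k mpol"
    let ?S0 = "{es\<in>S. hd es = e}" and ?S1 = "{es\<in>S. hd es \<noteq> e}"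
    let ?p = "\<Sum>es\<in>?S0. ?c es * power_list xs (tl es)"
    let ?q = "\<Sum>es\<in>?S1. ?c es * (x ^ (hd es - Suc e) * power_list xs (tl es))"
    have "(\<Sum>es\<in>A. ?c es * power_list (x # xs) es) = (\<Sum>es\<in>S. ?c es * power_list (x # xs) es)"
      by (rule sum.mono_neutral_right[OF Cons.prems(3)]) (auto simp: S_def)
    also have "\<dots> = (\<Sum>es\<in>S. ?c es * (x ^ hd es * power_list xs (tl es)))"
      by (rule sum.cong[OF refl]) (metis lenS(1) list.collapse power_list.simps(1))
    also have "\<dots> = (\<Sum>es\<in>?S0. ?c es * (x ^ hd es * power_list xs (tl es)))
       + (\<Sum>es\<in>?S1. ?c es * (x ^ hd es * power_list xs (tl es)))"
    proof -
      have "S \<inter> {es. hd es = e} = ?S0" "S - {es. hd es = e} = ?S1" by auto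
      then show ?thesis
        using sum.Int_Diff[OF S(2), of "\<lambda>es. ?c es * (x ^ hd es * power_list xs (tl es))" "{es. hd es = e}"]
        by (simp only:)
    qed
    also have "(\<Sum>es\<in>?S0. ?c es * (x ^ hd es * power_list xs (tl es))) = x ^ e * ?p"
      unfolding sum_distrib_left by (rule sum.cong) (auto simp: algebra_simps)
    also have "(\<Sum>es\<in>?S1. ?c es * (x ^ hd es * power_list xs (tl es))) = x ^ e * (x * ?q)"
      unfolding sum_distrib_left
    proof (rule sum.cong[OF refl])
      fix es assume "es \<in> ?S1"
      then have "e < hd es" using e(2)[of es] by auto
      then have "x ^ hd es = x ^ e * (x * x ^ (hd es - Suc e))"
        by (metis Suc_diff_Suc add_diff_inverse_nat less_not_sym power_Suc power_add)
      then show "?c es * (x ^ hd es * power_list xs (tl es))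
         = x ^ e * (x * (?c es * (x ^ (hd es - Suc e) * power_list xs (tl es))))"
        by (simp only: mult_ac)
    qed
    finally have "x ^ e * (?p + x * ?q) \<in> P 0" using Cons.prems(5) by (simp add: distrib_left)
    moreover have pV: "?p \<in> polys V" and qV: "?q \<in> polys V"
      using xV plV by (auto intro!: polys.sum_C polys.mult_C)
    moreover have "y \<in> P 0" if "x ^ k * y \<in> P 0" "y \<in> polys V" for k y
      using that
    proof (induction k)
      case (Suc k)
      have "x * (x ^ k * y) \<in> P 0" using Suc.prems by (simp add: mult.assoc)
      then have "x ^ k * y \<in> P 0" using P.I_prime[of x "x ^ k * y"] x(2) xV Suc.prems(2) by simp
      then show ?case using Suc by simp
    qed simp
    ultimately have "?p + x * ?q \<in> P 0" using xV by simp
    then have pq: "?p + x * ?q \<in> P 1" using x(3) by blast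
    have "x * ?q \<in> P 1" using polys.is_idealD(4)[OF QI qV x(1)] by (simp add: mult.commute)
    then have "?p + x * ?q - x * ?q \<in> P 1" by (rule polys.is_idealD(5)[OF QI pq])
    then have p1: "?p \<in> P 1" by (simp only: add_diff_cancel_right')
    have inj: "inj_on tl ?S0"
      by (rule inj_onI) (metis (mono_tags, lifting) lenS(1) list.collapse mem_Collect_eq)
    have re: "?p = (\<Sum>es\<in>tl ` ?S0. Poly_Mapping.single 0 (c (e # es)) * power_list xs es)"
      unfolding sum.reindex[OF inj] comp_def
      by (rule sum.cong[OF refl]) (metis (mono_tags, lifting) lenS(1) list.collapse mem_Collect_eq)
    have "\<forall>es\<in>tl ` ?S0. c (e # es) = 0"
    proof (rule Cons.IH[of "\<lambda>i. P (Suc i)"])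
      show "(\<Sum>es\<in>tl ` ?S0. Poly_Mapping.single 0 (c (e # es)) * power_list xs es) \<in> P (Suc 0)"
        using p1 unfolding re by simp
      show "primeideal (P (Suc i)) (poly_ring V)" if "i \<le> length xs" for i using PP that by simp
      show "P (Suc i) \<subseteq> P (Suc (Suc i)) \<and> xs ! i \<in> P (Suc (Suc i)) \<and> xs ! i \<notin> P (Suc i)" if "i < length xs" for i
        using Cons.prems(2)[of "Suc i"] that by simp
    qed (use S(2) lenS in auto)
    moreover obtain es where es: "es \<in> S" "hd es = e" using e(1) by auto
    ultimately have "c (e # tl es) = 0" by blast
    moreover have "e # tl es = es" using lenS(1)[OF es(1)] es(2) list.collapse by blast
    ultimately show False using es(1) unfolding S_def by simp
  qed
qed

text \<open>Elements separating consecutive primes can be chosen free of the variables in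
  \<open>Z\<close>. More than \<open>card (V - Z)\<close> of them would be algebraically dependent,
  while the chain makes them independent.\<close>

theorem prime_chain_length:
  fixes P :: "nat \<Rightarrow> 'k::field mpol set"
  assumes V: "finite V" and P: "\<forall>i\<le>k. primeideal (P i) (poly_ring V)" "\<forall>i<k. P i \<subset> P (Suc i)"
    and Z: "Z \<subseteq> V" "\<And>v. v \<in> Z \<Longrightarrow> mon (Poly_Mapping.single v 1) \<in> P 0"
  shows "k \<le> card (V - Z)"
proof (rule ccontr)
  let ?W = "V - Z"
  assume "\<not> k \<le> card ?W"
  have PI: "polys.is_ideal V (P i)" if "i \<le> k" for i
    using P(1) that unfolding ideal_poly_ring_iff[symmetric] by (simp add: primeideal.axioms(1))
  have P0: "P 0 \<subseteq> P i" if "i \<le> k" for i using that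
  proof (induction i)
    case (Suc i)
    then have "P i \<subset> P (Suc i)" using P(2) by simp
    then show ?case using Suc by auto
  qed simp
  have "\<exists>x. x \<in> polys ?W \<and> x \<in> P (Suc i) \<and> x \<notin> P i" if i: "i < k" for i
  proof -
    obtain y where y: "y \<in> P (Suc i)" "y \<notin> P i" using P(2) i by blast
    have yV: "y \<in> polys V" using polys.is_idealD(1)[OF PI y(1)] i by simp
    let ?s = "\<lambda>m. Poly_Mapping.single m (lookup y m)"
    \<comment> \<open>The terms containing a variable of \<open>Z\<close> are collected in
      \<open>z\<close>. They lie in \<open>P 0\<close>, hence in every prime of the chain, so
      \<open>p\<close> separates the two primes as \<open>y\<close> does.\<close>
    define p where "p = (\<Sum>m\<in>{m\<in>keys y. keys m \<subseteq> ?W}. ?s m)"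
    define z where "z = (\<Sum>m\<in>{m\<in>keys y. \<not> keys m \<subseteq> ?W}. ?s m)"
    have split: "y = p + z"
      using poly_sum_monomials[of y] sum.Int_Diff[of "keys y" ?s "{m. keys m \<subseteq> ?W}"]
      unfolding p_def z_def by (simp add: Int_def set_diff_eq)
    have sP: "?s m \<in> P 0" if m: "m \<in> keys y" "\<not> keys m \<subseteq> ?W" for m
    proof -
      have mV: "keys m \<subseteq> V" using m(1) yV unfolding polys_def by auto
      then obtain v where v: "v \<in> Z" "v \<in> keys m" using m(2) by auto
      let ?u = "m - Poly_Mapping.single v 1"
      have "Poly_Mapping.single v 1 + ?u = m"
        using v(2) by (intro minus_mono_add) (auto simp: lookup_single when_def in_keys_iff)
      then have "?s m = Poly_Mapping.single ?u (lookup y m) * mon (Poly_Mapping.single v 1)"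
        by (simp add: mult_single add.commute)
      moreover have "keys ?u \<subseteq> V" using mV by (auto simp: in_keys_iff lookup_minus subset_iff)
      ultimately show ?thesis using polys.is_idealD(4)[OF PI[of 0]] Z(2)[OF v(1)] by simp
    qed
    have "(\<Sum>m\<in>F. ?s m) \<in> P 0" if "finite F" "F \<subseteq> {m\<in>keys y. \<not> keys m \<subseteq> ?W}" for F
      using that by (induction F rule: finite_induct) (use sP polys.is_idealD(2,3)[OF PI[of 0]] in auto)
    from this[of "{m\<in>keys y. \<not> keys m \<subseteq> ?W}"] have z: "z \<in> P 0" unfolding z_def by simp
    have "p \<in> polys ?W" unfolding p_def by (intro polys.sum_C single_in_polys) auto
    moreover have "p \<in> P (Suc i)"
    proof -
      have "y - z \<in> P (Suc i)" using polys.is_idealD(5)[OF PI[of "Suc i"] y(1)] z P0[of "Suc i"] i by auto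
      moreover have "y - z = p" using split by simp
      ultimately show ?thesis by simp
    qed
    moreover have "p \<notin> P i"
    proof
      assume "p \<in> P i"
      then have "p + z \<in> P i" using polys.is_idealD(3)[OF PI[of i]] z P0[of i] i by auto
      then show False using split y(2) by simp
    qed
    ultimately show ?thesis by blast
  qed
  then obtain x where x: "\<And>i. i < k \<Longrightarrow> x i \<in> polys ?W \<and> x i \<in> P (Suc i) \<and> x i \<notin> P i" by metis
  let ?xs = "map x [0..<k]"
  obtain A c where A: "finite A" "\<forall>es\<in>A. length es = length ?xs"
    "(\<Sum>es\<in>A. Poly_Mapping.single 0 (c es) * power_list ?xs es) = (0 :: 'k mpol)" "\<exists>es\<in>A. c es \<noteq> 0"
  proof -
    have "finite ?W" using V by simp
    moreover have "set ?xs \<subseteq> polys ?W" using x by auto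
    moreover have "card ?W < length ?xs" using \<open>\<not> k \<le> card ?W\<close> by simp
    ultimately show ?thesis using algebraic_dependence[of ?W ?xs] that by blast
  qed
  have "\<forall>es\<in>A. c es = 0"
  proof (rule prime_chain_independent[of ?xs P V])
    show "(\<Sum>es\<in>A. Poly_Mapping.single 0 (c es) * power_list ?xs es) \<in> P 0"
      unfolding A(3) by (rule polys.is_idealD(2)[OF PI]) simp
    show "primeideal (P i) (poly_ring V)" if "i \<le> length ?xs" for i using P(1) that by simp
    show "P i \<subseteq> P (Suc i) \<and> ?xs ! i \<in> P (Suc i) \<and> ?xs ! i \<notin> P i" if "i < length ?xs" for i
    proof -
      have "i < k" using that by simp
      then have "P i \<subset> P (Suc i)" using P(2) by simp
      then show ?thesis using x[OF \<open>i < k\<close>] \<open>i < k\<close> by auto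
    qed
    show "finite A" by (rule A(1))
    show "length es = length ?xs" if "es \<in> A" for es using A(2) that by blast
  qed
  then show False using A(4) by blast
qed

text \<open>Columns of \<open>m\<close> that dominate every column of \<open>a\<close> can be used
  greedily from the right; any \<open>L\<close> of them admit a placement.\<close>

lemma shift_divides_full_columns:
  "L \<le> card {j\<in>{1..n}. \<forall>i\<in>{1..c}. \<forall>l\<in>{1..L}. a i l \<le> lookup m (i, j)} \<Longrightarrow> shift_divides c a L n m"
proof (induction c a L n m rule: shift_divides.induct)
  case (3 c a L n m)
  let ?G = "\<lambda>L j. \<forall>i\<in>{1..c}. \<forall>l\<in>{1..L}. a i l \<le> lookup m (i, j)"
  show ?case
  proof (cases "?G (Suc L) (Suc n)")
    case True
    then have "{j\<in>{1..Suc n}. ?G (Suc L) j} = insert (Suc n) {j\<in>{1..n}. ?G (Suc L) j}"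
      by (auto simp: le_Suc_eq)
    then have "L \<le> card {j\<in>{1..n}. ?G (Suc L) j}" using 3(3) by simp
    also have "\<dots> \<le> card {j\<in>{1..n}. ?G L j}" by (rule card_mono) auto
    finally have "shift_divides c a L n m" by (rule 3(2))
    then show ?thesis using True by auto
  next
    case False
    then have "{j\<in>{1..Suc n}. ?G (Suc L) j} = {j\<in>{1..n}. ?G (Suc L) j}" by (auto simp: le_Suc_eq)
    then have "shift_divides c a (Suc L) n m" using 3(1,3) by simp
    then show ?thesis by simp
  qed
qed auto

theorem shift_divides_prime_chain_length:
  fixes P :: "nat \<Rightarrow> 'k::field mpol set"
  assumes V: "V = {1..c} \<times> {1..n}" and L: "1 \<le> L" "L \<le> n"
    and P: "\<forall>i\<le>k. primeideal (P i) (poly_ring V)" "\<forall>i<k. P i \<subset> P (Suc i)"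
    and I: "monomial_ideal V {m. shift_divides c a L n m} \<subseteq> P 0"
  shows "k \<le> c * n - (n + 1 - L)"
proof -
  interpret P: primeideal "P 0" "poly_ring V" using P(1) by simp
  let ?x = "\<lambda>v. mon (Poly_Mapping.single v 1) :: 'k mpol"
  have one: "1 \<notin> P 0" using P.I_notcarr P.one_imp_carrier by auto
  define Z where "Z = {v\<in>V. ?x v \<in> P 0}"
  have fV: "finite V" unfolding V by simp
  have kW: "k \<le> card (V - Z)" by (rule prime_chain_length[OF fV P]) (auto simp: Z_def)
  \<comment> \<open>\<open>F\<close> consists of the columns without a variable in
    \<open>P 0\<close>. With \<open>L\<close> of them, a high power of the product of their
    variables would lie in the ideal, and primality would put one of these variables into
    \<open>P 0\<close>.\<close>
  define F where "F = {j\<in>{1..n}. \<forall>i\<in>{1..c}. (i, j) \<notin> Z}"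
  have "card F < L"
  proof (rule ccontr)
    assume "\<not> card F < L"
    \<comment> \<open>The sum of all entries serves as a common bound for them.\<close>
    define e where "e = (\<Sum>i\<in>{1..c}. \<Sum>l\<in>{1..L}. a i l)"
    let ?S = "{1..c} \<times> F"
    define m :: mono where "m = (\<Sum>v\<in>?S. Poly_Mapping.single v e)"
    have finS: "finite ?S" unfolding F_def by simp
    have lm: "lookup m v = (if v \<in> ?S then e else 0)" for v
      unfolding m_def using finS by (simp add: lookup_sum lookup_single when_def sum.delta)
    have ae: "a i l \<le> e" if "i \<in> {1..c}" "l \<in> {1..L}" for i l
    proof -
      have "a i l \<le> (\<Sum>l\<in>{1..L}. a i l)" by (rule member_le_sum[OF that(2)]) auto
      also have "\<dots> \<le> e" unfolding e_def by (rule member_le_sum[OF that(1)]) auto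
      finally show ?thesis .
    qed
    have "F \<subseteq> {j\<in>{1..n}. \<forall>i\<in>{1..c}. \<forall>l\<in>{1..L}. a i l \<le> lookup m (i, j)}"
      using ae unfolding lm F_def by auto
    then have "card F \<le> card {j\<in>{1..n}. \<forall>i\<in>{1..c}. \<forall>l\<in>{1..L}. a i l \<le> lookup m (i, j)}" by (rule card_mono[rotated]) simp
    then have "shift_divides c a L n m" using \<open>\<not> card F < L\<close> by (intro shift_divides_full_columns) simp
    moreover have "keys m \<subseteq> V" using lm unfolding V F_def by (auto simp: in_keys_iff split: if_splits)
    ultimately have mP: "mon m \<in> P 0" using I unfolding monomial_ideal_def by auto
    have "\<exists>v\<in>U. ?x v \<in> P 0" if "finite U" "U \<subseteq> V" "mon (\<Sum>v\<in>U. Poly_Mapping.single v e) \<in> P 0" for U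
      using that
    proof (induction U rule: finite_induct)
      case empty then show ?case using one by simp
    next
      case (insert v U)
      let ?r = "mon (\<Sum>v\<in>U. Poly_Mapping.single v e) :: 'k mpol"
      have eq: "mon (\<Sum>v\<in>insert v U. Poly_Mapping.single v e) = mon (Poly_Mapping.single v e) * ?r"
        using insert.hyps by (simp add: mult_single)
      have kU: "keys (\<Sum>v\<in>U. Poly_Mapping.single v e) \<subseteq> V"
        by (rule subset_trans[OF keys_sum_subset]) (use insert.prems keys_single_subset in fast)
      have kv: "keys (Poly_Mapping.single v e) \<subseteq> V" using insert.prems keys_single_subset by fast
      have "mon (Poly_Mapping.single v e) \<in> P 0 \<or> ?r \<in> P 0"
        using P.I_prime[of "mon (Poly_Mapping.single v e)" ?r] insert.prems(2) kU kv unfolding eq by simp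
      then show ?case
      proof
        assume "?r \<in> P 0"
        then show ?thesis using insert by auto
      next
        assume a: "mon (Poly_Mapping.single v e) \<in> P 0"
        have "mon (Poly_Mapping.single v k) \<in> P 0 \<Longrightarrow> ?x v \<in> P 0" for k
        proof (induction k)
          case 0 then show ?case using one by simp
        next
          case (Suc k)
          have "mon (Poly_Mapping.single v (Suc k)) = ?x v * mon (Poly_Mapping.single v k)"
            by (simp add: mult_single single_add[symmetric])
          then have "?x v * mon (Poly_Mapping.single v k) \<in> P 0" using Suc.prems by simp
          moreover have "v \<in> V" using insert.prems by simp
          moreover from this have "keys (Poly_Mapping.single v k) \<subseteq> V" using keys_single_subset by fast
          ultimately have "?x v \<in> P 0 \<or> mon (Poly_Mapping.single v k) \<in> P 0"
            using P.I_prime[of "?x v" "mon (Poly_Mapping.single v k)"] by simp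
          then show ?case using Suc.IH by blast
        qed
        then show ?thesis using a by blast
      qed
    qed
    moreover have SV: "?S \<subseteq> V" unfolding V F_def by auto
    ultimately obtain v where v: "v \<in> ?S" "?x v \<in> P 0" using finS mP[unfolded m_def] by blast
    then have "v \<in> Z" unfolding Z_def using SV by blast
    then show False using v(1) unfolding F_def by auto
  qed
  \<comment> \<open>Each column outside \<open>F\<close> contains a variable of \<open>Z\<close>,
    and there are at least \<open>n + 1 - L\<close> such columns.\<close>
  have "n - card F \<le> card Z"
  proof -
    have "{1..n} - F \<subseteq> snd ` Z" unfolding F_def by force
    moreover have finZ: "finite Z" unfolding Z_def using fV by simp
    ultimately have "card ({1..n} - F) \<le> card Z" using surj_card_le[OF finZ] by blast
    moreover have "F \<subseteq> {1..n}" unfolding F_def by auto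
    then have "card ({1..n} - F) = n - card F" by (subst card_Diff_subset) (auto intro: finite_subset)
    ultimately show ?thesis by simp
  qed
  moreover have "card (V - Z) = c * n - card Z"
    by (subst card_Diff_subset) (use fV in \<open>auto simp: Z_def V\<close>)
  ultimately show ?thesis using kW \<open>card F < L\<close> L by linarith
qed

section \<open>Truncations of orbit ideals\<close>

lemma genideal_monomials:
  assumes G: "\<And>u. u \<in> G \<Longrightarrow> keys u \<subseteq> V"
  shows "genideal (poly_ring V) (mon ` G) = (monomial_ideal V (\<Union>u\<in>G. range ((+) u)) :: 'k::field mpol set)"
proof
  interpret R: cring "poly_ring V :: 'k mpol ring" by (rule cring_poly_ring)
  let ?U = "\<Union>u\<in>G. range ((+) u)"
  have up: "up_closed ?U" unfolding up_closed_def by (auto simp: add.assoc)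
  have Gc: "(mon :: mono \<Rightarrow> 'k mpol) ` G \<subseteq> carrier (poly_ring V)" using G by auto
  show "genideal (poly_ring V) (mon ` G) \<subseteq> (monomial_ideal V ?U :: 'k mpol set)"
  proof (rule R.genideal_minimal)
    show "ideal (monomial_ideal V ?U :: 'k mpol set) (poly_ring V)"
      unfolding ideal_poly_ring_iff by (rule is_ideal_monomial_ideal[OF up])
    have "u \<in> ?U" if "u \<in> G" for u using that by (intro UN_I[of u] range_eqI[of _ _ 0]) auto
    then show "mon ` G \<subseteq> (monomial_ideal V ?U :: 'k mpol set)" using G unfolding monomial_ideal_def by auto
  qed
  show "(monomial_ideal V ?U :: 'k mpol set) \<subseteq> genideal (poly_ring V) (mon ` G)"
  proof
    let ?J = "genideal (poly_ring V) ((mon :: mono \<Rightarrow> 'k mpol) ` G)"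
    have J: "polys.is_ideal V ?J" unfolding ideal_poly_ring_iff[symmetric] by (rule R.genideal_ideal[OF Gc])
    fix p :: "'k mpol" assume p: "p \<in> monomial_ideal V ?U"
    have s: "Poly_Mapping.single m (lookup p m) \<in> ?J" if m: "m \<in> keys p" for m
    proof -
      obtain u w where u: "u \<in> G" "m = u + w" using p m unfolding monomial_ideal_def by auto
      have "keys m \<subseteq> V" using p m unfolding monomial_ideal_def polys_def by auto
      then have w: "keys w \<subseteq> V" using u(2) keys_mono_add[of u w] by auto
      have "Poly_Mapping.single m (lookup p m) = Poly_Mapping.single w (lookup p m) * mon u"
        unfolding u(2) by (simp add: mult_single add.commute)
      moreover have "mon u \<in> ?J" using R.genideal_self[OF Gc] u(1) by auto
      ultimately show ?thesis using polys.is_idealD(4)[OF J single_in_polys[OF w]] by simp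
    qed
    have "(\<Sum>m\<in>F. Poly_Mapping.single m (lookup p m)) \<in> ?J" if "finite F" "F \<subseteq> keys p" for F
      using that by (induction F rule: finite_induct) (use s polys.is_idealD(2,3)[OF J] in auto)
    from this[OF finite_keys order_refl] show "p \<in> ?J" using poly_sum_monomials[of p] by simp
  qed
qed

definition act_mono :: "(nat \<Rightarrow> nat) \<Rightarrow> mono \<Rightarrow> mono" where
  "act_mono \<pi> m = (\<Sum>v\<in>keys m. Poly_Mapping.single (fst v, \<pi> (snd v)) (lookup m v))"

lemma inc_act_mon: "inc_act \<pi> (mon m) = mon (act_mono \<pi> m)"
proof -
  have "inc_act \<pi> (mon m) = (\<Prod>v\<in>keys m. var (fst v, \<pi> (snd v)) ^ lookup m v :: 'a mpol)"
    unfolding inc_act_def const_poly_def xvar_def by (simp add: case_prod_beta)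
  then show ?thesis unfolding act_mono_def mon_sum var_power .
qed

definition col_mono :: "nat \<Rightarrow> (nat \<Rightarrow> nat \<Rightarrow> nat) \<Rightarrow> nat \<Rightarrow> mono" where
  "col_mono c a L = (\<Sum>v\<in>{1..c} \<times> {1..L}. Poly_Mapping.single v (a (fst v) (snd v)))"

lemma lookup_col_mono: "lookup (col_mono c a L) v = (if v \<in> {1..c} \<times> {1..L} then a (fst v) (snd v) else 0)"
  unfolding col_mono_def by (simp add: lookup_sum lookup_single when_def sum.delta)

lemma prod_xvar_eq: "(\<Prod>i=1..c. \<Prod>j=1..L. xvar i j ^ a i j) = mon (col_mono c a L)"
proof -
  have "(\<Prod>i=1..c. \<Prod>j=1..L. xvar i j ^ a i j) = (\<Prod>v\<in>{1..c} \<times> {1..L}. var v ^ a (fst v) (snd v) :: 'a mpol)"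
    unfolding prod.cartesian_product xvar_def by (rule prod.cong) auto
  then show ?thesis unfolding col_mono_def mon_sum var_power .
qed

lemma Inc_less: "\<pi> \<in> Inc \<Longrightarrow> 1 \<le> i \<Longrightarrow> i < j \<Longrightarrow> \<pi> i < \<pi> j"
proof (induction j)
  case (Suc j)
  then have s: "\<pi> j < \<pi> (Suc j)" unfolding Inc_def by auto
  show ?case
  proof (cases "i = j")
    case False
    then have "\<pi> i < \<pi> j" using Suc by auto
    then show ?thesis using s by simp
  qed (use s in simp)
qed simp

text \<open>An increasing map is injective on the positive indices, so columns of \<open>a\<close>
  are never merged and each exponent is moved unchanged.\<close>

lemma act_mono_divides_iff:
  assumes \<pi>: "\<pi> \<in> Inc"
  shows "m \<in> range ((+) (act_mono \<pi> (col_mono c a L))) \<longleftrightarrow>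
    (\<forall>i\<in>{1..c}. \<forall>j\<in>{1..L}. a i j \<le> lookup m (i, \<pi> j))"
proof -
  let ?m = "col_mono c a L"
  have kV: "keys ?m \<subseteq> {1..c} \<times> {1..L}" by (auto simp: in_keys_iff lookup_col_mono split: if_splits)
  have lk: "lookup (act_mono \<pi> ?m) (i, k)
      = (\<Sum>v\<in>keys ?m. if (fst v, \<pi> (snd v)) = (i, k) then lookup ?m v else 0)" for i k
    unfolding act_mono_def by (simp add: lookup_sum lookup_single when_def)
  have inj: "j = j'" if "\<pi> j = \<pi> j'" "1 \<le> j" "1 \<le> j'" for j j'
    using Inc_less[OF \<pi>, of j j'] Inc_less[OF \<pi>, of j' j] that by (cases j j' rule: linorder_cases) auto
  have at: "lookup (act_mono \<pi> ?m) (i, \<pi> j) = a i j" if ij: "i \<in> {1..c}" "j \<in> {1..L}" for i j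
  proof -
    have "(\<Sum>v\<in>keys ?m. if (fst v, \<pi> (snd v)) = (i, \<pi> j) then lookup ?m v else 0)
       = (\<Sum>v\<in>keys ?m. if v = (i, j) then lookup ?m v else 0)"
    proof (rule sum.cong[OF refl])
      fix v assume "v \<in> keys ?m"
      then have "v \<in> {1..c} \<times> {1..L}" using kV by blast
      then have "(fst v, \<pi> (snd v)) = (i, \<pi> j) \<longleftrightarrow> v = (i, j)"
        using inj[of "snd v" j] ij by (cases v) auto
      then show "(if (fst v, \<pi> (snd v)) = (i, \<pi> j) then lookup ?m v else 0) = (if v = (i, j) then lookup ?m v else 0)"
        by simp
    qed
    also have "\<dots> = lookup ?m (i, j)" by (simp add: sum.delta' in_keys_iff)
    also have "\<dots> = a i j" using ij by (simp add: lookup_col_mono)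
    finally show ?thesis using lk[of i "\<pi> j"] by simp
  qed
  show ?thesis
  proof
    assume "m \<in> range ((+) (act_mono \<pi> ?m))"
    then obtain w where "m = act_mono \<pi> ?m + w" by blast
    then show "\<forall>i\<in>{1..c}. \<forall>j\<in>{1..L}. a i j \<le> lookup m (i, \<pi> j)" using at by (auto simp: lookup_add)
  next
    assume R: "\<forall>i\<in>{1..c}. \<forall>j\<in>{1..L}. a i j \<le> lookup m (i, \<pi> j)"
    have "lookup (act_mono \<pi> ?m) v \<le> lookup m v" for v
    proof (cases "\<exists>i j. i \<in> {1..c} \<and> j \<in> {1..L} \<and> v = (i, \<pi> j)")
      case True
      then obtain i j where v: "i \<in> {1..c}" "j \<in> {1..L}" "v = (i, \<pi> j)" by blast
      then show ?thesis unfolding v(3) using R at[OF v(1,2)] by simp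
    next
      case False
      obtain i k where v: "v = (i, k)" by (cases v)
      have "lookup (act_mono \<pi> ?m) (i, k) = 0" unfolding lk
      proof (rule sum.neutral, rule ballI)
        fix w assume "w \<in> keys ?m"
        then have "w \<in> {1..c} \<times> {1..L}" using kV by blast
        then have "(fst w, \<pi> (snd w)) \<noteq> (i, k)" using False v by (cases w) auto
        then show "(if (fst w, \<pi> (snd w)) = (i, k) then lookup ?m w else 0) = 0" by (rule if_not_P)
      qed
      then show ?thesis unfolding v by simp
    qed
    from minus_mono_add[OF this] show "m \<in> range ((+) (act_mono \<pi> ?m))"
      by (intro range_eqI[of _ _ "m - act_mono \<pi> ?m"]) (rule sym)
  qed
qed

lemma shift_divides_imp_Inc:
  "shift_divides c a L n m \<Longrightarrow> \<exists>\<pi>\<in>Inc. (L = 0 \<or> \<pi> L \<le> n) \<and> (\<forall>i\<in>{1..c}. \<forall>j\<in>{1..L}. a i j \<le> lookup m (i, \<pi> j))"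
proof (induction c a L n m rule: shift_divides.induct)
  case (1 c a n m)
  show ?case by (rule bexI[of _ id]) (auto simp: Inc_def)
next
  case (3 c a L n m)
  show ?case
  proof (cases "shift_divides c a (Suc L) n m")
    case True
    from 3(1)[OF this] obtain \<pi> where \<pi>: "\<pi> \<in> Inc" "\<pi> (Suc L) \<le> n"
      "\<forall>i\<in>{1..c}. \<forall>j\<in>{1..Suc L}. a i j \<le> lookup m (i, \<pi> j)" by (metis Zero_not_Suc)
    then show ?thesis by (intro bexI[of _ \<pi>] conjI disjI2) simp_all
  next
    case False
    then have col: "\<forall>i\<in>{1..c}. a i (Suc L) \<le> lookup m (i, Suc n)" and "shift_divides c a L n m" using 3(3) by auto
    then obtain \<pi> where \<pi>: "\<pi> \<in> Inc" "L = 0 \<or> \<pi> L \<le> n"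
      "\<forall>i\<in>{1..c}. \<forall>j\<in>{1..L}. a i j \<le> lookup m (i, \<pi> j)" using 3(2) by auto
    \<comment> \<open>Beyond \<open>L\<close> the map continues with consecutive values from
      \<open>Suc n\<close> on, so it is increasing on all positive integers and sends
      \<open>Suc L\<close> to \<open>Suc n\<close>.\<close>
    define \<pi>' where "\<pi>' j = (if j \<le> L then \<pi> j else Suc n + (j - Suc L))" for j
    have "\<pi>' i \<ge> 1 \<and> \<pi>' i < \<pi>' (i + 1)" if i: "i \<ge> 1" for i
    proof -
      consider "i < L" | "i = L" | "i > L" by linarith
      then show ?thesis
      proof cases
        case 1
        then show ?thesis using \<pi>(1) i unfolding \<pi>'_def Inc_def by auto
      next
        case 2
        then have "\<pi> i \<ge> 1" "\<pi> i \<le> n" using \<pi>(1,2) i unfolding Inc_def by auto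
        then show ?thesis using 2 unfolding \<pi>'_def by auto
      next
        case 3
        then show ?thesis unfolding \<pi>'_def by auto
      qed
    qed
    then have "\<pi>' \<in> Inc" unfolding Inc_def by auto
    moreover have "\<pi>' (Suc L) \<le> Suc n" unfolding \<pi>'_def by simp
    moreover have "a i j \<le> lookup m (i, \<pi>' j)" if "i \<in> {1..c}" "j \<in> {1..Suc L}" for i j
    proof (cases "j = Suc L")
      case True
      then show ?thesis using col that unfolding \<pi>'_def by simp
    next
      case False
      then have "j \<in> {1..L}" using that by auto
      then show ?thesis using \<pi>(3) that unfolding \<pi>'_def by simp
    qed
    ultimately show ?thesis by blast
  qed
qed simp

lemma Inc_imp_shift_divides:
  assumes \<pi>: "\<pi> \<in> Inc"
  shows "L = 0 \<or> \<pi> L \<le> n \<Longrightarrow> \<forall>i\<in>{1..c}. \<forall>j\<in>{1..L}. a i j \<le> lookup m (i, \<pi> j) \<Longrightarrow> shift_divides c a L n m"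
proof (induction c a L n m rule: shift_divides.induct)
  case (2 c a L m)
  have "\<pi> (Suc L) \<ge> 1" using \<pi> unfolding Inc_def by auto
  then show ?case using 2 by simp
next
  case (3 c a L n m)
  show ?case
  proof (cases "\<pi> (Suc L) \<le> n")
    case True
    then have "shift_divides c a (Suc L) n m" using 3 by blast
    then show ?thesis by simp
  next
    case False
    \<comment> \<open>The last column is not placed within the first \<open>n\<close> columns, so it
      sits exactly in column \<open>Suc n\<close>, with all earlier ones to its left.\<close>
    then have e: "\<pi> (Suc L) = Suc n" using 3(3) by simp
    have "L = 0 \<or> \<pi> L \<le> n" using Inc_less[OF \<pi>, of L "Suc L"] e by (cases L) auto
    moreover have "\<forall>i\<in>{1..c}. \<forall>j\<in>{1..L}. a i j \<le> lookup m (i, \<pi> j)" using 3(4) by auto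
    ultimately have "shift_divides c a L n m" by (rule 3(2))
    moreover have "\<forall>i\<in>{1..c}. a i (Suc L) \<le> lookup m (i, Suc n)" using 3(4) e by (metis atLeastAtMost_iff le_refl le_simps(3) zero_less_Suc One_nat_def)
    ultimately show ?thesis by simp
  qed
qed simp

text \<open>Because column \<open>L\<close> is nonzero, a shifted monomial dividing a monomial of
  \<open>K[X_n]\<close> has its last column placed among the first \<open>n\<close> columns. So the
  bound by \<open>n\<close> in \<open>shift_divides\<close> is automatic for the truncation.\<close>

theorem orbit_ideal_Int:
  assumes L: "L \<ge> 1" and col: "\<exists>i\<in>{1..c}. a i L \<noteq> 0"
  shows "orbit_ideal c (\<Prod>i=1..c. \<Prod>j=1..L. xvar i j ^ a i j) \<inter> carrier (KXn c n)
    = (monomial_ideal ({1..c} \<times> {1..n}) {m. shift_divides c a L n m} :: 'k::field mpol set)"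
proof -
  let ?VX = "{1..c} \<times> {1..} :: (nat \<times> nat) set" and ?V = "{1..c} \<times> {1..n}"
  let ?G = "(\<lambda>\<pi>. act_mono \<pi> (col_mono c a L)) ` Inc"
  have kG: "keys u \<subseteq> ?VX" if u: "u \<in> ?G" for u
  proof -
    from u obtain \<pi> where \<pi>: "\<pi> \<in> Inc" "u = act_mono \<pi> (col_mono c a L)" by auto
    have "keys (col_mono c a L) \<subseteq> {1..c} \<times> {1..L}" by (auto simp: in_keys_iff lookup_col_mono split: if_splits)
    then have "(fst v, \<pi> (snd v)) \<in> ?VX" if "v \<in> keys (col_mono c a L)" for v
      using that \<pi>(1) unfolding Inc_def by fastforce
    then have "keys (Poly_Mapping.single (fst v, \<pi> (snd v)) (lookup (col_mono c a L) v)) \<subseteq> ?VX"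
      if "v \<in> keys (col_mono c a L)" for v using that keys_single_subset by fast
    then show ?thesis unfolding \<pi>(2) act_mono_def using keys_sum_subset by fast
  qed
  have "orbit_ideal c (\<Prod>i=1..c. \<Prod>j=1..L. xvar i j ^ a i j)
     = genideal (poly_ring ?VX) ((mon :: mono \<Rightarrow> 'k mpol) ` ?G)"
    unfolding orbit_ideal_def KX_def prod_xvar_eq inc_act_mon image_image ..
  also have "\<dots> = monomial_ideal ?VX (\<Union>u\<in>?G. range ((+) u))" by (rule genideal_monomials[OF kG])
  finally have O: "orbit_ideal c (\<Prod>i=1..c. \<Prod>j=1..L. xvar i j ^ a i j)
     = (monomial_ideal ?VX (\<Union>u\<in>?G. range ((+) u)) :: 'k mpol set)" .
  have iff: "m \<in> (\<Union>u\<in>?G. range ((+) u)) \<longleftrightarrow> shift_divides c a L n m" if m: "keys m \<subseteq> ?V" for m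
  proof
    assume "m \<in> (\<Union>u\<in>?G. range ((+) u))"
    then obtain \<pi> where \<pi>: "\<pi> \<in> Inc" "m \<in> range ((+) (act_mono \<pi> (col_mono c a L)))" by blast
    then have d: "\<forall>i\<in>{1..c}. \<forall>j\<in>{1..L}. a i j \<le> lookup m (i, \<pi> j)"
      using act_mono_divides_iff[OF \<pi>(1)] by simp
    obtain i where i: "i \<in> {1..c}" "a i L \<noteq> 0" using col by blast
    have "a i L \<le> lookup m (i, \<pi> L)" using d i(1) L by auto
    then have "(i, \<pi> L) \<in> keys m" using i(2) by (simp add: in_keys_iff)
    then have "\<pi> L \<le> n" using m by auto
    then show "shift_divides c a L n m" using Inc_imp_shift_divides[OF \<pi>(1) _ d] by blast
  next
    assume "shift_divides c a L n m"
    then obtain \<pi> where \<pi>: "\<pi> \<in> Inc" "\<forall>i\<in>{1..c}. \<forall>j\<in>{1..L}. a i j \<le> lookup m (i, \<pi> j)"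
      using shift_divides_imp_Inc by blast
    then have "m \<in> range ((+) (act_mono \<pi> (col_mono c a L)))" using act_mono_divides_iff[OF \<pi>(1)] by simp
    then show "m \<in> (\<Union>u\<in>?G. range ((+) u))" using \<pi>(1) by blast
  qed
  have VV: "?V \<subseteq> ?VX" by auto
  have C: "carrier (KXn c n) = (polys ?V :: 'k mpol set)" unfolding KXn_def by simp
  show ?thesis unfolding O C
  proof (intro equalityI subsetI)
    fix p :: "'k mpol" assume p: "p \<in> monomial_ideal ?VX (\<Union>u\<in>?G. range ((+) u)) \<inter> polys ?V"
    then have "shift_divides c a L n m" if "m \<in> keys p" for m using iff[of m] that unfolding monomial_ideal_def polys_def by blast
    then show "p \<in> monomial_ideal ?V {m. shift_divides c a L n m}" using p unfolding monomial_ideal_def by blast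
  next
    fix p :: "'k mpol" assume p: "p \<in> monomial_ideal ?V {m. shift_divides c a L n m}"
    then have k: "keys m \<subseteq> ?V" "shift_divides c a L n m" if "m \<in> keys p" for m using that unfolding monomial_ideal_def polys_def by blast+
    have "m \<in> (\<Union>u\<in>?G. range ((+) u))" if "m \<in> keys p" for m
      by (rule iffD2[OF iff[OF k(1)[OF that]] k(2)[OF that]])
    then have "keys p \<subseteq> (\<Union>u\<in>?G. range ((+) u))" by (rule subsetI)
    moreover have "p \<in> polys ?VX" unfolding polys_def using k(1) VV by blast
    moreover have "p \<in> polys ?V" using p unfolding monomial_ideal_def by simp
    ultimately show "p \<in> monomial_ideal ?VX (\<Union>u\<in>?G. range ((+) u)) \<inter> polys ?V"
      unfolding monomial_ideal_def by (intro IntI CollectI conjI)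
  qed
qed

section \<open>Hilbert series\<close>

lemma lookup_combine_monomials:
  fixes cs :: "'k::field list"
  assumes "distinct ms" "length cs = length ms"
  shows "ring.combine (poly_ring V) (map cst cs) (map mon ms) =
    (\<Sum>i<length ms. Poly_Mapping.single (ms ! i) (cs ! i))"
proof -
  interpret R: cring "poly_ring V :: 'k mpol ring" by (rule cring_poly_ring)
  show ?thesis using assms
  proof (induction ms arbitrary: cs)
    case Nil
    then show ?case by simp
  next
    case (Cons m ms)
    then obtain c cs' where cs: "cs = c # cs'" "length cs' = length ms" by (cases cs) auto
    have "R.combine (map cst cs) (map mon (m # ms)) = Poly_Mapping.single m c + R.combine (map cst cs') (map mon ms)"
      unfolding cs by (simp add: mult_single)
    also have "\<dots> = (\<Sum>i<length (m # ms). Poly_Mapping.single ((m # ms) ! i) (cs ! i))"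
      using Cons.IH[of cs'] Cons.prems cs by (simp add: sum.lessThan_Suc_shift del: sum.lessThan_Suc)
    finally show ?case .
  qed
qed

definition standard_monos :: "(nat \<times> nat) set \<Rightarrow> mono set \<Rightarrow> nat \<Rightarrow> mono set" where
  "standard_monos V U j = {m. keys m \<subseteq> V \<and> mono_degree m = j \<and> m \<notin> U}"

lemma mono_degree_sum: "finite A \<Longrightarrow> keys m \<subseteq> A \<Longrightarrow> mono_degree m = (\<Sum>v\<in>A. lookup m v)"
  unfolding mono_degree_def by (rule sum.mono_neutral_left) (auto simp: in_keys_iff)

lemma mono_degree_add: "mono_degree (m + m') = mono_degree m + mono_degree m'"
proof -
  let ?A = "keys m \<union> keys m'"
  have "mono_degree (m + m') = (\<Sum>v\<in>?A. lookup (m + m') v)" by (rule mono_degree_sum) (auto simp: keys_mono_add)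
  also have "\<dots> = (\<Sum>v\<in>?A. lookup m v) + (\<Sum>v\<in>?A. lookup m' v)" by (simp add: lookup_add sum.distrib)
  also have "\<dots> = mono_degree m + mono_degree m'" by (simp add: mono_degree_sum[of ?A])
  finally show ?thesis .
qed

lemma finite_standard_monos:
  assumes "finite V" shows "finite (standard_monos V U j)"
proof (rule finite_subset[OF subsetI card_bounded_monomials(1)[OF assms, of j]])
  fix m assume m: "m \<in> standard_monos V U j"
  have "lookup m v \<le> j" for v
  proof (cases "v \<in> keys m")
    case True
    then have "lookup m v \<le> mono_degree m" unfolding mono_degree_def by (intro member_le_sum) auto
    then show ?thesis using m unfolding standard_monos_def by simp
  qed (simp add: in_keys_iff)
  then show "m \<in> {m. keys m \<subseteq> V \<and> (\<forall>v. lookup m v \<le> j)}" using m unfolding standard_monos_def by simp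
qed

text \<open>The standard monomials of degree \<open>j\<close> represent a basis: a combination of
  them in the ideal would have its monomials in \<open>U\<close>, and subtracting the standard part
  of a form leaves an element of the ideal. As \<open>0 \<notin> U\<close>, the quotient is not the
  zero ring and the constants map onto a subfield.\<close>

theorem graded_dim_monomial_ideal:
  assumes U: "up_closed U" and U0: "0 \<notin> U"
  shows "graded_dim c n (monomial_ideal ({1..c} \<times> {1..n}) U :: 'k::field mpol set) j
    = card (standard_monos ({1..c} \<times> {1..n}) U j)"
proof -
  define V where "V = {1..c} \<times> {1..n}"
  have finV: "finite V" unfolding V_def by simp
  let ?R = "poly_ring V :: 'k mpol ring"
  let ?I = "monomial_ideal V U :: 'k mpol set"
  let ?Q = "?R Quot ?I"
  let ?h = "\<lambda>x. ?I +>\<^bsub>?R\<^esub> x"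
  interpret R: cring ?R by (rule cring_poly_ring)
  have II: "polys.is_ideal V ?I" by (rule is_ideal_monomial_ideal[OF U])
  then have Iid: "ideal ?I ?R" unfolding ideal_poly_ring_iff .
  interpret I: ideal ?I ?R by (rule Iid)
  interpret Q: cring ?Q by (rule I.quotient_is_cring[OF R.is_cring])
  have hom: "ring_hom_ring ?R ?Q ?h" by (rule I.rcos_ring_hom_ring)
  have hcl: "?h x \<in> carrier ?Q" if "x \<in> polys V" for x
    using ring_hom_closed[OF I.rcos_ring_hom] that by simp
  have h0: "?h x = \<zero>\<^bsub>?Q\<^esub> \<longleftrightarrow> x \<in> ?I" if "x \<in> polys V" for x
    using I.rcos_const_imp_mem[of x] R.a_rcos_zero[OF Iid, of x] that unfolding zero_FactRing by auto
  have hdiff: "?h x = ?h y" if "x \<in> polys V" "y \<in> polys V" "x - y \<in> ?I" for x y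
  proof -
    have "?h x = ?h ((x - y) + y)" by simp
    also have "\<dots> = ?h (x - y) \<oplus>\<^bsub>?Q\<^esub> ?h y"
      using ring_hom_add[OF I.rcos_ring_hom, of "x - y" y] that by simp
    also have "\<dots> = ?h y" using h0[of "x - y"] that hcl[of y] by simp
    finally show ?thesis .
  qed
  have one: "\<one>\<^bsub>?Q\<^esub> \<noteq> \<zero>\<^bsub>?Q\<^esub>"
  proof
    assume "\<one>\<^bsub>?Q\<^esub> = \<zero>\<^bsub>?Q\<^esub>"
    then have "?h 1 = \<zero>\<^bsub>?Q\<^esub>" using ring_hom_one[OF I.rcos_ring_hom] by simp
    then have "1 \<in> ?I" using h0[of 1] by simp
    then show False using U0 unfolding monomial_ideal_def by simp
  qed
  let ?K = "?h ` range cst"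
  have K: "subfield ?K ?Q" by (rule ring_hom_ring.img_is_subfield(2)[OF hom subfield_constants one])
  obtain ms where ms: "set ms = standard_monos V U j" "distinct ms"
    using finite_distinct_list[OF finite_standard_monos[OF finV, of U j]] by auto
  have msV: "keys m \<subseteq> V" "mono_degree m = j" "m \<notin> U" if "m \<in> set ms" for m
    using that unfolding ms(1) standard_monos_def by auto
  let ?Us = "map (\<lambda>m. ?h (mon m)) ms"
  have Usc: "set ?Us \<subseteq> carrier ?Q" using hcl msV(1) by auto
  let ?p = "\<lambda>cs. \<Sum>i<length ms. Poly_Mapping.single (ms ! i) (cs ! i) :: 'k mpol"
  have pV: "?p cs \<in> polys V" for cs
    by (intro polys.sum_C single_in_polys msV(1)) auto
  have comb: "Q.combine (map (\<lambda>c. ?h (cst c)) cs) ?Us = ?h (?p cs)" if "length cs = length ms" for cs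
  proof -
    have "Q.combine (map ?h (map cst cs)) (map ?h (map mon ms)) = ?h (R.combine (map cst cs) (map mon ms))"
      by (rule ring_hom_ring.combine_hom[OF hom]) (use msV(1) in auto)
    then show ?thesis unfolding lookup_combine_monomials[OF ms(2) that] by (simp add: comp_def)
  qed
  have lookup_p: "lookup (?p cs) (ms ! i) = cs ! i" if "i < length ms" for cs i
  proof -
    have "lookup (?p cs) (ms ! i) = (\<Sum>k<length ms. if k = i then cs ! k else 0)"
      unfolding lookup_sum lookup_single when_def
      by (rule sum.cong[OF refl]) (use ms(2) that in \<open>auto simp: nth_eq_iff_index_eq\<close>)
    then show ?thesis using that by simp
  qed
  have lookup_p': "lookup (?p cs) m = 0" if "m \<notin> set ms" for cs m
    unfolding lookup_sum lookup_single when_def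
    by (rule sum.neutral) (use that in \<open>auto simp: in_set_conv_nth\<close>)
  have exK: "\<exists>cs. Ks = map (\<lambda>c. ?h (cst c)) cs" if "set Ks \<subseteq> ?K" for Ks
  proof -
    have "\<forall>y\<in>set Ks. \<exists>c. y = ?h (cst c)" using that by blast
    then show ?thesis unfolding ex_map_conv[symmetric] .
  qed
  have ind: "Q.independent ?K ?Us"
  proof (rule Q.trivial_combine_imp_independent[OF K Usc])
    fix Ks assume Ks: "set Ks \<subseteq> ?K" "Q.combine Ks ?Us = \<zero>\<^bsub>?Q\<^esub>"
    have Kc: "set Ks \<subseteq> carrier ?Q" using Ks(1) subfieldE(3)[OF K] by blast
    \<comment> \<open>The coefficient list may have any length, so it is first brought to the length
      of the basis.\<close>
    obtain Ks' where Ks': "set (take (length ?Us) Ks) \<subseteq> set Ks'"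
      "set Ks' \<subseteq> set (take (length ?Us) Ks) \<union> {\<zero>\<^bsub>?Q\<^esub>}"
      "length Ks' = length ?Us" "Q.combine Ks' ?Us = \<zero>\<^bsub>?Q\<^esub>"
      by (rule Q.combine_normalize[OF Kc Usc Ks(2)])
    have "\<zero>\<^bsub>?Q\<^esub> \<in> ?K" using subringE(2)[OF subfieldE(1)[OF K]] .
    then have "set Ks' \<subseteq> ?K" using Ks'(2) Ks(1) set_take_subset[of "length ?Us" Ks] by blast
    then obtain cs where cs: "Ks' = map (\<lambda>c. ?h (cst c)) cs" using exK by blast
    have len: "length cs = length ms" using Ks'(3) cs by simp
    have "?h (?p cs) = \<zero>\<^bsub>?Q\<^esub>" using Ks'(4) comb[OF len] cs by simp
    then have pI: "?p cs \<in> ?I" using h0[OF pV] by simp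
    have "cs ! i = 0" if "i < length ms" for i
    proof (rule ccontr)
      assume "cs ! i \<noteq> 0"
      then have "ms ! i \<in> keys (?p cs)" using lookup_p[OF that] by (simp add: in_keys_iff)
      then have "ms ! i \<in> U" using pI unfolding monomial_ideal_def by auto
      then show False using msV(3) that by simp
    qed
    then have z: "c = 0" if "c \<in> set cs" for c using that len by (metis in_set_conv_nth)
    have c0: "?h (cst 0) = \<zero>\<^bsub>?Q\<^esub>" using h0[of 0] polys.is_idealD(2)[OF II] by simp
    have "y = \<zero>\<^bsub>?Q\<^esub>" if "y \<in> set Ks'" for y
    proof -
      obtain c where "c \<in> set cs" "y = ?h (cst c)" using \<open>y \<in> set Ks'\<close> unfolding cs set_map by blast
      then show ?thesis using z[of c] c0 by (simp only:)
    qed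
    then have "set Ks' \<subseteq> {\<zero>\<^bsub>?Q\<^esub>}" by blast
    then show "set (take (length ?Us) Ks) \<subseteq> {\<zero>\<^bsub>?Q\<^esub>}" using Ks'(1) by blast
  qed
  have span: "Q.Span ?K ?Us = ?h ` forms c n j"
  proof (intro equalityI subsetI)
    fix x assume "x \<in> Q.Span ?K ?Us"
    then obtain Ks where Ks: "set Ks \<subseteq> ?K" "length Ks = length ?Us" "x = Q.combine Ks ?Us"
      using Q.Span_mem_iff_length_version[OF K Usc] by blast
    obtain cs where cs: "Ks = map (\<lambda>c. ?h (cst c)) cs" using exK[OF Ks(1)] by blast
    have len: "length cs = length ms" using Ks(2) cs by simp
    have "m \<in> set ms" if "m \<in> keys (?p cs)" for m
      using lookup_p'[of m cs] that by (auto simp: in_keys_iff)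
    then have "?p cs \<in> forms c n j" unfolding forms_def KXn_def V_def[symmetric] using pV msV(2) by simp
    then show "x \<in> ?h ` forms c n j" using Ks(3) comb[OF len] cs by blast
  next
    fix x assume "x \<in> ?h ` forms c n j"
    then obtain p where p: "p \<in> polys V" "\<And>m. m \<in> keys p \<Longrightarrow> mono_degree m = j" "x = ?h p"
      unfolding forms_def KXn_def V_def[symmetric] by auto
    define cs where "cs = map (lookup p) ms"
    have len: "length cs = length ms" unfolding cs_def by simp
    have "p - ?p cs \<in> ?I" unfolding monomial_ideal_def
    proof (intro CollectI conjI subsetI)
      show "p - ?p cs \<in> polys V" by (rule polys.diff_C[OF p(1) pV])
      fix m assume m: "m \<in> keys (p - ?p cs)"
      have "m \<notin> set ms"
      proof
        assume "m \<in> set ms"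
        then obtain i where i: "i < length ms" "m = ms ! i" by (metis in_set_conv_nth)
        have "lookup (p - ?p cs) m = 0" using lookup_p[OF i(1), of cs] i unfolding lookup_minus cs_def by simp
        then show False using m by (simp add: in_keys_iff)
      qed
      moreover from this have mp: "m \<in> keys p" using m lookup_p'[of m cs] by (simp add: in_keys_iff lookup_minus)
      moreover have "keys m \<subseteq> V" using mp p(1) unfolding polys_def by blast
      ultimately show "m \<in> U" using p(2)[OF mp] unfolding ms(1) standard_monos_def by simp
    qed
    then have "x = ?h (?p cs)" unfolding p(3) by (rule hdiff[OF p(1) pV])
    then have "x = Q.combine (map (\<lambda>c. ?h (cst c)) cs) ?Us" using comb[OF len] by simp
    moreover have "set (map (\<lambda>c. ?h (cst c)) cs) \<subseteq> ?K" by auto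
    moreover have "length (map (\<lambda>c. ?h (cst c)) cs) = length ?Us" using len by simp
    ultimately show "x \<in> Q.Span ?K ?Us" using Q.Span_mem_iff_length_version[OF K Usc] by blast
  qed
  have "Q.dim ?K (?h ` forms c n j) = length ?Us"
    using Q.dimI[OF K Q.dimensionI[OF K ind span]] unfolding over_def .
  moreover have "length ?Us = card (standard_monos V U j)"
    using ms distinct_card[of ms] by simp
  moreover have "(\<lambda>c. ?h (const_poly c)) ` UNIV = ?K" unfolding const_poly_def by (simp add: image_image)
  ultimately show ?thesis unfolding graded_dim_def KXn_def V_def[symmetric] by simp
qed

section \<open>Counting series of sets of monomials\<close>

definition counting_series :: "mono set \<Rightarrow> rat fps" where
  "counting_series A = Abs_fps (\<lambda>j. of_nat (card {m\<in>A. mono_degree m = j}))"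

definition all_monos :: "(nat \<times> nat) set \<Rightarrow> mono set" where
  "all_monos V = {m. keys m \<subseteq> V}"

definition mono_sums :: "mono set \<Rightarrow> mono set \<Rightarrow> mono set" where
  "mono_sums A B = (\<lambda>(s, t). s + t) ` (A \<times> B)"

lemma mono_sums_iff: "m \<in> mono_sums A B \<longleftrightarrow> (\<exists>s\<in>A. \<exists>t\<in>B. m = s + t)"
  unfolding mono_sums_def by auto

lemma finite_monos_degree: "finite V \<Longrightarrow> A \<subseteq> all_monos V \<Longrightarrow> finite {m\<in>A. mono_degree m = j}"
  by (rule finite_subset[OF _ finite_standard_monos[of V "{}" j]]) (auto simp: standard_monos_def all_monos_def)

lemma counting_series_Un:
  assumes "finite V" "A \<subseteq> all_monos V" "B \<subseteq> all_monos V" "A \<inter> B = {}"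
  shows "counting_series (A \<union> B) = counting_series A + counting_series B"
proof (rule fps_ext)
  fix j
  have "{m\<in>A \<union> B. mono_degree m = j} = {m\<in>A. mono_degree m = j} \<union> {m\<in>B. mono_degree m = j}" by auto
  moreover have "card ({m\<in>A. mono_degree m = j} \<union> {m\<in>B. mono_degree m = j})
     = card {m\<in>A. mono_degree m = j} + card {m\<in>B. mono_degree m = j}"
    by (rule card_Un_disjoint) (use assms finite_monos_degree in auto)
  ultimately show "fps_nth (counting_series (A \<union> B)) j = fps_nth (counting_series A + counting_series B) j" unfolding counting_series_def by simp
qed

lemma inj_on_mono_sums:
  assumes "A \<subseteq> all_monos V" "B \<subseteq> all_monos W" "V \<inter> W = {}"
  shows "inj_on (\<lambda>(s, t). s + t) (A \<times> B)"
proof (rule inj_onI, clarify)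
  fix s t s' t' assume *: "s \<in> A" "t \<in> B" "s' \<in> A" "t' \<in> B" "s + t = s' + t'"
  have eq: "lookup s v + lookup t v = lookup s' v + lookup t' v" for v
    using arg_cong[OF *(5), of "\<lambda>m. lookup m v"] by (simp add: lookup_add)
  have A: "lookup s v = 0 \<and> lookup s' v = 0" if "v \<notin> V" for v
  proof -
    have "v \<notin> keys s" "v \<notin> keys s'" using * assms(1) that unfolding all_monos_def by blast+
    then show ?thesis by (simp add: in_keys_iff)
  qed
  have B: "lookup t v = 0 \<and> lookup t' v = 0" if "v \<notin> W" for v
  proof -
    have "v \<notin> keys t" "v \<notin> keys t'" using * assms(2) that unfolding all_monos_def by blast+
    then show ?thesis by (simp add: in_keys_iff)
  qed
  have "lookup s v = lookup s' v \<and> lookup t v = lookup t' v" for v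
    using eq[of v] A[of v] B[of v] assms(3) by (cases "v \<in> V"; cases "v \<in> W") auto
  then show "s = s' \<and> t = t'" by (auto intro: poly_mapping_eqI)
qed

text \<open>With disjoint sets of variables the factorization of a monomial is unique, so the counts
  form a Cauchy product.\<close>

lemma counting_series_mono_sums:
  assumes fin: "finite V" "finite W" and A: "A \<subseteq> all_monos V" and B: "B \<subseteq> all_monos W" and disj: "V \<inter> W = {}"
  shows "counting_series (mono_sums A B) = counting_series A * counting_series B"
proof (rule fps_ext)
  fix n
  let ?A = "\<lambda>i. {m\<in>A. mono_degree m = i}" and ?B = "\<lambda>i. {m\<in>B. mono_degree m = i}"
  have eq: "{m\<in>mono_sums A B. mono_degree m = n} = (\<lambda>(s, t). s + t) ` (\<Union>i\<in>{0..n}. ?A i \<times> ?B (n - i))"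
    unfolding mono_sums_def
  proof (intro equalityI subsetI)
    fix m assume "m \<in> {m \<in> (\<lambda>(s, t). s + t) ` (A \<times> B). mono_degree m = n}"
    then obtain s t where st: "s \<in> A" "t \<in> B" "m = s + t" "mono_degree s + mono_degree t = n"
      by (auto simp: mono_degree_add)
    then have "(s, t) \<in> (\<Union>i\<in>{0..n}. ?A i \<times> ?B (n - i))" by (intro UN_I[of "mono_degree s"]) auto
    then show "m \<in> (\<lambda>(s, t). s + t) ` (\<Union>i\<in>{0..n}. ?A i \<times> ?B (n - i))" using st(3) by (intro image_eqI[of _ _ "(s, t)"]) auto
  qed (auto simp: mono_degree_add)
  have "(\<Union>i\<in>{0..n}. ?A i \<times> ?B (n - i)) \<subseteq> A \<times> B" by auto
  then have "card {m\<in>mono_sums A B. mono_degree m = n} = card (\<Union>i\<in>{0..n}. ?A i \<times> ?B (n - i))"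
    unfolding eq by (intro card_image inj_on_subset[OF inj_on_mono_sums[OF A B disj]])
  also have "\<dots> = (\<Sum>i\<in>{0..n}. card (?A i \<times> ?B (n - i)))"
    by (rule card_UN_disjoint)
       (use finite_monos_degree[OF fin(1) A] finite_monos_degree[OF fin(2) B] in auto)
  finally show "fps_nth (counting_series (mono_sums A B)) n = fps_nth (counting_series A * counting_series B) n"
    unfolding counting_series_def fps_mult_nth by (simp add: card_cartesian_product)
qed

lemma counting_series_shift:
  shows "counting_series ((+) u ` A) = fps_X ^ mono_degree u * counting_series A"
proof (rule fps_ext)
  fix n
  show "fps_nth (counting_series ((+) u ` A)) n = fps_nth (fps_X ^ mono_degree u * counting_series A) n"
  proof (cases "n < mono_degree u")
    case True
    then have empty: "{m\<in>(+) u ` A. mono_degree m = n} = {}" by (auto simp: mono_degree_add)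
    have "card {m\<in>(+) u ` A. mono_degree m = n} = 0" unfolding empty by simp
    then show ?thesis using True unfolding counting_series_def by (simp add: fps_X_power_mult_nth)
  next
    case False
    then have "{m\<in>(+) u ` A. mono_degree m = n} = (+) u ` {m\<in>A. mono_degree m = n - mono_degree u}"
      by (auto simp: mono_degree_add)
    moreover have "card ((+) u ` {m\<in>A. mono_degree m = n - mono_degree u}) = card {m\<in>A. mono_degree m = n - mono_degree u}"
      by (rule card_image) (simp add: inj_on_def)
    ultimately show ?thesis using False unfolding counting_series_def by (simp add: fps_X_power_mult_nth)
  qed
qed

lemma all_monos_Un: "V \<inter> W = {} \<Longrightarrow> all_monos (V \<union> W) = mono_sums (all_monos V) (all_monos W)"
proof (intro equalityI subsetI)
  fix m assume m: "m \<in> all_monos (V \<union> W)" and disj: "V \<inter> W = {}"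
  let ?s = "\<lambda>A. \<Sum>v\<in>keys m \<inter> A. Poly_Mapping.single v (lookup m v)"
  have k: "keys (?s A) \<subseteq> A" for A
    by (rule subset_trans[OF keys_sum_subset]) (use keys_single_subset in fast)
  have "keys m = (keys m \<inter> V) \<union> (keys m \<inter> W)" using m unfolding all_monos_def by auto
  then have "(\<Sum>v\<in>keys m. Poly_Mapping.single v (lookup m v)) = ?s V + ?s W"
    using sum.union_disjoint[of "keys m \<inter> V" "keys m \<inter> W" "\<lambda>v. Poly_Mapping.single v (lookup m v)"] disj
    by auto
  then have "m = ?s V + ?s W" unfolding poly_sum_monomials[symmetric] .
  then show "m \<in> mono_sums (all_monos V) (all_monos W)" unfolding mono_sums_def all_monos_def
    by (intro image_eqI[of _ _ "(?s V, ?s W)"]) (use k in auto)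
qed (auto simp: mono_sums_def all_monos_def keys_mono_add)

text \<open>The series is \<open>1 / (1 - fps_X) ^ card V\<close>, written as a product to avoid
  division of power series; each variable contributes a geometric series.\<close>

lemma counting_series_all_monos: "finite V \<Longrightarrow> counting_series (all_monos V) * (1 - fps_X) ^ card V = 1"
proof (induction V rule: finite_induct)
  case empty
  have "counting_series (all_monos {}) = 1"
  proof (rule fps_ext)
    fix n
    have "{m \<in> all_monos {}. mono_degree m = n} = (if n = 0 then {0} else {})"
      unfolding all_monos_def by (auto simp: mono_degree_def)
    then show "fps_nth (counting_series (all_monos {})) n = fps_nth 1 n" unfolding counting_series_def by simp
  qed
  then show ?case by simp
next
  case (insert v V)
  have v: "counting_series (all_monos {v}) * (1 - fps_X) = 1"
  proof -
    have "{m \<in> all_monos {v}. mono_degree m = n} = {Poly_Mapping.single v n}" for n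
    proof (intro equalityI subsetI)
      fix m assume m: "m \<in> {m \<in> all_monos {v}. mono_degree m = n}"
      then have k: "keys m \<subseteq> {v}" unfolding all_monos_def by auto
      have "mono_degree m = lookup m v" using mono_degree_sum[of "{v}" m] k by simp
      moreover have "m = Poly_Mapping.single v (lookup m v)"
        by (rule poly_mapping_eqI) (use k in \<open>auto simp: lookup_single when_def in_keys_iff subset_iff\<close>)
      ultimately show "m \<in> {Poly_Mapping.single v n}" using m by simp
    next
      fix m assume "m \<in> {Poly_Mapping.single v n}"
      moreover have "mono_degree (Poly_Mapping.single v n) = n"
        using mono_degree_sum[of "{v}" "Poly_Mapping.single v n"] keys_single_subset[of v n] by simp
      ultimately show "m \<in> {m \<in> all_monos {v}. mono_degree m = n}"
        unfolding all_monos_def using keys_single_subset[of v n] by auto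
    qed
    then have "counting_series (all_monos {v}) = Abs_fps (\<lambda>n. 1)" unfolding counting_series_def by simp
    moreover have "Abs_fps (\<lambda>n. 1) * (1 - fps_X) = (1 :: rat fps)"
      by (rule fps_ext) (simp add: right_diff_distrib fps_X_mult_right_nth)
    ultimately show ?thesis by simp
  qed
  have "all_monos (insert v V) = mono_sums (all_monos {v}) (all_monos V)" using all_monos_Un[of "{v}" V] insert.hyps by simp
  then have "counting_series (all_monos (insert v V)) = counting_series (all_monos {v}) * counting_series (all_monos V)"
    using counting_series_mono_sums[of "{v}" V "all_monos {v}" "all_monos V"] insert.hyps by simp
  then have "counting_series (all_monos (insert v V)) * (1 - fps_X) ^ card (insert v V)
    = (counting_series (all_monos {v}) * (1 - fps_X)) * (counting_series (all_monos V) * (1 - fps_X) ^ card V)"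
    using insert.hyps by (simp add: mult_ac)
  then show ?case using v insert.IH by simp
qed

definition shift_free :: "nat \<Rightarrow> (nat \<Rightarrow> nat \<Rightarrow> nat) \<Rightarrow> nat \<Rightarrow> nat \<Rightarrow> mono set" where
  "shift_free c a L n = {m \<in> all_monos ({1..c} \<times> {1..n}). \<not> shift_divides c a L n m}"

text \<open>The possible last columns divisible by \<open>u\<close> have the series
  \<open>fps_X ^ b / (1 - fps_X) ^ c\<close>, with \<open>b\<close> the degree of \<open>u\<close>,
  and the other ones \<open>(1 - fps_X ^ b) / (1 - fps_X) ^ c\<close>; the identity is multiplied by
  \<open>(1 - fps_X) ^ c\<close>.\<close>

lemma counting_series_shift_free_Suc:
  "counting_series (shift_free c a (Suc L) (Suc n)) * (1 - fps_X) ^ c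
    = (1 - fps_X ^ (\<Sum>i=1..c. a i (Suc L))) * counting_series (shift_free c a (Suc L) n)
      + fps_X ^ (\<Sum>i=1..c. a i (Suc L)) * counting_series (shift_free c a L n)"
proof -
  define col where "col = {1..c} \<times> {Suc n}"
  define V where "V = {1..c} \<times> {1..n}"
  have finc: "finite col" and finV: "finite V" unfolding col_def V_def by auto
  define u :: mono where "u = (\<Sum>v\<in>col. Poly_Mapping.single v (a (fst v) (Suc L)))"
  let ?C = "all_monos col"
  let ?D = "(+) u ` ?C"
  have lu: "lookup u v = (if v \<in> col then a (fst v) (Suc L) else 0)" for v
    unfolding u_def using finc by (simp add: lookup_sum lookup_single when_def sum.delta)
  have ku: "keys u \<subseteq> col" using lu by (auto simp: in_keys_iff split: if_splits)
  have degu: "mono_degree u = (\<Sum>i=1..c. a i (Suc L))"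
  proof -
    have "mono_degree u = (\<Sum>v\<in>col. lookup u v)" by (rule mono_degree_sum) (use ku finc in auto)
    also have "\<dots> = (\<Sum>i\<in>{1..c}. a i (Suc L))"
      by (rule sum.reindex_bij_witness[of _ "\<lambda>i. (i, Suc n)" fst]) (auto simp: lu col_def)
    finally show ?thesis .
  qed
  have DC: "?D \<subseteq> ?C" using ku unfolding all_monos_def by (auto simp: keys_mono_add)
  have Dmem: "s \<in> ?D \<longleftrightarrow> (\<forall>i\<in>{1..c}. a i (Suc L) \<le> lookup s (i, Suc n))" if s: "s \<in> ?C" for s
  proof
    assume "s \<in> ?D"
    then show "\<forall>i\<in>{1..c}. a i (Suc L) \<le> lookup s (i, Suc n)" by (auto simp: lookup_add lu col_def)
  next
    assume le: "\<forall>i\<in>{1..c}. a i (Suc L) \<le> lookup s (i, Suc n)"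
    have "lookup u v \<le> lookup s v" for v using le unfolding lu col_def by auto
    then have eq: "u + (s - u) = s" by (rule minus_mono_add)
    have "keys (s - u) \<subseteq> col" using s keys_mono_add[of u "s - u"] unfolding eq all_monos_def by auto
    then show "s \<in> ?D" using eq unfolding all_monos_def by (intro image_eqI[of _ _ "s - u"]) auto
  qed
  have disj: "col \<inter> V = {}" unfolding col_def V_def by auto
  have colV: "{1..c} \<times> {1..Suc n} = col \<union> V" unfolding col_def V_def by auto
  have shift_divides_st: "shift_divides c a l n (s + t) = shift_divides c a l n t" if "s \<in> ?C" for s t l
  proof (rule shift_divides_cong)
    fix i j assume "j \<in> {1..n}"
    then have "(i, j) \<notin> keys s" using that unfolding all_monos_def col_def by auto
    then show "lookup (s + t) (i, j) = lookup t (i, j)" by (simp add: lookup_add in_keys_iff)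
  qed
  have lst: "lookup (s + t) (i, Suc n) = lookup s (i, Suc n)" if "t \<in> all_monos V" for s t i
  proof -
    have "(i, Suc n) \<notin> keys t" using that unfolding all_monos_def V_def by auto
    then show ?thesis by (simp add: lookup_add in_keys_iff)
  qed
  have shift_divides_iff: "shift_divides c a (Suc L) (Suc n) (s + t) \<longleftrightarrow> shift_divides c a (Suc L) n t \<or> (s \<in> ?D \<and> shift_divides c a L n t)"
    if "s \<in> ?C" "t \<in> all_monos V" for s t
    unfolding shift_divides.simps shift_divides_st[OF that(1)] lst[OF that(2)] Dmem[OF that(1)] by blast
  \<comment> \<open>If the last column is in \<open>?D\<close>, the rest must avoid placements of
    the first \<open>L\<close> columns of \<open>a\<close>; otherwise it only has to avoid
    placements of all \<open>Suc L\<close> columns.\<close>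
  have eq: "shift_free c a (Suc L) (Suc n)
     = mono_sums (?C - ?D) (shift_free c a (Suc L) n) \<union> mono_sums ?D (shift_free c a L n)" (is "?l = ?r1 \<union> ?r2")
  proof (intro equalityI subsetI)
    fix m assume m: "m \<in> ?l"
    then have "m \<in> mono_sums ?C (all_monos V)" using all_monos_Un[OF disj] unfolding shift_free_def colV by simp
    then obtain s t where st: "s \<in> ?C" "t \<in> all_monos V" "m = s + t" unfolding mono_sums_def by auto
    have nh: "\<not> shift_divides c a (Suc L) n t" "\<not> (s \<in> ?D \<and> shift_divides c a L n t)"
      using m shift_divides_iff[OF st(1,2)] unfolding shift_free_def st(3) by blast+
    show "m \<in> ?r1 \<union> ?r2"
    proof (cases "s \<in> ?D")
      case True
      then have "(s, t) \<in> ?D \<times> shift_free c a L n" using nh st(2) unfolding shift_free_def V_def by simp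
      then show ?thesis unfolding mono_sums_def using st(3) by force
    next
      case False
      then have "(s, t) \<in> (?C - ?D) \<times> shift_free c a (Suc L) n" using nh st unfolding shift_free_def V_def by simp
      then show ?thesis unfolding mono_sums_def using st(3) by force
    qed
  next
    fix m assume "m \<in> ?r1 \<union> ?r2"
    then obtain s t where "m = s + t"
      "(s \<in> ?C - ?D \<and> t \<in> shift_free c a (Suc L) n) \<or> (s \<in> ?D \<and> t \<in> shift_free c a L n)"
      unfolding Un_iff mono_sums_iff by blast
    then have st: "m = s + t" "s \<in> ?C" "t \<in> all_monos V"
      "(s \<notin> ?D \<and> \<not> shift_divides c a (Suc L) n t) \<or> (s \<in> ?D \<and> \<not> shift_divides c a L n t)"
      using DC unfolding shift_free_def V_def by blast+
    have "\<not> shift_divides c a (Suc L) (Suc n) m"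
      \<comment> \<open>Avoiding placements of the first \<open>L\<close> columns implies avoiding
        those of the first \<open>Suc L\<close>.\<close>
      unfolding st(1) shift_divides_iff[OF st(2,3)] using st(4) shift_divides_Suc_row[of c a L n t] by blast
    moreover have "m \<in> all_monos ({1..c} \<times> {1..Suc n})"
      using st(1-3) unfolding colV all_monos_def by (auto simp: keys_mono_add)
    ultimately show "m \<in> ?l" unfolding shift_free_def by simp
  qed
  have uV: "shift_free c a l n \<subseteq> all_monos V" for l unfolding shift_free_def V_def by blast
  have inj: "inj_on (\<lambda>(s, t). s + t) (?C \<times> all_monos V)" by (rule inj_on_mono_sums[OF order_refl order_refl disj])
  have dj: "?r1 \<inter> ?r2 = {}"
  proof (rule ccontr)
    assume "?r1 \<inter> ?r2 \<noteq> {}"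
    then obtain m where m: "m \<in> ?r1" "m \<in> ?r2" by blast
    obtain s t where st: "s \<in> ?C - ?D" "t \<in> shift_free c a (Suc L) n" "m = s + t"
      using m(1) unfolding mono_sums_iff by blast
    obtain s' t' where st': "s' \<in> ?D" "t' \<in> shift_free c a L n" "m = s' + t'"
      using m(2) unfolding mono_sums_iff by blast
    have "(s, t) \<in> ?C \<times> all_monos V" "(s', t') \<in> ?C \<times> all_monos V" using st st' DC uV by blast+
    then have "(s, t) = (s', t')" using inj_onD[OF inj, of "(s, t)" "(s', t')"] st(3) st'(3) by simp
    then show False using st(1) st'(1) by blast
  qed
  have in_all: "mono_sums S T \<subseteq> all_monos ({1..c} \<times> {1..Suc n})" if "S \<subseteq> ?C" "T \<subseteq> all_monos V" for S T
    using that unfolding mono_sums_def colV all_monos_def by (auto simp: keys_mono_add subset_iff)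
  have g: "counting_series (shift_free c a (Suc L) (Suc n)) = counting_series (?C - ?D) * counting_series (shift_free c a (Suc L) n) + counting_series ?D * counting_series (shift_free c a L n)"
  proof -
    have "counting_series (?r1 \<union> ?r2) = counting_series ?r1 + counting_series ?r2"
      by (rule counting_series_Un[OF _ in_all[OF _ uV] in_all[OF DC uV] dj]) blast+
    also have "counting_series ?r1 = counting_series (?C - ?D) * counting_series (shift_free c a (Suc L) n)"
      by (rule counting_series_mono_sums[OF finc finV _ uV disj]) blast
    also have "counting_series ?r2 = counting_series ?D * counting_series (shift_free c a L n)"
      by (rule counting_series_mono_sums[OF finc finV DC uV disj])
    finally show ?thesis unfolding eq .
  qed
  have gC: "counting_series ?C * (1 - fps_X) ^ c = 1" using counting_series_all_monos[OF finc] unfolding col_def by simp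
  have gD: "counting_series ?D = fps_X ^ (\<Sum>i=1..c. a i (Suc L)) * counting_series ?C" unfolding counting_series_shift degu ..
  have "counting_series ((?C - ?D) \<union> ?D) = counting_series (?C - ?D) + counting_series ?D"
    by (rule counting_series_Un[OF finc _ DC]) blast+
  moreover have "(?C - ?D) \<union> ?D = ?C" using DC by blast
  ultimately have gCD: "counting_series (?C - ?D) = counting_series ?C - counting_series ?D" by simp
  let ?b = "\<Sum>i=1..c. a i (Suc L)" and ?z = "(1 - fps_X) ^ c :: rat fps"
  have "counting_series (shift_free c a (Suc L) (Suc n)) * ?z
     = (1 - fps_X ^ ?b) * counting_series (shift_free c a (Suc L) n) * (counting_series ?C * ?z) + fps_X ^ ?b * counting_series (shift_free c a L n) * (counting_series ?C * ?z)"
    unfolding g gCD gD by (simp add: algebra_simps)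
  then show ?thesis unfolding gC by simp
qed

text \<open>A zero column has degree 0, so the first term of the recursion vanishes and only a
  factor \<open>1 / (1 - fps_X) ^ c\<close> per column remains.\<close>

lemma counting_series_shift_free_zero_columns:
  assumes "\<And>i j. i \<in> {1..c} \<Longrightarrow> j \<in> {l<..l + k} \<Longrightarrow> a i j = 0"
  shows "counting_series (shift_free c a (l + k) (n + k)) * (1 - fps_X) ^ (c * k) = counting_series (shift_free c a l n)"
  using assms
proof (induction k)
  case (Suc k)
  have "(\<Sum>i=1..c. a i (Suc (l + k))) = 0" using Suc.prems by simp
  then have "counting_series (shift_free c a (Suc (l + k)) (Suc (n + k))) * (1 - fps_X) ^ c = counting_series (shift_free c a (l + k) (n + k))"
    using counting_series_shift_free_Suc[of c a "l + k" "n + k"] by simp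
  then show ?case using Suc by (simp add: power_add mult.assoc[symmetric])
qed simp

text \<open>Some nonzero column has to be placed, and it cannot divide the monomial 1. This makes
  the ideals proper.\<close>

lemma not_shift_divides_zero:
  "\<exists>i\<in>{1..c}. \<exists>j\<in>{1..L}. a i j \<noteq> 0 \<Longrightarrow> \<not> shift_divides c a L n 0"
proof (induction c a L n "0 :: mono" rule: shift_divides.induct)
  case (3 c a L n)
  show ?case
  proof (cases "\<exists>i\<in>{1..c}. a i (Suc L) \<noteq> 0")
    case True
    then show ?thesis using 3 by auto
  next
    case False
    obtain i j where ij: "i \<in> {1..c}" "j \<in> {1..Suc L}" "a i j \<noteq> 0" using 3(3) by blast
    then have "j \<noteq> Suc L" using False by blast
    then have "j \<in> {1..L}" using ij(2) by auto
    then have "\<exists>i\<in>{1..c}. \<exists>j\<in>{1..L}. a i j \<noteq> 0" using ij by blast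
    then have "\<not> shift_divides c a L n 0" by (rule 3(2))
    then show ?thesis using shift_divides_Suc_row[of c a L n 0] by auto
  qed
qed auto

lemma hilbert_series_shift_divides:
  assumes "\<exists>i\<in>{1..c}. \<exists>j\<in>{1..L}. a i j \<noteq> 0"
  shows "hilbert_series c n (monomial_ideal ({1..c} \<times> {1..n}) {m. shift_divides c a L n m} :: 'k::field mpol set) = counting_series (shift_free c a L n)"
proof -
  have n0: "0 \<notin> {m. shift_divides c a L n m}" using not_shift_divides_zero[OF assms] by simp
  have eq: "standard_monos ({1..c} \<times> {1..n}) {m. shift_divides c a L n m} j = {m \<in> shift_free c a L n. mono_degree m = j}" for j
    unfolding standard_monos_def shift_free_def all_monos_def by blast
  show ?thesis unfolding hilbert_series_def counting_series_def graded_dim_monomial_ideal[OF up_closed_shift_divides n0] eq ..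
qed

theorem corollary3p2:
  fixes c r :: nat and \<mu> :: "nat \<Rightarrow> nat" and a :: "nat \<Rightarrow> nat \<Rightarrow> nat"
    and I J :: "'k::field mpol set" and b :: "nat \<Rightarrow> nat" and \<delta> :: nat
  assumes c: "c \<ge> 1" and r: "r \<ge> 1"
    and mu: "strict_mono_on {1..r} \<mu>"
    and nonzero: "\<exists>i\<in>{1..c}. \<exists>j\<in>{1..\<mu> r}. a i j \<noteq> 0"
    and columns: "\<mu> ` {1..r} = {j \<in> {1..\<mu> r}. \<exists>i\<in>{1..c}. a i j \<noteq> 0}"
  defines "I \<equiv> orbit_ideal c (\<Prod>i=1..c. \<Prod>j=1..\<mu> r. xvar i j ^ a i j)"
    and "J \<equiv> orbit_ideal c (\<Prod>i=1..c. \<Prod>j=1..\<mu> (r - 1). xvar i j ^ a i j)"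
    and "b \<equiv> \<lambda>j. \<Sum>i=1..c. a i (\<mu> j)"
    and "\<delta> \<equiv> \<mu> r - \<mu> (r - 1)"
  shows "(\<forall>n\<ge>\<mu> r.
            cohen_macaulay (KXn c n Quot (I \<inter> carrier (KXn c n))) \<and>
            krull_dim (KXn c n Quot (I \<inter> carrier (KXn c n))) = enat (n * (c - 1) + \<mu> r - 1)) \<and>
         (r \<ge> 2 \<longrightarrow> (\<forall>n\<ge>\<delta>.
            hilbert_series c n (I \<inter> carrier (KXn c n)) =
              (1 - fps_X ^ b r) / (1 - fps_X) ^ c
                * hilbert_series c (n - 1) (I \<inter> carrier (KXn c (n - 1)))
              + fps_X ^ b r / (1 - fps_X) ^ (c * \<delta>)
                * hilbert_series c (n - \<delta>) (J \<inter> carrier (KXn c (n - \<delta>)))))"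
proof -
  have support: "\<mu> k \<in> {1..\<mu> r}" "\<exists>i\<in>{1..c}. a i (\<mu> k) \<noteq> 0" if "k \<in> {1..r}" for k
  proof -
    have "\<mu> k \<in> {j \<in> {1..\<mu> r}. \<exists>i\<in>{1..c}. a i j \<noteq> 0}" unfolding columns[symmetric] using that by (rule imageI)
    then show "\<mu> k \<in> {1..\<mu> r}" "\<exists>i\<in>{1..c}. a i (\<mu> k) \<noteq> 0" by blast+
  qed
  have rr: "r \<in> {1..r}" using r by simp
  have L1: "1 \<le> \<mu> r" using support(1)[OF rr] by simp
  have I: "I \<inter> carrier (KXn c n) = monomial_ideal ({1..c} \<times> {1..n}) {m. shift_divides c a (\<mu> r) n m}" for n
    unfolding I_def by (rule orbit_ideal_Int[where a = a, OF L1 support(2)[OF rr]])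
  have "cohen_macaulay (KXn c n Quot (I \<inter> carrier (KXn c n))) \<and>
    krull_dim (KXn c n Quot (I \<inter> carrier (KXn c n))) = enat (n * (c - 1) + \<mu> r - 1)" if n: "\<mu> r \<le> n" for n
  proof -
    define V where "V = {1..c} \<times> {1..n}"
    let ?M = "monomial_ideal V {m. shift_divides c a (\<mu> r) n m} :: 'k mpol set"
    have finV: "finite V" unfolding V_def by simp
    \<comment> \<open>By \<open>1 \<le> \<mu> r \<le> n\<close>, no truncated subtraction takes
      effect; the dimension is the number of variables minus \<open>n + 1 - \<mu> r\<close>.\<close>
    have "c * n = n * (c - 1) + n" using c by (cases c) auto
    then have d: "n * (c - 1) + \<mu> r - 1 = c * n - (n + 1 - \<mu> r)" using n L1 by linarith
    have idl: "ideal ?M (poly_ring V)"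
      unfolding ideal_poly_ring_iff by (rule is_ideal_monomial_ideal[OF up_closed_shift_divides])
    have "1 \<notin> ?M" using not_shift_divides_zero[OF nonzero, of n] unfolding monomial_ideal_def by simp
    moreover have "1 \<in> carrier (poly_ring V :: 'k mpol ring)" by simp
    ultimately have proper: "?M \<noteq> carrier (poly_ring V)" by metis
    show ?thesis unfolding I unfolding KXn_def V_def[symmetric] d
    proof (rule cring.cohen_macaulay_Quot[OF cring_poly_ring idl proper noetherian_poly_ring[OF finV]])
      fix P k assume "\<forall>i\<le>k. primeideal (P i) (poly_ring V)" "\<forall>i<k. P i \<subset> P (Suc i)" "?M \<subseteq> P 0"
      then show "k \<le> c * n - (n + 1 - \<mu> r)"
        using shift_divides_prime_chain_length[OF V_def L1 n] by blast
    next
      fix M :: "'k mpol set" assume M: "maximalideal M (poly_ring V)"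
      show "\<exists>xs. set xs \<subseteq> M \<and> length xs = c * n - (n + 1 - \<mu> r) \<and>
        (\<forall>i<c * n - (n + 1 - \<mu> r). \<forall>y\<in>carrier (poly_ring V).
           xs ! i \<otimes>\<^bsub>poly_ring V\<^esub> y \<in> Idl\<^bsub>poly_ring V\<^esub> (?M \<union> set (take i xs)) \<longrightarrow>
           (\<exists>u\<in>carrier (poly_ring V) - M. u \<otimes>\<^bsub>poly_ring V\<^esub> y \<in> Idl\<^bsub>poly_ring V\<^esub> (?M \<union> set (take i xs))))"
        unfolding poly_ring_simps by (rule local_regular_sequence[OF M V_def n])
    qed
  qed
  moreover
  have "hilbert_series c n (I \<inter> carrier (KXn c n)) =
      (1 - fps_X ^ b r) / (1 - fps_X) ^ c * hilbert_series c (n - 1) (I \<inter> carrier (KXn c (n - 1)))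
      + fps_X ^ b r / (1 - fps_X) ^ (c * \<delta>) * hilbert_series c (n - \<delta>) (J \<inter> carrier (KXn c (n - \<delta>)))"
    if r2: "2 \<le> r" and n: "\<delta> \<le> n" for n
  proof -
    define L where "L = \<mu> (r - 1)"
    have r1: "r - 1 \<in> {1..r}" using r2 by auto
    have L: "1 \<le> L" using support(1)[OF r1] unfolding L_def by simp
    have lt: "L < \<mu> r" unfolding L_def using r2 by (intro strict_mono_onD[OF mu]) auto
    have J: "J \<inter> carrier (KXn c n) = monomial_ideal ({1..c} \<times> {1..n}) {m. shift_divides c a L n m}" for n
      unfolding J_def L_def[symmetric]
      by (rule orbit_ideal_Int[where a = a, OF L support(2)[OF r1, folded L_def]])
    have Lnz: "\<exists>i\<in>{1..c}. \<exists>j\<in>{1..L}. a i j \<noteq> 0"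
      using support(2)[OF r1] L unfolding L_def[symmetric] by fastforce
    \<comment> \<open>\<open>k\<close> counts the zero columns strictly between
      \<open>\<mu> (r - 1)\<close> and \<open>\<mu> r\<close>.\<close>
    define k where "k = \<delta> - 1"
    have k: "\<delta> = Suc k" "\<mu> r = Suc (L + k)" using lt unfolding k_def \<delta>_def L_def[symmetric] by auto
    obtain n' where n': "n = Suc (n' + k)" using n k(1) by (metis add.commute add_Suc_right le_Suc_ex)
    have zero: "a i j = 0" if "i \<in> {1..c}" "j \<in> {L<..L + k}" for i j
    proof (rule ccontr)
      assume "a i j \<noteq> 0"
      then have "j \<in> \<mu> ` {1..r}" unfolding columns using that k(2) by auto
      then obtain s where s: "s \<in> {1..r}" "j = \<mu> s" by blast
      show False
      proof (cases "s = r")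
        case False
        then have "\<mu> s \<le> L" unfolding L_def
          using s(1) r1 by (intro strict_mono_on_leD[OF mu]) auto
        then show False using s that by simp
      qed (use s that k(2) in simp)
    qed
    let ?z = "1 - fps_X :: rat fps" and ?t = "fps_X ^ b r :: rat fps"
    define G where "G l m = counting_series (shift_free c a l m)" for l m
    \<comment> \<open>One step of the recursion removes the nonzero column \<open>\<mu> r\<close>;
      then the \<open>k\<close> zero columns before it are removed. Together they produce the
      exponent \<open>c * \<delta> = c + c * k\<close>.\<close>
    have G1: "G (\<mu> r) n * ?z ^ c = (1 - ?t) * G (\<mu> r) (n' + k) + ?t * G (L + k) (n' + k)"
      unfolding G_def b_def n' k(2) by (rule counting_series_shift_free_Suc)
    have G2: "G (L + k) (n' + k) * ?z ^ (c * k) = G L n'"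
      unfolding G_def by (rule counting_series_shift_free_zero_columns[OF zero])
    \<comment> \<open>Powers of \<open>1 - fps_X\<close> have constant term 1, so the divisions in
      the claim are multiplications by inverses.\<close>
    have z0: "fps_nth (?z ^ m) 0 \<noteq> 0" for m by (simp add: fps_power_zeroth)
    have inv: "x / ?z ^ m = x * inverse (?z ^ m)" "inverse (?z ^ m) * ?z ^ m = 1" for x m
      using fps_divide_unit[OF z0, of x m] inverse_mult_eq_1[OF z0, of m] by auto
    define Z W where "Z = inverse (?z ^ c)" and "W = inverse (?z ^ (c * k))"
    have G2': "G (L + k) (n' + k) = G L n' * W"
      unfolding W_def G2[symmetric] mult.assoc mult.commute[of "?z ^ (c * k)"] inv(2) by simp
    have "G (\<mu> r) n = G (\<mu> r) n * ?z ^ c * Z"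
      unfolding Z_def mult.assoc mult.commute[of "?z ^ c"] inv(2) by simp
    also have "\<dots> = (1 - ?t) * Z * G (\<mu> r) (n' + k) + ?t * (Z * W) * G L n'"
      unfolding G1 G2' by (simp only: algebra_simps)
    also have "Z * W = inverse (?z ^ (c * \<delta>))"
      unfolding Z_def W_def k(1) by (simp add: power_add fps_inverse_mult)
    finally have "G (\<mu> r) n = (1 - ?t) / ?z ^ c * G (\<mu> r) (n' + k) + ?t / ?z ^ (c * \<delta>) * G L n'"
      unfolding inv(1) Z_def .
    moreover have "n - 1 = n' + k" "n - \<delta> = n'" using n' k(1) by auto
    ultimately show ?thesis
      unfolding I J hilbert_series_shift_divides[OF nonzero] hilbert_series_shift_divides[OF Lnz] G_def by simp
  qed
  ultimately show ?thesis by blast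
qed

end
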